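(* Let $L>\pi$ and $c\in\left(1+\frac{\pi}{L-\pi},+\infty\right)$, and let $$\phi_c(\xi)=\frac{2c\pi}{L}\left(\frac{\sinh(\eta)}{\cosh(\eta)-\cos\left(\frac{\pi\xi}{L}\right)}\right),\qquad \eta=\tanh^{-1}\left(\frac{c\pi}{(c-1)L}\right).$$ Then the orbit $\mathcal{O}_{\phi_c}=\{\phi_c(\cdot+y):y\in\mathbb{R}\}$ is nonlinearly (orbitally) stable with regard to the periodic flow generated by the regularized Benjamin-Ono equation $$u_t+u_x+uu_x+\mathcal{H}u_{xt}=0.$$ That is, for every $\epsilon>0$ there exists $\delta(\epsilon)>0$ such that if $u_0\in H^{\frac32}_{per}([-L,L])$ and $$\inf_{y\in\mathbb{R}}\|u_0-\phi_c(\cdot+y)\|_{H^{1/2}_{per}}<\delta,$$ then the solution $u$ of the equation with initial datum $u_0$ satisfies, for all $t\in\mathbb{R}$ and some $y=y(t)\in\mathbb{R}$, $$\|u(t)-\phi_c(\cdot+y)\|_{H^{1/2}_{per}}<\epsilon.$$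
   Context: All functions are $2L$-periodic and $u$ is real-valued. $\widehat f(k)=\frac1{2L}\int_{-L}^Lf(x)e^{-ik\pi x/L}dx$, $k\in\mathbb{Z}$; $H^s_{per}([-L,L])$ is the Sobolev space of $2L$-periodic distributions with norm $\|f\|^2_{H^s_{per}}=2L\sum_{k\in\mathbb{Z}}(1+|k|^2)^s|\widehat f(k)|^2$. $\mathcal{H}$ is the Hilbert transform $\widehat{\mathcal{H}f}(k)=-i\,\mathrm{sgn}(k)\widehat f(k)$. The function $\phi_c$ is a periodic travelling wave profile: $u(x,t)=\phi_c(x-ct)$ solves the equation. The solution with datum $u_0\in H^{3/2}_{per}$ is the global solution in $C(\mathbb{R};H^{3/2}_{per})$ (the initial value problem is globally well-posed in $H^s_{per}$ for $s\ge 3/2$). *)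

theory Defs
  imports "HOL-Analysis.Analysis"
begin

definition fourier_coeff :: "real \<Rightarrow> (real \<Rightarrow> real) \<Rightarrow> int \<Rightarrow> complex" where
  "fourier_coeff L f k =
     1 / complex_of_real (2 * L) *
     (\<integral>x. complex_of_real (f x) * cis (- (of_int k * pi * x / L)) \<partial>lebesgue_on {-L..L})"

text \<open>The real-valued elements of \<open>H\<^sup>s\<^sub>p\<^sub>e\<^sub>r([-L,L])\<close>, intended for \<open>s \<ge> 0\<close> only: there the space
  consists of square-integrable functions, and its elements are represented by functions
  rather than by classes modulo null sets.\<close>

definition sobolev_per :: "real \<Rightarrow> real \<Rightarrow> (real \<Rightarrow> real) set" where
  "sobolev_per L s = {f.
     (\<forall>x. f (x + 2 * L) = f x) \<and>
     f \<in> borel_measurable (lebesgue_on {-L..L}) \<and>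
     integrable (lebesgue_on {-L..L}) (\<lambda>x. (f x)\<^sup>2) \<and>
     (\<lambda>k. (1 + (real_of_int k)\<^sup>2) powr s * (cmod (fourier_coeff L f k))\<^sup>2) summable_on UNIV}"

definition sobolev_per_norm :: "real \<Rightarrow> real \<Rightarrow> (real \<Rightarrow> real) \<Rightarrow> real" where
  "sobolev_per_norm L s f =
     sqrt (2 * L *
       (\<Sum>\<^sub>\<infinity>k\<in>UNIV. (1 + (real_of_int k)\<^sup>2) powr s * (cmod (fourier_coeff L f k))\<^sup>2))"

text \<open>Periodic distributions are identified with their sequences of Fourier coefficients;
  the next two operators act on such sequences.\<close>

definition deriv_hat :: "real \<Rightarrow> (int \<Rightarrow> complex) \<Rightarrow> int \<Rightarrow> complex" where
  "deriv_hat L a k = \<i> * of_int k * of_real (pi / L) * a k"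

definition hilbert_hat :: "(int \<Rightarrow> complex) \<Rightarrow> int \<Rightarrow> complex" where
  "hilbert_hat a k = - \<i> * of_int (sgn k) * a k"

definition sobolev_continuous :: "real \<Rightarrow> real \<Rightarrow> (real \<Rightarrow> real \<Rightarrow> real) \<Rightarrow> bool" where
  "sobolev_continuous L s u \<longleftrightarrow>
     (\<forall>t. u t \<in> sobolev_per L s) \<and>
     (\<forall>t. ((\<lambda>\<tau>. sobolev_per_norm L s (\<lambda>x. u \<tau> x - u t x)) \<longlongrightarrow> 0) (at t))"

text \<open>Global solutions in \<open>C(\<real>; H\<^sup>3\<^sup>/\<^sup>2\<^sub>p\<^sub>e\<^sub>r)\<close> of \<open>u\<^sub>t + u\<^sub>x + u u\<^sub>x + \<H> u\<^sub>x\<^sub>t = 0\<close>, where \<open>u t x\<close> is the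
  value at time \<open>t\<close> and position \<open>x\<close>. The equation is imposed at every time in the sense of
  periodic distributions in \<open>x\<close>. The distribution \<open>ut = u\<^sub>t(t)\<close> is given by its Fourier coefficients;
  \<open>ux = u\<^sub>x(t)\<close> is a function of class \<open>H\<^sup>1\<^sup>/\<^sup>2\<close>, so that \<open>u u\<^sub>x\<close> is an honest product of functions.\<close>

definition rBO_solution :: "real \<Rightarrow> (real \<Rightarrow> real \<Rightarrow> real) \<Rightarrow> bool" where
  "rBO_solution L u \<longleftrightarrow>
     sobolev_continuous L (3/2) u \<and>
     (\<forall>t. \<exists>ut. \<exists>ux \<in> sobolev_per L (1/2).
        (\<forall>k. ((\<lambda>\<tau>. fourier_coeff L (u \<tau>) k) has_vector_derivative ut k) (at t)) \<and>
        fourier_coeff L ux = deriv_hat L (fourier_coeff L (u t)) \<and>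
        (\<forall>k. ut k + fourier_coeff L ux k + fourier_coeff L (\<lambda>x. u t x * ux x) k
             + hilbert_hat (deriv_hat L ut) k = 0))"

definition rBO_wave :: "real \<Rightarrow> real \<Rightarrow> real \<Rightarrow> real" where
  "rBO_wave L c \<xi> =
     (let \<eta> = artanh (c * pi / ((c - 1) * L))
      in 2 * c * pi / L * (sinh \<eta> / (cosh \<eta> - cos (pi * \<xi> / L))))"

end

theory Submission imports Defs "HOL-Real_Asymp.Real_Asymp" begin

text \<open>With \<open>\<kappa> = \<pi>/L\<close> and \<open>r = exp (-\<eta>)\<close> the profile has the Fourier coefficients \<open>2 c \<kappa> r\<^bsup>|k|\<^esup>\<close>, so it
  is a multiple of a Poisson kernel \<open>P\<close>. It is a critical point of the conserved action
  \<open>c/2 F - E\<close>, where \<open>F\<close> is the quadratic and \<open>E\<close> the cubic invariant, and the second variation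
  there is \<open>c \<kappa> (|D| + \<omega> - 2 P)\<close> with \<open>\<omega> = coth \<eta>\<close>. This operator leaves the span of \<open>P\<close>, \<open>|D| P\<close>
  and \<open>P'\<close> invariant. On the orthogonal complement of this span the nonnegative frequencies of a real
  function, with the zero mode suitably shared, form a power series vanishing to second order at \<open>r\<close>.
  Dividing by the square of a Blaschke factor turns \<open>|D| - 2 P\<close> into \<open>|D|\<close>, and the second variation
  is at least \<open>\<omega>\<close>. On the span it is an explicit \<open>2 \<times> 2\<close> matrix (besides the kernel \<open>P'\<close>) whose only
  negative direction is removed by a penalty on the derivative of \<open>F\<close>; the kernel is removed by
  translating so that the first Fourier coefficient is positive. Hence the action plus a multiple of the
  square of the deviation of \<open>F\<close> is a conserved Lyapunov function, comparable near the orbit with the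
  squared \<open>H\<^sup>1\<^sup>/\<^sup>2\<close> distance to it, and stability follows by continuity in time.\<close>

section \<open>Sequences with the decay of Fourier coefficients of \<open>H\<^sup>3\<^sup>/\<^sup>2\<close> functions\<close>

text \<open>The second variation is bounded below by comparing two explicit quadratic forms instead
  of by spectral theory: the tridiagonal inverse of multiplication by P factors into two first-order
  differences, and after two divisions by z - r the difference of the forms telescopes. On the span,
  the value of the form on the null line of the penalty has the sign of 1 + 2 kappa omega - kappa^2
  with kappa = pi / L and omega > 1, which is positive since kappa < 1; this sign decides stability.

  The regularity shapes the rest. Solutions are only continuous into H^(3/2), so the invariants are
  differentiated after truncation in frequency and the truncation is removed in the limit. For this
  everything is phrased with Fourier coefficients, and what is kept of H^(3/2) is the pointwise
  bound \<open>psi\<close>: it is summable, and so is its square times 1 + |k|, which covers the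
  H^(1/2) norm. A derivative reduces it to boundedness, so the trilinear sums admit one merely
  bounded slot. Integration in x serves to identify the coefficients of u u_x as a convolution, and
  those of the wave as a geometric sequence.\<close>

definition psi :: "int \<Rightarrow> real" where
  "psi k = (1 + real_of_int \<bar>k\<bar>) powr (-3/2)"

lemma psi_pos: "psi k > 0"
  by (simp add: psi_def)

lemma psi_minus [simp]: "psi (-k) = psi k"
  by (simp add: psi_def)

lemma psi_le_1: "psi k \<le> 1"
proof -
  have "(1 + real_of_int \<bar>k\<bar>) powr (-3/2) \<le> 1 powr (-3/2)"
    by (intro powr_mono2') auto
  then show ?thesis by (simp add: psi_def)
qed

lemma weight_psi_square: "(1 + real_of_int \<bar>k\<bar>) ^ 3 * (psi k)\<^sup>2 = 1"
proof -
  have p: "1 + real_of_int \<bar>k\<bar> > 0" by simp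
  have "(psi k)\<^sup>2 = (1 + real_of_int \<bar>k\<bar>) powr (-3)"
    by (simp add: psi_def power2_eq_square flip: powr_add)
  also have "\<dots> = inverse ((1 + real_of_int \<bar>k\<bar>) ^ 3)"
    using p by (simp add: powr_minus powr_numeral)
  finally show ?thesis using p by simp
qed

lemma weight_psi_le: "(1 + real_of_int \<bar>k\<bar>) * (psi k)\<^sup>2 \<le> psi k"
proof -
  have p: "1 + real_of_int \<bar>k\<bar> > 0" by simp
  have "(1 + real_of_int \<bar>k\<bar>) * psi k = (1 + real_of_int \<bar>k\<bar>) powr (-1/2)"
    using powr_add[of "1 + real_of_int \<bar>k\<bar>" 1 "-3/2"] p by (simp add: psi_def)
  also have "\<dots> \<le> 1 powr (-1/2)"
    by (intro powr_mono2') auto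
  finally have "(1 + real_of_int \<bar>k\<bar>) * psi k \<le> 1" by simp
  then have "(1 + real_of_int \<bar>k\<bar>) * psi k * psi k \<le> 1 * psi k"
    using psi_pos[of k] by (intro mult_right_mono) auto
  then show ?thesis by (simp add: power2_eq_square mult.assoc)
qed

lemma weight_psi_le_1: "(1 + real_of_int \<bar>k\<bar>) * psi k \<le> 1"
proof -
  have "(1 + real_of_int \<bar>k\<bar>) * psi k * psi k \<le> 1 * psi k"
    using weight_psi_le[of k] by (simp add: power2_eq_square mult.assoc)
  then show ?thesis using psi_pos[of k] by (metis mult_le_cancel_right_pos)
qed

section \<open>Folding sums over the integers\<close>

lemma int_UNIV_split: "(UNIV :: int set) = insert 0 (range (\<lambda>n. int n + 1) \<union> range (\<lambda>n. - int n - 1))"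
proof -
  have "x = 0 \<or> x \<in> range (\<lambda>n. int n + 1) \<or> x \<in> range (\<lambda>n. - int n - 1)" for x :: int
  proof (cases "x \<ge> 0")
    case True
    then have "x = 0 \<or> x = int (nat (x - 1)) + 1" by linarith
    then show ?thesis by blast
  next
    case False
    then have "x = - int (nat (- x - 1)) - 1" by simp
    then show ?thesis by blast
  qed
  then show ?thesis by blast
qed

text \<open>The frequencies n + 1 and -n - 1 are opposite, so for real sequences the two half sums
  are conjugate to each other.\<close>

lemma has_sum_int_fold:
  fixes f :: "int \<Rightarrow> 'a::{topological_comm_monoid_add, t2_space}"
  assumes "((\<lambda>n. f (int n + 1)) has_sum S) UNIV" "((\<lambda>n. f (- int n - 1)) has_sum T) UNIV"
  shows "(f has_sum (f 0 + (S + T))) UNIV"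
proof -
  have 1: "(f has_sum S) (range (\<lambda>n. int n + 1))"
    using assms(1) by (subst has_sum_reindex) (auto simp: inj_def o_def)
  have 2: "(f has_sum T) (range (\<lambda>n. - int n - 1))"
    using assms(2) by (subst has_sum_reindex) (auto simp: inj_def o_def)
  have 3: "(f has_sum (S + T)) (range (\<lambda>n. int n + 1) \<union> range (\<lambda>n. - int n - 1))"
    by (intro has_sum_Un_disjoint 1 2) auto
  show ?thesis
    unfolding int_UNIV_split by (intro has_sum_insert 3) auto
qed

lemma summable_on_int_foldD:
  fixes f :: "int \<Rightarrow> 'a::banach"
  assumes "f summable_on UNIV"
  shows "(\<lambda>n. f (int n + 1)) summable_on UNIV" "(\<lambda>n. f (- int n - 1)) summable_on UNIV"
proof -
  have "f summable_on range (\<lambda>n. int n + 1)" "f summable_on range (\<lambda>n. - int n - 1)"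
    using assms summable_on_subset_banach by blast+
  moreover have "inj (\<lambda>n. int n + 1)" "inj (\<lambda>n. - int n - 1)" by (auto simp: inj_def)
  ultimately have "(f \<circ> (\<lambda>n. int n + 1)) summable_on UNIV" "(f \<circ> (\<lambda>n. - int n - 1)) summable_on UNIV"
    by (simp_all only: summable_on_reindex)
  then show "(\<lambda>n. f (int n + 1)) summable_on UNIV" "(\<lambda>n. f (- int n - 1)) summable_on UNIV"
    by (simp_all only: o_def)
qed

lemma infsum_int_fold:
  fixes f :: "int \<Rightarrow> 'a::banach"
  assumes "f summable_on UNIV"
  shows "infsum f UNIV = f 0 + ((\<Sum>\<^sub>\<infinity>n. f (int n + 1)) + (\<Sum>\<^sub>\<infinity>n. f (- int n - 1)))"
  using has_sum_int_fold[OF has_sum_infsum[OF summable_on_int_foldD(1)[OF assms]]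
      has_sum_infsum[OF summable_on_int_foldD(2)[OF assms]]] by (rule infsumI)

lemma psi_summable: "psi summable_on UNIV"
proof -
  have "summable (\<lambda>n. real n powr (-3/2))"
    by (subst summable_real_powr_iff) auto
  then have "summable (\<lambda>n. real (Suc (Suc n)) powr (-3/2))"
    by (subst summable_Suc_iff, subst summable_Suc_iff) 
  then have s: "(\<lambda>n. real (Suc (Suc n)) powr (-3/2)) summable_on UNIV"
    by (intro summable_nonneg_imp_summable_on) auto
  have 1: "(\<lambda>n. psi (int n + 1)) summable_on UNIV"
    using s by (rule summable_on_cong[THEN iffD1, rotated]) (simp add: psi_def add_ac)
  have "psi (- int n - 1) = psi (int n + 1)" for n
    using psi_minus[of "int n + 1"] by (simp only: minus_add_distrib diff_conv_add_uminus)
  then have 2: "(\<lambda>n. psi (- int n - 1)) summable_on UNIV"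
    using 1 by simp
  show ?thesis
    using has_sum_int_fold[OF has_sum_infsum[OF 1] has_sum_infsum[OF 2]] by (rule has_sum_imp_summable)
qed

lemma norm_summable_psi:
  fixes g :: "int \<Rightarrow> 'a::real_normed_vector"
  assumes "\<And>k. norm (g k) \<le> C * psi k"
  shows "(\<lambda>k. norm (g k)) summable_on UNIV"
  by (rule summable_on_comparison_test[of "\<lambda>k. C * psi k"])
     (use assms psi_summable in \<open>auto intro!: summable_on_cmult_right\<close>)

lemma summable_psi:
  fixes g :: "int \<Rightarrow> 'a::banach"
  assumes "\<And>k. norm (g k) \<le> C * psi k"
  shows "g summable_on UNIV"
  using norm_summable_psi[OF assms] by (rule abs_summable_summable)

section \<open>Sequences bounded by a multiple of \<open>psi\<close>\<close>

definition decaying :: "(int \<Rightarrow> complex) \<Rightarrow> bool" where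
  "decaying a \<longleftrightarrow> (\<exists>C. \<forall>k. cmod (a k) \<le> C * psi k)"

lemma decayingE:
  assumes "decaying a"
  obtains C where "C > 0" "\<And>k. cmod (a k) \<le> C * psi k" "\<And>k. cmod (a k) \<le> C"
proof -
  obtain C where C: "\<And>k. cmod (a k) \<le> C * psi k" using assms unfolding decaying_def by blast
  have le: "cmod (a k) \<le> (\<bar>C\<bar> + 1) * psi k" for k
    using C[of k] psi_pos[of k] by (smt (verit, best) mult_right_mono)
  moreover have "(\<bar>C\<bar> + 1) * psi k \<le> (\<bar>C\<bar> + 1) * 1" for k
    using psi_le_1[of k] by (intro mult_left_mono) auto
  ultimately have "cmod (a k) \<le> \<bar>C\<bar> + 1" for k by (metis mult.right_neutral order_trans)
  with le show thesis using that[of "\<bar>C\<bar> + 1"] by simp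
qed

lemma decaying_add: "decaying a \<Longrightarrow> decaying b \<Longrightarrow> decaying (\<lambda>k. a k + b k)"
proof (elim decayingE)
  fix C D assume "\<And>k. cmod (a k) \<le> C * psi k" "\<And>k. cmod (b k) \<le> D * psi k"
  then have "cmod (a k + b k) \<le> (C + D) * psi k" for k
    by (smt (verit, best) distrib_right norm_triangle_ineq)
  then show ?thesis unfolding decaying_def by blast
qed

lemma decaying_bounded_mult:
  assumes "decaying a" "\<And>k. cmod (m k) \<le> B"
  shows "decaying (\<lambda>k. m k * a k)"
proof -
  obtain C where C: "C > 0" "\<And>k. cmod (a k) \<le> C * psi k" using decayingE[OF assms(1)] by metis
  have "cmod (m k * a k) \<le> (B * C) * psi k" for k
    unfolding norm_mult mult.assoc by (intro mult_mono assms C) (use assms(2) in \<open>auto intro: order_trans[OF norm_ge_zero]\<close>)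
  then show ?thesis unfolding decaying_def by blast
qed

lemma decaying_cmult: "decaying a \<Longrightarrow> decaying (\<lambda>k. c * a k)"
  by (rule decaying_bounded_mult[of _ "\<lambda>_. c" "cmod c"]) auto

lemma decaying_diff: "decaying a \<Longrightarrow> decaying b \<Longrightarrow> decaying (\<lambda>k. a k - b k)"
  using decaying_add[of a "\<lambda>k. (-1) * b k"] decaying_cmult[of b "-1"] by simp

lemma decaying_norm_summable: "decaying a \<Longrightarrow> (\<lambda>k. cmod (a k)) summable_on UNIV"
  by (elim decayingE) (rule norm_summable_psi)

text \<open>Differentiation costs one power of the weight, after which the bound \<open>psi\<close>
  leaves mere boundedness. This is why several lemmas below allow one factor that is only
  bounded.\<close>

lemma derivative_bound:
  assumes "\<And>k. cmod (a k) \<le> C * psi k"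
  shows "cmod (of_int k * a k) \<le> C"
proof -
  have C0: "C \<ge> 0" using order_trans[OF norm_ge_zero assms[of 0]] psi_pos[of 0] by (simp add: zero_le_mult_iff)
  have "cmod (of_int k * a k) \<le> (1 + real_of_int \<bar>k\<bar>) * (C * psi k)"
    unfolding norm_mult by (intro mult_mono assms) auto
  also have "\<dots> = C * ((1 + real_of_int \<bar>k\<bar>) * psi k)" by simp
  also have "\<dots> \<le> C * 1" using C0 by (intro mult_left_mono weight_psi_le_1) auto
  finally show ?thesis by simp
qed

lemma decaying_mult_bound:
  assumes "decaying a" "decaying b"
  obtains C where "\<And>k. (1 + real_of_int \<bar>k\<bar>) * (cmod (a k) * cmod (b k)) \<le> C * psi k"
proof -
  obtain C where C: "C > 0" "\<And>k. cmod (a k) \<le> C * psi k" using decayingE[OF assms(1)] by metis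
  obtain D where D: "D > 0" "\<And>k. cmod (b k) \<le> D * psi k" using decayingE[OF assms(2)] by metis
  have "(1 + real_of_int \<bar>k\<bar>) * (cmod (a k) * cmod (b k)) \<le> (1 + real_of_int \<bar>k\<bar>) * ((C * psi k) * (D * psi k))" for k
    by (intro mult_left_mono mult_mono C D) (use C(1) psi_pos[of k] in auto)
  also have "\<dots>k = (C * D) * ((1 + real_of_int \<bar>k\<bar>) * (psi k)\<^sup>2)" for k
    by (simp add: power2_eq_square)
  also have "\<dots>k \<le> (C * D) * psi k" for k
    using weight_psi_le[of k] C(1) D(1) by (intro mult_left_mono) auto
  finally show thesis using that by blast
qed

lemma decaying_weighted_summable:
  fixes g :: "int \<Rightarrow> 'a::banach"
  assumes "decaying a" "decaying b" "\<And>k. norm (g k) \<le> B * ((1 + real_of_int \<bar>k\<bar>) * (cmod (a k) * cmod (b k)))"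
    "B \<ge> 0"
  shows "g summable_on UNIV"
proof -
  obtain C where C: "\<And>k. (1 + real_of_int \<bar>k\<bar>) * (cmod (a k) * cmod (b k)) \<le> C * psi k"
    using decaying_mult_bound[OF assms(1,2)] by blast
  have "norm (g k) \<le> (B * C) * psi k" for k
    using assms(3)[of k] mult_left_mono[OF C[of k] assms(4)] by (simp add: mult.assoc)
  then show ?thesis by (rule summable_psi)
qed

lemma poly_times_power_bounded:
  assumes "0 < r" "r < (1::real)"
  shows "\<exists>C. \<forall>n::nat. (1 + real n) ^ j * r ^ n \<le> C"
proof -
  have "(\<lambda>n. (1 + real n) ^ j * r ^ n) \<longlonglongrightarrow> 0"
    using assms by real_asymp
  then have "Bseq (\<lambda>n. (1 + real n) ^ j * r ^ n)"
    using convergent_imp_Bseq convergentI by blast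
  then obtain C where "\<And>n. norm ((1 + real n) ^ j * r ^ n) \<le> C" unfolding Bseq_def by blast
  then show ?thesis by (auto intro: exI[of _ C] order_trans[OF abs_ge_self])
qed

lemma decaying_poly_exp:
  assumes "0 < r" "r < (1::real)" and "\<And>k. cmod (a k) \<le> B * ((1 + real_of_int \<bar>k\<bar>) ^ j * r ^ nat \<bar>k\<bar>)" "B \<ge> 0"
  shows "decaying a"
proof -
  \<comment> \<open>Two more powers of the weight w are requested to pay for \<open>psi\<close>,
    because w^2 \<open>psi\<close> >= 1.\<close>
  obtain C where C: "\<And>n::nat. (1 + real n) ^ (j + 2) * r ^ n \<le> C"
    using poly_times_power_bounded[OF assms(1,2)] by blast
  have le: "(1 + real_of_int \<bar>k\<bar>) ^ j * r ^ nat \<bar>k\<bar> \<le> C * psi k" for k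
  proof -
    let ?w = "1 + real_of_int \<bar>k\<bar>"
    have "?w powr (3/2) \<le> ?w powr 2" by (intro powr_mono) auto
    then have "1 \<le> ?w ^ 2 * psi k"
      using psi_pos[of k] by (simp add: psi_def powr_minus_divide divide_simps)
    then have "?w ^ j * r ^ nat \<bar>k\<bar> * 1 \<le> ?w ^ j * r ^ nat \<bar>k\<bar> * (?w ^ 2 * psi k)"
      using assms(1) by (intro mult_left_mono) auto
    also have "\<dots> = ((1 + real (nat \<bar>k\<bar>)) ^ (j + 2) * r ^ nat \<bar>k\<bar>) * psi k"
      by (simp add: power_add power2_eq_square)
    also have "\<dots> \<le> C * psi k" using C[of "nat \<bar>k\<bar>"] psi_pos[of k] by (intro mult_right_mono) auto
    finally show ?thesis by simp
  qed
  then have "cmod (a k) \<le> (B * C) * psi k" for k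
    using assms(3)[of k] mult_left_mono[OF le[of k] assms(4)] by (simp only: mult.assoc)
  then show ?thesis unfolding decaying_def by blast
qed

lemma psi_antimono_nat: "psi (int (k + j)) \<le> psi (int k)"
  unfolding psi_def by (intro powr_mono2') auto

text \<open>Peetre's inequality for the exponent 3/2, with the last weight rounded up to the integer
  power 2. It lets a convolution with an exponentially decaying kernel move \<open>psi\<close> from
  the inner to the outer frequency.\<close>

lemma psi_Peetre: "psi l \<le> psi k * (1 + real_of_int \<bar>k - l\<bar>) ^ 2"
proof -
  have "1 + real_of_int \<bar>k\<bar> \<le> (1 + real_of_int \<bar>l\<bar>) * (1 + real_of_int \<bar>k - l\<bar>)"
  proof -
    have "real_of_int \<bar>k\<bar> \<le> real_of_int \<bar>l\<bar> + real_of_int \<bar>k - l\<bar>" by linarith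
    moreover have "0 \<le> real_of_int \<bar>l\<bar> * real_of_int \<bar>k - l\<bar>" by simp
    ultimately show ?thesis by (simp only: distrib_left distrib_right mult_1_left mult_1_right)
  qed
  then have "(1 + real_of_int \<bar>k\<bar>) powr (3/2) \<le> ((1 + real_of_int \<bar>l\<bar>) * (1 + real_of_int \<bar>k - l\<bar>)) powr (3/2)"
    by (intro powr_mono2) auto
  also have "\<dots> = (1 + real_of_int \<bar>l\<bar>) powr (3/2) * (1 + real_of_int \<bar>k - l\<bar>) powr (3/2)"
    by (simp add: powr_mult)
  also have "\<dots> \<le> (1 + real_of_int \<bar>l\<bar>) powr (3/2) * (1 + real_of_int \<bar>k - l\<bar>) powr 2"
    by (intro mult_left_mono powr_mono) auto
  finally have "(1 + real_of_int \<bar>k\<bar>) powr (3/2) \<le> (1 + real_of_int \<bar>l\<bar>) powr (3/2) * (1 + real_of_int \<bar>k - l\<bar>) ^ 2"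
    by (simp add: powr_numeral)
  moreover have "1 + \<bar>real_of_int k\<bar> \<noteq> 0" "1 + \<bar>real_of_int l\<bar> \<noteq> 0" by linarith+
  ultimately show ?thesis by (simp add: psi_def powr_minus_divide divide_simps mult.commute)
qed

section \<open>Multiplication by the Poisson kernel in Fourier space\<close>

definition ker :: "real \<Rightarrow> int \<Rightarrow> real" where
  "ker r d = r ^ nat \<bar>d\<bar>"

text \<open>Multiplication by the Poisson kernel \<open>\<Sum>k. r\<^bsup>|k|\<^esup> cis (k x) = (1 - r\<^sup>2) / (1 + r\<^sup>2 - 2 r cos x)\<close>, on Fourier
  coefficients; its inverse \<open>kinv\<close> is a tridiagonal operator, which is how convolutions are evaluated below.\<close>

definition kconv :: "real \<Rightarrow> (int \<Rightarrow> complex) \<Rightarrow> int \<Rightarrow> complex" where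
  "kconv r v k = (\<Sum>\<^sub>\<infinity>l. of_real (ker r (k - l)) * v l)"

definition kinv :: "real \<Rightarrow> (int \<Rightarrow> complex) \<Rightarrow> int \<Rightarrow> complex" where
  "kinv r y k = (of_real (1 + r\<^sup>2) * y k - of_real r * y (k + 1) - of_real r * y (k - 1)) / of_real (1 - r\<^sup>2)"

lemma ker_minus [simp]: "ker r (-k) = ker r k"
  by (simp add: ker_def)

lemma ker_minus_commute: "ker r (k - l) = ker r (l - k)"
  by (simp add: ker_def abs_minus_commute)

text \<open>A geometric sequence in |d| solves the recurrence on each side of 0, and the kink at 0
  produces the right-hand side: up to the factor 1 - r^2, \<open>ker r\<close> is a Green's function
  of the tridiagonal operator.\<close>

lemma ker_second_difference:
  "(1 + r\<^sup>2) * ker r d - r * ker r (d + 1) - r * ker r (d - 1) = (if d = 0 then 1 - r\<^sup>2 else 0)"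
proof -
  have pos: "(1 + r\<^sup>2) * ker r d - r * ker r (d + 1) - r * ker r (d - 1) = 0" if "d > 0" for d
  proof -
    define n where "n = nat (d - 1)"
    have n: "d = int n + 1" using that by (simp add: n_def)
    have "nat \<bar>d\<bar> = Suc n" "nat \<bar>d + 1\<bar> = Suc (Suc n)" "nat \<bar>d - 1\<bar> = n" using n by auto
    then show ?thesis by (simp add: ker_def algebra_simps power2_eq_square)
  qed
  consider "d > 0" | "d = 0" | "- d > 0" by linarith
  then show ?thesis
  proof cases
    case 3
    have "ker r (d + 1) = ker r (- d - 1)" "ker r (d - 1) = ker r (- d + 1)"
      unfolding ker_def by (intro arg_cong[where f = "\<lambda>x. r ^ nat x"], linarith)+
    then show ?thesis using pos[of "- d"] 3 by simp
  qed (use pos in \<open>auto simp: ker_def power2_eq_square\<close>)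
qed

locale poisson_kernel =
  fixes r :: real
  assumes r0: "0 < r" and r1: "r < 1"
begin

lemma r2: "0 < 1 - r\<^sup>2"
  using r0 r1 by (simp add: power_less_one_iff abs_square_less_1)

lemma ker_pos: "ker r d > 0"
  using r0 by (simp add: ker_def)

lemma ker_le_1: "ker r d \<le> 1"
  using r0 r1 by (simp add: ker_def power_le_one)

lemma decaying_ker_poly:
  assumes "\<And>k. cmod (a k) \<le> B * ((1 + real_of_int \<bar>k\<bar>) ^ j * ker r k)" "B \<ge> 0"
  shows "decaying a"
  using decaying_poly_exp[OF r0 r1] assms unfolding ker_def by blast

lemma decaying_ker: "decaying (\<lambda>k. of_real (ker r k))"
  by (rule decaying_ker_poly[of _ 1 0]) (use ker_pos in \<open>auto simp: less_imp_le\<close>)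

lemma weighted_ker_summable: "(\<lambda>k. (1 + real_of_int \<bar>k\<bar>) ^ j * ker r k) summable_on UNIV"
proof -
  have "decaying (\<lambda>k. of_real ((1 + real_of_int \<bar>k\<bar>) ^ j * ker r k))"
    by (rule decaying_ker_poly[of _ 1 j]) (use ker_pos in \<open>simp_all only: norm_of_real, simp_all add: abs_mult less_imp_le\<close>)
  from decaying_norm_summable[OF this, unfolded norm_of_real] show ?thesis
    using ker_pos by (simp add: abs_mult less_imp_le)
qed

lemma ker_shift_has_sum: "((\<lambda>l. ker r (k - l)) has_sum infsum (ker r) UNIV) UNIV"
proof -
  have "bij_betw (\<lambda>l. k - l) UNIV UNIV" by (rule bij_betw_byWitness[of _ "\<lambda>l. k - l"]) auto
  moreover have "(ker r has_sum infsum (ker r) UNIV) UNIV" using weighted_ker_summable[of 0] by simp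
  ultimately show ?thesis using has_sum_reindex_bij_betw[of "\<lambda>l. k - l" UNIV UNIV "ker r"] by blast
qed

lemma kconv_has_sum:
  assumes "\<And>l. cmod (v l) \<le> B"
  shows "((\<lambda>l. of_real (ker r (k - l)) * v l) has_sum kconv r v k) UNIV"
proof -
  have "(\<lambda>l. norm (of_real (ker r (k - l)) * v l)) summable_on UNIV"
  proof (rule summable_on_comparison_test)
    show "(\<lambda>l. ker r (k - l) * B) summable_on UNIV"
      using ker_shift_has_sum has_sum_imp_summable summable_on_cmult_left by blast
    show "norm (of_real (ker r (k - l)) * v l) \<le> ker r (k - l) * B" for l
      using assms[of l] ker_pos[of "k - l"] by (simp add: norm_mult)
  qed auto
  then show ?thesis unfolding kconv_def by (rule has_sum_infsum[OF abs_summable_summable])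
qed

lemma kinv_kconv:
  assumes B: "\<And>l. cmod (v l) \<le> B"
  shows "kinv r (kconv r v) k = v k"
proof -
  note H = kconv_has_sum[OF B]
  have 1: "((\<lambda>l. of_real (1 + r\<^sup>2) * (of_real (ker r (k - l)) * v l) + (- of_real r) * (of_real (ker r (k + 1 - l)) * v l)
       + (- of_real r) * (of_real (ker r (k - 1 - l)) * v l)) has_sum
       (of_real (1 + r\<^sup>2) * kconv r v k + (- of_real r) * kconv r v (k + 1) + (- of_real r) * kconv r v (k - 1))) UNIV"
    by (intro has_sum_add has_sum_cmult_right H)
  have 2: "of_real (1 + r\<^sup>2) * (of_real (ker r (k - l)) * v l) + (- of_real r) * (of_real (ker r (k + 1 - l)) * v l)
       + (- of_real r) * (of_real (ker r (k - 1 - l)) * v l) = (if l = k then of_real (1 - r\<^sup>2) * v k else 0)" for l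
  proof -
    have "of_real (1 + r\<^sup>2) * (of_real (ker r (k - l)) * v l) + (- of_real r) * (of_real (ker r (k + 1 - l)) * v l)
       + (- of_real r) * (of_real (ker r (k - 1 - l)) * v l)
      = of_real ((1 + r\<^sup>2) * ker r (k - l) - r * ker r (k - l + 1) - r * ker r (k - l - 1)) * v l"
      by (simp add: algebra_simps)
    then show ?thesis unfolding ker_second_difference by auto
  qed
  have 3: "((\<lambda>l. if l = k then of_real (1 - r\<^sup>2) * v k else 0) has_sum of_real (1 - r\<^sup>2) * v k) UNIV"
    by (rule has_sum_finite_neutralI[of "{k}"]) auto
  have "of_real (1 + r\<^sup>2) * kconv r v k + (- of_real r) * kconv r v (k + 1) + (- of_real r) * kconv r v (k - 1)
      = of_real (1 - r\<^sup>2) * v k"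
    by (rule has_sum_unique[OF 1[unfolded 2] 3])
  moreover have "(of_real (1 - r\<^sup>2) :: complex) \<noteq> 0" using r2 by (simp only: of_real_eq_0_iff)
  ultimately show ?thesis unfolding kinv_def by (simp add: field_simps)
qed

lemma kconv_shift:
  assumes B: "\<And>l. cmod (v l) \<le> B"
  shows "((\<lambda>l. of_real (ker r (k - l)) * v (l + j)) has_sum kconv r v (k + j)) UNIV"
proof -
  have "bij_betw (\<lambda>l. l + j) UNIV UNIV" by (rule bij_betw_byWitness[of _ "\<lambda>l. l - j"]) auto
  from has_sum_reindex_bij_betw[OF this, of "\<lambda>l. of_real (ker r (k + j - l)) * v l"] kconv_has_sum[OF B, of "k + j"]
  show ?thesis by (simp add: algebra_simps)
qed

text \<open>\<open>kinv\<close> is a combination of shifts and convolution commutes with shifts, so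
  this order of composition reduces to the other.\<close>

lemma kconv_kinv:
  assumes B: "\<And>l. cmod (y l) \<le> B"
  shows "kconv r (kinv r y) k = y k"
proof -
  let ?d = "of_real (1 - r\<^sup>2) :: complex"
  have 1: "((\<lambda>l. (of_real (1 + r\<^sup>2) / ?d) * (of_real (ker r (k - l)) * y (l + 0)) + (- of_real r / ?d) * (of_real (ker r (k - l)) * y (l + 1))
       + (- of_real r / ?d) * (of_real (ker r (k - l)) * y (l + (- 1)))) has_sum
       ((of_real (1 + r\<^sup>2) / ?d) * kconv r y (k + 0) + (- of_real r / ?d) * kconv r y (k + 1) + (- of_real r / ?d) * kconv r y (k + (- 1)))) UNIV"
    by (intro has_sum_add has_sum_cmult_right kconv_shift[OF B])
  have 2: "(of_real (1 + r\<^sup>2) / ?d) * (of_real (ker r (k - l)) * y (l + 0)) + (- of_real r / ?d) * (of_real (ker r (k - l)) * y (l + 1))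
       + (- of_real r / ?d) * (of_real (ker r (k - l)) * y (l + (- 1))) = of_real (ker r (k - l)) * kinv r y l" for l
    unfolding kinv_def by (simp add: diff_divide_distrib add_divide_distrib algebra_simps)
  have 3: "(of_real (1 + r\<^sup>2) / ?d) * kconv r y (k + 0) + (- of_real r / ?d) * kconv r y (k + 1) + (- of_real r / ?d) * kconv r y (k + (- 1))
      = kinv r (kconv r y) k"
    unfolding kinv_def by (simp add: diff_divide_distrib add_divide_distrib algebra_simps)
  have "kconv r (kinv r y) k = kinv r (kconv r y) k"
    unfolding kconv_def[of r "kinv r y"] by (rule infsumI[OF 1[unfolded 2 3]])
  then show ?thesis by (simp only: kinv_kconv[OF B])
qed

text \<open>Peetre's inequality costs a weight (1 + |k - l|)^2, which the exponential decay of the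
  kernel absorbs.\<close>

lemma decaying_kconv:
  assumes "decaying v"
  shows "decaying (kconv r v)"
proof -
  obtain C where C: "C > 0" "\<And>k. cmod (v k) \<le> C * psi k" "\<And>k. cmod (v k) \<le> C" using decayingE[OF assms] by metis
  let ?w = "\<lambda>k. (1 + real_of_int \<bar>k\<bar>) ^ 2 * ker r k"
  have "cmod (kconv r v k) \<le> (C * infsum ?w UNIV) * psi k" for k
  proof (rule norm_infsum_le[OF kconv_has_sum[OF C(3)]])
    have "bij_betw (\<lambda>l. k - l) UNIV UNIV" by (rule bij_betw_byWitness[of _ "\<lambda>l. k - l"]) auto
    then have "((\<lambda>l. ?w (k - l)) has_sum infsum ?w UNIV) UNIV"
      using has_sum_infsum[OF weighted_ker_summable[of 2]] has_sum_reindex_bij_betw[of "\<lambda>l. k - l" UNIV UNIV ?w] by blast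
    then have "((\<lambda>l. C * psi k * ?w (k - l)) has_sum C * psi k * infsum ?w UNIV) UNIV"
      by (intro has_sum_cmult_right)
    then show "((\<lambda>l. C * psi k * ?w (k - l)) has_sum C * infsum ?w UNIV * psi k) UNIV"
      by (simp only: mult.assoc mult.commute[of "psi k"])
    fix l
    have "norm (of_real (ker r (k - l)) * v l) \<le> ker r (k - l) * (C * psi l)"
      using C(2)[of l] ker_pos[of "k - l"] by (simp add: norm_mult)
    also have "\<dots> \<le> ker r (k - l) * (C * (psi k * (1 + real_of_int \<bar>k - l\<bar>) ^ 2))"
      using ker_pos[of "k - l"] C(1) psi_Peetre by (intro mult_left_mono) auto
    finally show "norm (of_real (ker r (k - l)) * v l) \<le> C * psi k * ?w (k - l)" by (simp add: mult_ac)
  qed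
  then show ?thesis unfolding decaying_def by blast
qed

text \<open>Pulling out r^|k| turns the tridiagonal operator into a second-order difference operator
  on \<open>g\<close> that annihilates constants. Convolutions of polynomials times the kernel can
  then be found by matching coefficients.\<close>

lemma kinv_radial:
  assumes "k \<noteq> 0"
  shows "kinv r (\<lambda>k. of_real (g (nat \<bar>k\<bar>) * ker r k)) k
    = of_real (((1 + r\<^sup>2) * g (nat \<bar>k\<bar>) - r\<^sup>2 * g (nat \<bar>k\<bar> + 1) - g (nat \<bar>k\<bar> - 1)) * ker r k / (1 - r\<^sup>2))"
proof -
  obtain n where n: "nat \<bar>k\<bar> = Suc n" using assms by (cases "nat \<bar>k\<bar>") auto
  consider "nat \<bar>k + 1\<bar> = Suc (Suc n)" "nat \<bar>k - 1\<bar> = n" | "nat \<bar>k - 1\<bar> = Suc (Suc n)" "nat \<bar>k + 1\<bar> = n"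
    using n by linarith
  then show ?thesis
  proof cases
    case 1 then show ?thesis using n by (simp add: kinv_def ker_def power2_eq_square algebra_simps)
  next
    case 2 then show ?thesis using n by (simp add: kinv_def ker_def power2_eq_square algebra_simps)
  qed
qed

lemma kinv_radial_0:
  "kinv r (\<lambda>k. of_real (g (nat \<bar>k\<bar>) * ker r k)) 0 = of_real (((1 + r\<^sup>2) * g 0 - 2 * r\<^sup>2 * g 1) / (1 - r\<^sup>2))"
  by (simp add: kinv_def ker_def power2_eq_square algebra_simps)

lemma kinv_radial_odd:
  assumes "g 0 = 0"
  shows "kinv r (\<lambda>k. of_real (of_int (sgn k) * g (nat \<bar>k\<bar>) * ker r k)) k
    = of_real (of_int (sgn k) * ((1 + r\<^sup>2) * g (nat \<bar>k\<bar>) - r\<^sup>2 * g (nat \<bar>k\<bar> + 1) - g (nat \<bar>k\<bar> - 1)) * ker r k / (1 - r\<^sup>2))"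
proof (cases "k = 0")
  case True then show ?thesis by (simp add: kinv_def ker_def)
next
  case False
  obtain n where n: "nat \<bar>k\<bar> = Suc n" using False by (cases "nat \<bar>k\<bar>") auto
  let ?y = "\<lambda>k. of_real (of_int (sgn k) * g (nat \<bar>k\<bar>) * ker r k) :: complex"
  let ?d = "of_real (1 - r\<^sup>2) :: complex"
  consider "k > 0" | "k < 0" using False by linarith
  then show ?thesis
  proof cases
    case 1
    then have k: "k = int n + 1" using n by linarith
    have "nat \<bar>k + 1\<bar> = Suc (Suc n)" "nat \<bar>k - 1\<bar> = n" "sgn k = 1" "sgn (k+1) = 1" using k by auto
    \<comment> \<open>For k = 1 the neighbour is 0, whose sign is 0; the equation survives because g
      0 = 0.\<close>
    moreover have "of_int (sgn (k - 1)) * g n = g n" using assms k by (cases n) auto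
    ultimately have "?y k = of_real (g (Suc n) * r ^ Suc n)" "?y (k + 1) = of_real (g (Suc (Suc n)) * r ^ Suc (Suc n))"
      "?y (k - 1) = of_real (g n * r ^ n)" using n by (simp_all only: ker_def of_int_1 mult_1_left)
    then show ?thesis using n \<open>sgn k = 1\<close> by (simp add: kinv_def ker_def power2_eq_square algebra_simps)
  next
    case 2
    then have k: "k = - int n - 1" using n by linarith
    have "nat \<bar>k - 1\<bar> = Suc (Suc n)" "nat \<bar>k + 1\<bar> = n" "sgn k = -1" "sgn (k-1) = -1" using k by auto
    moreover have "of_int (sgn (k + 1)) * g n = - g n" using assms k by (cases n) auto
    ultimately have "?y k = - of_real (g (Suc n) * r ^ Suc n)" "?y (k - 1) = - of_real (g (Suc (Suc n)) * r ^ Suc (Suc n))"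
      "?y (k + 1) = - of_real (g n * r ^ n)" using n by (simp_all only: ker_def of_int_minus of_int_1 mult_minus_left mult_1_left of_real_minus)
    then show ?thesis using n \<open>sgn k = -1\<close> by (simp add: kinv_def ker_def power2_eq_square algebra_simps)
  qed
qed

end

section \<open>Explicit convolutions with the Poisson kernel\<close>

lemma cubic_bounds:
  fixes n :: nat
  shows "1 \<le> (1 + real n) ^ 3" "real n \<le> (1 + real n) ^ 3" "(real n)\<^sup>2 \<le> (1 + real n) ^ 3" "(real n) ^ 3 \<le> (1 + real n) ^ 3"
proof -
  have e: "(1 + real n) ^ 3 = 1 + 3 * real n + 3 * (real n)\<^sup>2 + (real n) ^ 3"
    by (simp add: power3_eq_cube power2_eq_square algebra_simps)
  have "0 \<le> real n" "0 \<le> (real n)\<^sup>2" "0 \<le> (real n) ^ 3" by simp_all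
  then show "1 \<le> (1 + real n) ^ 3" "real n \<le> (1 + real n) ^ 3" "(real n)\<^sup>2 \<le> (1 + real n) ^ 3" "(real n) ^ 3 \<le> (1 + real n) ^ 3"
    unfolding e by linarith+
qed

lemma cubic_poly_bound:
  "\<bar>a * (real n) ^ 3 + b * (real n)\<^sup>2 + c * real n + d\<bar> \<le> (\<bar>a\<bar> + \<bar>b\<bar> + \<bar>c\<bar> + \<bar>d\<bar>) * (1 + real n) ^ 3"
proof -
  have "\<bar>a * (real n) ^ 3 + b * (real n)\<^sup>2 + c * real n + d\<bar> \<le> \<bar>a\<bar> * (real n) ^ 3 + \<bar>b\<bar> * (real n)\<^sup>2 + \<bar>c\<bar> * real n + \<bar>d\<bar> * 1"
    by (intro order_trans[OF abs_triangle_ineq] add_mono) (simp_all add: abs_mult)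
  also have "\<dots> \<le> \<bar>a\<bar> * (1 + real n) ^ 3 + \<bar>b\<bar> * (1 + real n) ^ 3 + \<bar>c\<bar> * (1 + real n) ^ 3 + \<bar>d\<bar> * (1 + real n) ^ 3"
    by (intro add_mono mult_left_mono cubic_bounds) auto
  finally show ?thesis by (simp only: distrib_right)
qed

context poisson_kernel
begin

text \<open>With \<open>r = exp (-\<eta>)\<close> these are \<open>coth \<eta>\<close> and \<open>1 / sinh\<^sup>2 \<eta>\<close>.\<close>

definition \<omega> :: real where "\<omega> = (1 + r\<^sup>2) / (1 - r\<^sup>2)"
definition \<sigma> :: real where "\<sigma> = \<omega>\<^sup>2 - 1"

lemma omega_ge_1: "\<omega> > 1"
  using r2 r0 by (simp add: \<omega>_def)

lemma sigma_pos: "\<sigma> > 0"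
  using omega_ge_1 by (simp add: \<sigma>_def one_less_power)

lemma omega_r2: "\<omega> * (1 - r\<^sup>2) = 1 + r\<^sup>2" "\<omega> - \<omega> * r\<^sup>2 = 1 + r\<^sup>2"
proof -
  show "\<omega> * (1 - r\<^sup>2) = 1 + r\<^sup>2"
    using r2 by (simp add: \<omega>_def)
  then show "\<omega> - \<omega> * r\<^sup>2 = 1 + r\<^sup>2" by (simp only: right_diff_distrib mult_1_right)
qed

text \<open>Convolution identities are verified, not computed: the tridiagonal inverse is applied to
  the guessed result.\<close>

lemma kconv_eqI:
  assumes "decaying y" "\<And>k. kinv r y k = v k"
  shows "kconv r v k = y k"
proof -
  obtain C where C: "\<And>k. cmod (y k) \<le> C" using decayingE[OF assms(1)] by metis
  have eq: "kinv r y = v" using assms(2) by (rule ext)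
  show ?thesis using kconv_kinv[of y C k, OF C] by (simp only: eq)
qed

lemma decaying_cubic_ker:
  assumes "\<And>n. \<bar>g n\<bar> \<le> B * (1 + real n) ^ 3" "B \<ge> 0"
  shows "decaying (\<lambda>k. of_real (g (nat \<bar>k\<bar>) * ker r k))" "decaying (\<lambda>k. of_real (of_int (sgn k) * g (nat \<bar>k\<bar>) * ker r k))"
proof -
  have le: "\<bar>g (nat \<bar>k\<bar>)\<bar> * ker r k \<le> B * ((1 + real_of_int \<bar>k\<bar>) ^ 3 * ker r k)" for k
    using mult_right_mono[OF assms(1)[of "nat \<bar>k\<bar>"], of "ker r k"] ker_pos[of k] by (simp add: mult.assoc)
  show "decaying (\<lambda>k. of_real (g (nat \<bar>k\<bar>) * ker r k))"
  proof (rule decaying_ker_poly[OF _ assms(2)])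
    show "cmod (of_real (g (nat \<bar>k\<bar>) * ker r k)) \<le> B * ((1 + real_of_int \<bar>k\<bar>) ^ 3 * ker r k)" for k
      using le[of k] ker_pos[of k] by (simp only: norm_of_real abs_mult abs_of_pos)
  qed
  show "decaying (\<lambda>k. of_real (of_int (sgn k) * g (nat \<bar>k\<bar>) * ker r k))"
  proof (rule decaying_ker_poly[OF _ assms(2)])
    fix k :: int
    have "\<bar>real_of_int (sgn k)\<bar> * (\<bar>g (nat \<bar>k\<bar>)\<bar> * ker r k) \<le> 1 * (\<bar>g (nat \<bar>k\<bar>)\<bar> * ker r k)"
      using ker_pos[of k] by (intro mult_right_mono) (auto simp: sgn_if)
    then show "cmod (of_real (of_int (sgn k) * g (nat \<bar>k\<bar>) * ker r k)) \<le> B * ((1 + real_of_int \<bar>k\<bar>) ^ 3 * ker r k)"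
      using le[of k] ker_pos[of k] by (simp only: norm_of_real abs_mult abs_of_pos mult.assoc)
  qed
qed

text \<open>Constants solve the homogeneous recurrence, so the result has one degree more than the
  input \<open>h\<close>; its constant term is fixed by the separate condition at frequency 0.
  Degree 3 suffices for the inputs 1, |k| and k^2.\<close>

lemma kconv_radial_poly:
  assumes g: "\<And>n. g n = a * (real n) ^ 3 + b * (real n)\<^sup>2 + c * real n + d"
    and h0: "(1 + r\<^sup>2) * g 0 - 2 * r\<^sup>2 * g 1 = (1 - r\<^sup>2) * h 0"
    and h: "\<And>n. n > 0 \<Longrightarrow> (1 + r\<^sup>2) * g n - r\<^sup>2 * g (n + 1) - g (n - 1) = (1 - r\<^sup>2) * h n"
  shows "kconv r (\<lambda>k. of_real (h (nat \<bar>k\<bar>) * ker r k)) k = of_real (g (nat \<bar>k\<bar>) * ker r k)"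
proof (rule kconv_eqI)
  show "decaying (\<lambda>k. of_real (g (nat \<bar>k\<bar>) * ker r k))"
    by (rule decaying_cubic_ker[of _ "\<bar>a\<bar> + \<bar>b\<bar> + \<bar>c\<bar> + \<bar>d\<bar>"]) (use cubic_poly_bound in \<open>simp_all add: g\<close>)
  fix k :: int
  show "kinv r (\<lambda>k. of_real (g (nat \<bar>k\<bar>) * ker r k)) k = of_real (h (nat \<bar>k\<bar>) * ker r k)"
  proof (cases "k = 0")
    case True
    then show ?thesis using r2 by (simp only: kinv_radial_0 h0) (simp add: ker_def)
  next
    case False
    then show ?thesis using r2 h[of "nat \<bar>k\<bar>"] by (subst kinv_radial) simp_all
  qed
qed

lemma kconv_radial_odd_poly:
  assumes g: "\<And>n. g n = a * (real n) ^ 3 + b * (real n)\<^sup>2 + c * real n"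
    and h: "\<And>n. n > 0 \<Longrightarrow> (1 + r\<^sup>2) * g n - r\<^sup>2 * g (n + 1) - g (n - 1) = (1 - r\<^sup>2) * h n"
  shows "kconv r (\<lambda>k. of_real (of_int (sgn k) * h (nat \<bar>k\<bar>) * ker r k)) k = of_real (of_int (sgn k) * g (nat \<bar>k\<bar>) * ker r k)"
proof (rule kconv_eqI)
  show "decaying (\<lambda>k. of_real (of_int (sgn k) * g (nat \<bar>k\<bar>) * ker r k))"
    by (rule decaying_cubic_ker[of _ "\<bar>a\<bar> + \<bar>b\<bar> + \<bar>c\<bar> + \<bar>0\<bar>"])
       (use cubic_poly_bound[of a _ b c 0] in \<open>simp_all add: g\<close>)
  fix k :: int
  show "kinv r (\<lambda>k. of_real (of_int (sgn k) * g (nat \<bar>k\<bar>) * ker r k)) k = of_real (of_int (sgn k) * h (nat \<bar>k\<bar>) * ker r k)"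
  proof (cases "k = 0")
    case True
    then show ?thesis by (simp add: kinv_def ker_def)
  next
    case False
    have g0: "g 0 = 0" using g[of 0] by simp
    show ?thesis using r2 h[of "nat \<bar>k\<bar>"] False by (subst kinv_radial_odd[of g, OF g0]) simp
  qed
qed

text \<open>This is P^2 = |D| P + omega P, the integrated equation of the travelling wave after
  rescaling.\<close>

lemma kconv_ker: "kconv r (\<lambda>k. of_real (ker r k)) k = of_real ((real_of_int \<bar>k\<bar> + \<omega>) * ker r k)"
proof -
  have "kconv r (\<lambda>k. of_real ((\<lambda>n. 1) (nat \<bar>k\<bar>) * ker r k)) k = of_real ((\<lambda>n. real n + \<omega>) (nat \<bar>k\<bar>) * ker r k)"
    by (rule kconv_radial_poly[where a = 0 and b = 0 and c = 1 and d = \<omega>])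
       (use omega_r2(2) in \<open>simp_all add: algebra_simps of_nat_diff\<close>)
  then show ?thesis by simp
qed

text \<open>The product of P and |D| P. The coefficient 1/2 of |k|^2 is what lets the second
  variation map |D| P back into the span.\<close>

lemma kconv_abs_ker: "kconv r (\<lambda>k. of_real (real_of_int \<bar>k\<bar> * ker r k)) k
    = of_real (((real_of_int \<bar>k\<bar>)\<^sup>2 + \<omega> * real_of_int \<bar>k\<bar> + \<sigma>) / 2 * ker r k)"
proof -
  have s: "\<sigma> = \<omega> * \<omega> - 1" by (simp add: \<sigma>_def power2_eq_square)
  have "kconv r (\<lambda>k. of_real ((\<lambda>n. real n) (nat \<bar>k\<bar>) * ker r k)) k = of_real ((\<lambda>n. ((real n)\<^sup>2 + \<omega> * real n + \<sigma>) / 2) (nat \<bar>k\<bar>) * ker r k)"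
  proof (rule kconv_radial_poly[where a = 0 and b = "1/2" and c = "\<omega>/2" and d = "\<sigma>/2"])
    have "(1 + r\<^sup>2) * \<sigma> = 2 * r\<^sup>2 * (1 + \<omega> + \<sigma>)"
      using omega_r2(1) unfolding s by algebra
    then show "(1 + r\<^sup>2) * (((real 0)\<^sup>2 + \<omega> * real 0 + \<sigma>) / 2) - 2 * r\<^sup>2 * (((real 1)\<^sup>2 + \<omega> * real 1 + \<sigma>) / 2) = (1 - r\<^sup>2) * real 0"
      by simp
    fix n :: nat assume "n > 0"
    then have n: "real (n + 1) = real n + 1" "real (n - 1) = real n - 1" by auto
    show "(1 + r\<^sup>2) * (((real n)\<^sup>2 + \<omega> * real n + \<sigma>) / 2) - r\<^sup>2 * (((real (n + 1))\<^sup>2 + \<omega> * real (n + 1) + \<sigma>) / 2)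
      - ((real (n - 1))\<^sup>2 + \<omega> * real (n - 1) + \<sigma>) / 2 = (1 - r\<^sup>2) * real n"
      using omega_r2(1) unfolding n by (simp add: field_simps) algebra
  qed (simp add: field_simps)
  then show ?thesis by simp
qed

text \<open>At frequency 0 the convolution is the sum of k^2 r^(2|k|), that is, the squared norm of
  both |D| P and P'.\<close>

lemma kconv_square_ker: "kconv r (\<lambda>k. of_real ((real_of_int \<bar>k\<bar>)\<^sup>2 * ker r k)) 0 = of_real (\<sigma> * \<omega> / 2)"
proof -
  have s: "\<sigma> = \<omega> * \<omega> - 1" by (simp add: \<sigma>_def power2_eq_square)
  \<comment> \<open>The cubic is found by matching coefficients; its constant term, the value
    wanted, comes from the condition at frequency 0.\<close>
  let ?g = "\<lambda>n. (1/3) * (real n) ^ 3 + (\<omega>/2) * (real n)\<^sup>2 + (\<omega> * \<omega> / 2 - 1/3) * real n + \<sigma> * \<omega> / 2"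
  have "kconv r (\<lambda>k. of_real ((\<lambda>n. (real n)\<^sup>2) (nat \<bar>k\<bar>) * ker r k)) 0 = of_real (?g (nat \<bar>0\<bar>) * ker r 0)"
  proof (rule kconv_radial_poly[where a = "1/3" and b = "\<omega>/2" and c = "\<omega> * \<omega> / 2 - 1/3" and d = "\<sigma> * \<omega> / 2"])
    have "(1 + r\<^sup>2) * (\<sigma> * \<omega> / 2) = 2 * r\<^sup>2 * (\<omega> / 2 + \<omega> * \<omega> / 2 + \<sigma> * \<omega> / 2)"
      using omega_r2(1) unfolding s by (simp add: field_simps) algebra
    then show "(1 + r\<^sup>2) * ?g 0 - 2 * r\<^sup>2 * ?g 1 = (1 - r\<^sup>2) * (real 0)\<^sup>2"
      by simp
    fix n :: nat assume "n > 0"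
    then have n: "real (n + 1) = real n + 1" "real (n - 1) = real n - 1" by auto
    show "(1 + r\<^sup>2) * ?g n - r\<^sup>2 * ?g (n + 1) - ?g (n - 1) = (1 - r\<^sup>2) * (real n)\<^sup>2"
      using omega_r2(1) unfolding n s by (simp add: field_simps) algebra
  qed simp
  then show ?thesis by (simp add: ker_def)
qed

text \<open>Half the derivative of the identity for P^2, which is why P' will lie in the kernel of
  the second variation.\<close>

lemma kconv_odd_ker: "kconv r (\<lambda>k. of_real (real_of_int k * ker r k)) k = of_real ((real_of_int \<bar>k\<bar> + \<omega>) / 2 * real_of_int k * ker r k)"
proof -
  have "kconv r (\<lambda>k. of_real (real_of_int (sgn k) * (\<lambda>n. real n) (nat \<bar>k\<bar>) * ker r k)) k
    = of_real (real_of_int (sgn k) * (\<lambda>n. ((real n)\<^sup>2 + \<omega> * real n) / 2) (nat \<bar>k\<bar>) * ker r k)"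
  proof (rule kconv_radial_odd_poly[where a = 0 and b = "1/2" and c = "\<omega>/2"])
    fix n :: nat assume "n > 0"
    then have n: "real (n + 1) = real n + 1" "real (n - 1) = real n - 1" by auto
    show "(1 + r\<^sup>2) * (((real n)\<^sup>2 + \<omega> * real n) / 2) - r\<^sup>2 * (((real (n + 1))\<^sup>2 + \<omega> * real (n + 1)) / 2)
      - ((real (n - 1))\<^sup>2 + \<omega> * real (n - 1)) / 2 = (1 - r\<^sup>2) * real n"
      using omega_r2(1) unfolding n by (simp add: field_simps) algebra
  qed (simp add: field_simps)
  moreover have "real_of_int (sgn k) * real (nat \<bar>k\<bar>) = real_of_int k" for k
    by (simp add: sgn_if)
  moreover have "real_of_int (sgn k) * (((real (nat \<bar>k\<bar>))\<^sup>2 + \<omega> * real (nat \<bar>k\<bar>)) / 2) = (real_of_int \<bar>k\<bar> + \<omega>) / 2 * real_of_int k" for k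
    by (simp add: sgn_if power2_eq_square field_simps)
  ultimately show ?thesis by (simp only:)
qed

section \<open>Nonnegativity of |D| - 2 P on the complement of the span\<close>

text \<open>Here \<open>h = p - r S p\<close>, with \<open>S\<close> the shift, is the sequence under study, \<open>y\<close> is its convolution with the
  kernel and \<open>t\<close> is the quotient of its power series by \<open>(z - r)\<^sup>2\<close>. The sequence \<open>p' (k + 1) - r * p' k\<close>
  is the quotient of \<open>h\<close> by the square of the Blaschke factor \<open>(z - r) / (1 - r z)\<close>.\<close>

lemma telescoping_identity:
  fixes t y p p' :: "nat \<Rightarrow> real"
  assumes p: "\<And>k. p k = t k - r * t (k + 1)" and p': "\<And>k. p' k = t (k + 1) - r * t k"
    and y: "\<And>k. y (k + 1) = r * y k + (1 - r\<^sup>2) * p k" and "t 0 = 0" "y 0 = 0"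
  shows "(\<Sum>k<n. real (k + 1) * ((p k - r * p (k + 1))\<^sup>2 - (p' (k + 1) - r * p' k)\<^sup>2) - 2 * ((p k - r * p (k + 1)) * y (k + 1)))
    = (1 - r\<^sup>2)\<^sup>2 * (t n)\<^sup>2 - (1 - r\<^sup>2) * (real n * ((p n)\<^sup>2 + (p' n)\<^sup>2)) + 2 * r * (p n * y n)"
proof (induction n)
  case (Suc n)
  have "real (Suc n) = real n + 1" by simp
  then show ?case
    unfolding sum.lessThan_Suc Suc.IH unfolding p p' y Suc_eq_plus1
    by (simp add: power2_eq_square algebra_simps)
qed (use assms in simp)

text \<open>As n grows, the boundary terms of the telescoping identity tend to 0; the weighted
  squares of the Blaschke quotient, which are nonnegative, are dropped.\<close>

lemma telescoping_inequality:
  fixes t y p :: "nat \<Rightarrow> real"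
  assumes p: "\<And>k. p k = t k - r * t (k + 1)"
    and y: "\<And>k. y (k + 1) = r * y k + (1 - r\<^sup>2) * p k" and "t 0 = 0" "y 0 = 0"
    and t_le: "\<And>k. \<bar>t k\<bar> \<le> C * psi (int k)" and y_le: "\<And>k. \<bar>y k\<bar> \<le> D"
    and sm: "(\<lambda>k. real (k + 1) * (p k - r * p (k + 1))\<^sup>2) summable_on UNIV"
    "(\<lambda>k. (p k - r * p (k + 1)) * y (k + 1)) summable_on UNIV"
  shows "2 * (\<Sum>\<^sub>\<infinity>k. (p k - r * p (k + 1)) * y (k + 1)) \<le> (\<Sum>\<^sub>\<infinity>k. real (k + 1) * (p k - r * p (k + 1))\<^sup>2)"
proof -
  define p' where "p' k = t (k + 1) - r * t k" for k
  let ?h = "\<lambda>k. p k - r * p (k + 1)"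
  let ?R = "\<lambda>n. (1 - r\<^sup>2)\<^sup>2 * (t n)\<^sup>2 - (1 - r\<^sup>2) * (real n * ((p n)\<^sup>2 + (p' n)\<^sup>2)) + 2 * r * (p n * y n)"
  have C0: "C \<ge> 0" using t_le[of 0] by (simp add: psi_def)
  have t_le': "\<bar>t (k + 1)\<bar> \<le> C * psi (int k)" for k
    using t_le[of "k + 1"] mult_left_mono[OF psi_antimono_nat[of k 1] C0] by linarith
  have rt: "\<bar>r * x\<bar> \<le> \<bar>x\<bar>" for x
    using r0 r1 by (simp add: abs_mult mult_left_le_one_le)
  have pb: "\<bar>p k\<bar> \<le> 2 * C * psi (int k)" for k
    using t_le[of k] t_le'[of k] rt[of "t (k + 1)"] unfolding p by linarith
  have p'b: "\<bar>p' k\<bar> \<le> 2 * C * psi (int k)" for k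
    using t_le[of k] t_le'[of k] rt[of "t k"] unfolding p'_def by linarith
  have lim: "(\<lambda>n. psi (int n)) \<longlonglongrightarrow> 0"
    unfolding psi_def by simp real_asymp
  have lim_mult: "(\<lambda>n. B * psi (int n)) \<longlonglongrightarrow> 0" for B
    using tendsto_mult_right_zero[OF lim] .
  have t0: "t \<longlonglongrightarrow> 0"
    by (rule Lim_null_comparison[OF _ lim_mult[of C]]) (use t_le in simp)
  \<comment> \<open>Decay of order 3/2 makes the weighted boundary terms vanish in the
    limit.\<close>
  have sq: "(\<lambda>n. real n * (u n)\<^sup>2) \<longlonglongrightarrow> 0" if u: "\<And>k. \<bar>u k\<bar> \<le> 2 * C * psi (int k)" for u
  proof (rule Lim_null_comparison[OF _ lim_mult])
    have "norm (real n * (u n)\<^sup>2) \<le> (2 * C)\<^sup>2 * psi (int n)" for n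
    proof -
      have "(u n)\<^sup>2 \<le> (2 * C * psi (int n))\<^sup>2"
        using power_mono[OF u, of n 2] by simp
      then have "real n * (u n)\<^sup>2 \<le> (1 + real n) * (2 * C * psi (int n))\<^sup>2"
        by (intro mult_mono) auto
      also have "\<dots> = (2 * C)\<^sup>2 * ((1 + real_of_int \<bar>int n\<bar>) * (psi (int n))\<^sup>2)"
        by (simp add: power_mult_distrib)
      also have "\<dots> \<le> (2 * C)\<^sup>2 * psi (int n)"
        by (intro mult_left_mono weight_psi_le) auto
      finally show ?thesis by simp
    qed
    then show "eventually (\<lambda>n. norm (real n * (u n)\<^sup>2) \<le> (2 * C)\<^sup>2 * psi (int n)) sequentially" by simp
  qed
  have py: "(\<lambda>n. p n * y n) \<longlonglongrightarrow> 0"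
  proof (rule Lim_null_comparison[OF _ lim_mult])
    have "norm (p n * y n) \<le> (2 * C * D) * psi (int n)" for n
      using mult_mono[OF pb[of n] y_le[of n]] C0 psi_pos[of n] by (simp add: abs_mult mult_ac less_imp_le)
    then show "eventually (\<lambda>n. norm (p n * y n) \<le> (2 * C * D) * psi (int n)) sequentially" by simp
  qed
  have "?R \<longlonglongrightarrow> (1 - r\<^sup>2)\<^sup>2 * 0\<^sup>2 - (1 - r\<^sup>2) * (0 + 0) + 2 * r * 0"
    unfolding distrib_left[of "real _"]
    by (intro tendsto_intros t0 py sq pb p'b)
  then have R: "?R \<longlonglongrightarrow> 0" by simp
  have ge: "?R n \<le> (\<Sum>k<n. real (k + 1) * (?h k)\<^sup>2 - 2 * (?h k * y (k + 1)))" for n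
    unfolding telescoping_identity[OF p p'_def y assms(3,4), symmetric]
    by (intro sum_mono) (simp add: right_diff_distrib)
  have "(\<lambda>k. real (k + 1) * (?h k)\<^sup>2 - 2 * (?h k * y (k + 1))) sums
      (infsum (\<lambda>k. real (k + 1) * (?h k)\<^sup>2) UNIV - 2 * infsum (\<lambda>k. ?h k * y (k + 1)) UNIV)"
    by (intro sums_diff sums_mult has_sum_imp_sums has_sum_infsum sm)
  then have "(\<lambda>n. \<Sum>k<n. real (k + 1) * (?h k)\<^sup>2 - 2 * (?h k * y (k + 1))) \<longlonglongrightarrow>
      infsum (\<lambda>k. real (k + 1) * (?h k)\<^sup>2) UNIV - 2 * infsum (\<lambda>k. ?h k * y (k + 1)) UNIV"
    unfolding sums_def .
  from LIMSEQ_le[OF R this] ge have "0 \<le> infsum (\<lambda>k. real (k + 1) * (?h k)\<^sup>2) UNIV - 2 * infsum (\<lambda>k. ?h k * y (k + 1)) UNIV"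
    by blast
  then show ?thesis by simp
qed

end

definition real_seq :: "(int \<Rightarrow> complex) \<Rightarrow> bool" where
  "real_seq a \<longleftrightarrow> (\<forall>k. a (- k) = cnj (a k))"

context poisson_kernel
begin

lemma real_seq_kconv:
  assumes "real_seq v"
  shows "real_seq (kconv r v)"
  unfolding real_seq_def
proof
  fix k
  have bij: "bij_betw uminus (UNIV :: int set) UNIV" by (rule bij_betw_byWitness[of _ uminus]) auto
  have "kconv r v (- k) = (\<Sum>\<^sub>\<infinity>l. of_real (ker r (- k - (- l))) * v (- l))"
    unfolding kconv_def by (rule infsum_reindex_bij_betw[OF bij, symmetric])
  also have "\<dots> = (\<Sum>\<^sub>\<infinity>l. cnj (of_real (ker r (k - l)) * v l))"
  proof (rule infsum_cong)
    fix l :: int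
    have "ker r (- k - (- l)) = ker r (k - l)" using ker_minus_commute[of r l k] by simp
    then show "of_real (ker r (- k - (- l))) * v (- l) = cnj (of_real (ker r (k - l)) * v l)"
      using assms by (simp add: real_seq_def)
  qed
  also have "\<dots> = cnj (kconv r v k)" unfolding kconv_def by (rule infsum_cnj)
  finally show "kconv r v (- k) = cnj (kconv r v k)" .
qed

text \<open>The two hypotheses on \<open>z\<close> express orthogonality to \<open>P\<close>, \<open>|D| P\<close> and \<open>P'\<close>.\<close>

lemma kernel_form_le_weight:
  assumes dz: "decaying z" and rz: "real_seq z" and z0: "kconv r z 0 = 0"
    and z1: "((\<lambda>n. of_real (real (n + 1) * r ^ (n + 1)) * z (int n + 1)) has_sum 0) UNIV"
  shows "2 * (\<Sum>\<^sub>\<infinity>k. Re (cnj (z k) * kconv r z k)) \<le> (\<Sum>\<^sub>\<infinity>k. real_of_int \<bar>k\<bar> * (cmod (z k))\<^sup>2)"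
proof -
  define y where "y = kconv r z"
  have dy: "decaying y" unfolding y_def by (rule decaying_kconv[OF dz])
  obtain D where D: "D > 0" "\<And>k. cmod (y k) \<le> D * psi k" "\<And>k. cmod (y k) \<le> D" using decayingE[OF dy] by metis
  obtain E where E: "\<And>k. cmod (z k) \<le> E" using decayingE[OF dz] by metis
  \<comment> \<open>\<open>kinv\<close> factors into two first-order differences; \<open>p\<close>
    is the sequence in between, so that \<open>z\<close> at the positive frequencies becomes p - r S
    p.\<close>
  define p where "p n = (y (int n + 1) - of_real r * y (int n)) / of_real (1 - r\<^sup>2)" for n
  have nz: "(of_real (1 - r\<^sup>2) :: complex) \<noteq> 0" using r2 by (simp only: of_real_eq_0_iff)
  have yp: "y (int (n + 1)) = of_real r * y (int n) + of_real (1 - r\<^sup>2) * p n" for n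
    unfolding p_def using nz by (simp add: add_ac)
  have zp: "z (int n + 1) = p n - of_real r * p (n + 1)" for n
  proof -
    have "z (int n + 1) = kinv r y (int n + 1)" unfolding y_def by (rule kinv_kconv[OF E, symmetric])
    also have "\<dots> = p n - of_real r * p (n + 1)"
    proof -
      have i: "int (n + 1) = int n + 1" "int n + 1 - 1 = int n" by simp_all
      have alg: "((1 + R * R) * b - R * c - R * a) / d = (b - R * a) / d - R * ((c - R * b) / d)" for R a b c d :: complex
        by (simp add: algebra_simps diff_divide_distrib add_divide_distrib)
      show ?thesis unfolding p_def kinv_def i of_real_add of_real_1 power2_eq_square of_real_mult by (rule alg)
    qed
    finally show ?thesis .
  qed
  have y0: "y (int 0) = 0" using z0 by (simp add: y_def)
  define B where "B = 2 * D / (1 - r\<^sup>2)"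
  have B0: "B > 0" using D(1) r2 by (simp add: B_def)
  have pb: "cmod (p n) \<le> B * psi (int n)" for n
  proof -
    have "cmod (y (int n + 1)) \<le> D * psi (int n)"
      using D(2)[of "int (n + 1)"] mult_left_mono[OF psi_antimono_nat[of n 1] less_imp_le[OF D(1)]]
      unfolding of_nat_add of_nat_1 by linarith
    moreover have "cmod (of_real r * y (int n)) \<le> D * psi (int n)"
    proof -
      have "r * cmod (y (int n)) \<le> 1 * (D * psi (int n))"
        using r0 r1 D by (intro mult_mono) auto
      then show ?thesis using r0 by (simp add: norm_mult)
    qed
    ultimately have "cmod (y (int n + 1) - of_real r * y (int n)) \<le> 2 * D * psi (int n)"
      using norm_triangle_ineq4[of "y (int n + 1)" "of_real r * y (int n)"] by linarith
    then show ?thesis using r2 unfolding p_def B_def norm_divide norm_of_real by (simp add: divide_simps)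
  qed
  \<comment> \<open>The decaying solution of p k = t k - r t (k + 1). In terms of power series it is
    the second division by the variable minus r, without remainder once t 0 = 0.\<close>
  define t where "t k = (\<Sum>j. of_real (r ^ j) * p (k + j))" for k
  have tb: "cmod (of_real (r ^ j) * p (k + j)) \<le> (B * psi (int k)) * r ^ j" for j k
  proof -
    have "cmod (p (k + j)) \<le> B * psi (int k)"
      using pb[of "k + j"] mult_left_mono[OF psi_antimono_nat[of k j] less_imp_le[OF B0]] by linarith
    then show ?thesis using r0 by (simp add: norm_mult norm_power)
  qed
  have geo: "summable (\<lambda>j. (B * psi (int k)) * r ^ j)" for k
    using r0 r1 by (intro summable_mult summable_geometric) auto
  have tsum: "summable (\<lambda>j. of_real (r ^ j) * p (k + j))" for k
    by (rule summable_comparison_test'[OF geo tb])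
  have tp: "p k = t k - of_real r * t (k + 1)" for k
  proof -
    have "t k = of_real (r ^ 0) * p (k + 0) + (\<Sum>j. of_real (r ^ Suc j) * p (k + Suc j))"
      unfolding t_def using suminf_split_head[OF tsum[of k]] by simp
    also have "(\<Sum>j. of_real (r ^ Suc j) * p (k + Suc j)) = (\<Sum>j. of_real r * (of_real (r ^ j) * p (k + 1 + j)))"
      by (simp add: mult.assoc)
    also have "\<dots> = of_real r * t (k + 1)"
      unfolding t_def by (rule suminf_mult[OF tsum])
    finally show ?thesis by simp
  qed
  have t_le: "cmod (t k) \<le> (B / (1 - r)) * psi (int k)" for k
  proof -
    have "cmod (t k) \<le> (\<Sum>j. (B * psi (int k)) * r ^ j)"
      unfolding t_def by (rule norm_suminf_le[OF tb geo])
    also have "\<dots> = (B * psi (int k)) * (1 / (1 - r))"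
      using r0 r1 by (subst suminf_mult) (auto simp: suminf_geometric)
    finally show ?thesis by (simp add: mult_ac)
  qed
  have t0: "t 0 = 0"
  proof -
    \<comment> \<open>Summation by parts. In the limit the left side is the condition
      \<open>z1\<close>, and the right side is r times t 0.\<close>
    have fin: "(\<Sum>n<N. of_real (real (n + 1) * r ^ (n + 1)) * z (int n + 1))
        = of_real r * (\<Sum>j<N. of_real (r ^ j) * p (0 + j)) - of_real (real N * r ^ (N + 1)) * p N" for N
    proof (induction N)
      case (Suc N)
      then show ?case unfolding sum.lessThan_Suc Suc.IH zp by (simp add: algebra_simps)
    qed simp
    have "(\<lambda>N. \<Sum>n<N. of_real (real (n + 1) * r ^ (n + 1)) * z (int n + 1)) \<longlonglongrightarrow> 0"
      using has_sum_imp_sums[OF z1] by (simp add: sums_def)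
    moreover have "(\<lambda>N. of_real r * (\<Sum>j<N. of_real (r ^ j) * p (0 + j)) - of_real (real N * r ^ (N + 1)) * p N) \<longlonglongrightarrow> of_real r * t 0 - 0"
    proof (intro tendsto_intros)
      show "(\<lambda>N. \<Sum>j<N. of_real (r ^ j) * p (0 + j)) \<longlonglongrightarrow> t 0"
        unfolding t_def by (rule summable_LIMSEQ[OF tsum])
      show "(\<lambda>N. of_real (real N * r ^ (N + 1)) * p N) \<longlonglongrightarrow> 0"
      proof (rule Lim_null_comparison)
        have "cmod (p N) \<le> B" for N
          using pb[of N] mult_left_mono[OF psi_le_1[of "int N"] less_imp_le[OF B0]] by linarith
        then have "norm (of_real (real N * r ^ (N + 1)) * p N) \<le> (real N * r ^ (N + 1)) * B" for N
          using r0 unfolding norm_mult[of "of_real _"] norm_of_real by (intro mult_mono) (auto simp: abs_mult)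
        then show "eventually (\<lambda>N. norm (of_real (real N * r ^ (N + 1)) * p N) \<le> (real N * r ^ (N + 1)) * B) sequentially" by simp
        have "(\<lambda>N. real N * r ^ (N + 1)) \<longlonglongrightarrow> 0" using r0 r1 by real_asymp
        then show "(\<lambda>N. (real N * r ^ (N + 1)) * B) \<longlonglongrightarrow> 0" by (rule tendsto_mult_left_zero)
      qed
    qed
    ultimately have "0 = of_real r * t 0 - 0" unfolding fin by (rule LIMSEQ_unique)
    then show ?thesis using r0 by simp
  qed
  have sq_sum: "(\<lambda>k. real_of_int \<bar>k\<bar> * (cmod (z k))\<^sup>2) summable_on UNIV"
    by (rule decaying_weighted_summable[OF dz dz, of _ 1])
       (auto simp: power2_eq_square abs_mult intro!: mult_right_mono)
  have Re_sum: "(\<lambda>k. real_of_int \<bar>k\<bar> * (Re (z k))\<^sup>2) summable_on UNIV"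
    and Im_sum: "(\<lambda>k. real_of_int \<bar>k\<bar> * (Im (z k))\<^sup>2) summable_on UNIV"
    by (rule summable_on_comparison_test[OF sq_sum]; auto simp: cmod_power2 intro!: mult_left_mono)+
  have ip_sum: "(\<lambda>k. Re (cnj (z k) * y k)) summable_on UNIV"
  proof (rule decaying_weighted_summable[OF dz dy, of _ 1])
    fix k
    have "\<bar>Re (cnj (z k) * y k)\<bar> \<le> 1 * (cmod (z k) * cmod (y k))"
      using abs_Re_le_cmod[of "cnj (z k) * y k"] by (simp add: norm_mult)
    also have "\<dots> \<le> (1 + real_of_int \<bar>k\<bar>) * (cmod (z k) * cmod (y k))"
      by (intro mult_right_mono) auto
    finally show "norm (Re (cnj (z k) * y k)) \<le> 1 * ((1 + real_of_int \<bar>k\<bar>) * (cmod (z k) * cmod (y k)))" by simp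
  qed simp
  have part_sum: "(\<lambda>k. Re (z k) * Re (y k)) summable_on UNIV" "(\<lambda>k. Im (z k) * Im (y k)) summable_on UNIV"
  proof -
    have *: "\<bar>Re (z k)\<bar> * \<bar>Re (y k)\<bar> \<le> 1 * ((1 + real_of_int \<bar>k\<bar>) * (cmod (z k) * cmod (y k)))"
      "\<bar>Im (z k)\<bar> * \<bar>Im (y k)\<bar> \<le> 1 * ((1 + real_of_int \<bar>k\<bar>) * (cmod (z k) * cmod (y k)))" for k
    proof -
      have "1 * (cmod (z k) * cmod (y k)) \<le> (1 + real_of_int \<bar>k\<bar>) * (cmod (z k) * cmod (y k))"
        by (intro mult_right_mono) auto
      moreover have "\<bar>Re (z k)\<bar> * \<bar>Re (y k)\<bar> \<le> cmod (z k) * cmod (y k)" "\<bar>Im (z k)\<bar> * \<bar>Im (y k)\<bar> \<le> cmod (z k) * cmod (y k)"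
        by (intro mult_mono abs_Re_le_cmod abs_Im_le_cmod; simp)+
      ultimately show "\<bar>Re (z k)\<bar> * \<bar>Re (y k)\<bar> \<le> 1 * ((1 + real_of_int \<bar>k\<bar>) * (cmod (z k) * cmod (y k)))"
        "\<bar>Im (z k)\<bar> * \<bar>Im (y k)\<bar> \<le> 1 * ((1 + real_of_int \<bar>k\<bar>) * (cmod (z k) * cmod (y k)))" by linarith+
    qed
    show "(\<lambda>k. Re (z k) * Re (y k)) summable_on UNIV" "(\<lambda>k. Im (z k) * Im (y k)) summable_on UNIV"
      by (rule decaying_weighted_summable[OF dz dy, of _ 1]; use * in \<open>simp add: abs_mult\<close>)+
  qed
  have Re_h: "Re (p k) - r * Re (p (k + 1)) = Re (z (int k + 1))" and Im_h: "Im (p k) - r * Im (p (k + 1)) = Im (z (int k + 1))" for k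
    unfolding zp by simp_all
  have Re_y: "Re (y (int (k + 1))) = r * Re (y (int k)) + (1 - r\<^sup>2) * Re (p k)"
    and Im_y: "Im (y (int (k + 1))) = r * Im (y (int k)) + (1 - r\<^sup>2) * Im (p k)" for k
    unfolding yp by (simp_all del: of_real_diff of_real_power)
  have Re_p: "Re (p k) = Re (t k) - r * Re (t (k + 1))" and Im_p: "Im (p k) = Im (t k) - r * Im (t (k + 1))" for k
    by (simp_all add: tp)
  have fold1: "real (k + 1) = real_of_int \<bar>int k + 1\<bar>" "int (k + 1) = int k + 1" for k by simp_all
  \<comment> \<open>The telescoping inequality concerns real sequences, so real and imaginary parts
    are treated separately.\<close>
  have Re_le: "2 * (\<Sum>\<^sub>\<infinity>k. Re (z (int k + 1)) * Re (y (int k + 1))) \<le> (\<Sum>\<^sub>\<infinity>k. real_of_int \<bar>int k + 1\<bar> * (Re (z (int k + 1)))\<^sup>2)"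
  proof -
    have "2 * (\<Sum>\<^sub>\<infinity>k. (Re (p k) - r * Re (p (k + 1))) * Re (y (int (k + 1)))) \<le> (\<Sum>\<^sub>\<infinity>k. real (k + 1) * (Re (p k) - r * Re (p (k + 1)))\<^sup>2)"
    proof (rule telescoping_inequality[where t = "\<lambda>k. Re (t k)" and C = "B / (1 - r)" and D = D])
      show "\<bar>Re (t k)\<bar> \<le> B / (1 - r) * psi (int k)" "\<bar>Re (y (int k))\<bar> \<le> D" for k
        using abs_Re_le_cmod[of "t k"] t_le[of k] abs_Re_le_cmod[of "y (int k)"] D(3)[of "int k"] by linarith+
      show "(\<lambda>k. real (k + 1) * (Re (p k) - r * Re (p (k + 1)))\<^sup>2) summable_on UNIV"
        using summable_on_int_foldD(1)[OF Re_sum] unfolding Re_h fold1 .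
      show "(\<lambda>k. (Re (p k) - r * Re (p (k + 1))) * Re (y (int (k + 1)))) summable_on UNIV"
        using summable_on_int_foldD(1)[OF part_sum(1)] unfolding Re_h fold1 .
    qed (simp_all only: Re_y Re_p t0 y0 zero_complex.simps)
    then show ?thesis unfolding Re_h fold1 .
  qed
  have Im_le: "2 * (\<Sum>\<^sub>\<infinity>k. Im (z (int k + 1)) * Im (y (int k + 1))) \<le> (\<Sum>\<^sub>\<infinity>k. real_of_int \<bar>int k + 1\<bar> * (Im (z (int k + 1)))\<^sup>2)"
  proof -
    have "2 * (\<Sum>\<^sub>\<infinity>k. (Im (p k) - r * Im (p (k + 1))) * Im (y (int (k + 1)))) \<le> (\<Sum>\<^sub>\<infinity>k. real (k + 1) * (Im (p k) - r * Im (p (k + 1)))\<^sup>2)"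
    proof (rule telescoping_inequality[where t = "\<lambda>k. Im (t k)" and C = "B / (1 - r)" and D = D])
      show "\<bar>Im (t k)\<bar> \<le> B / (1 - r) * psi (int k)" "\<bar>Im (y (int k))\<bar> \<le> D" for k
        using abs_Im_le_cmod[of "t k"] t_le[of k] abs_Im_le_cmod[of "y (int k)"] D(3)[of "int k"] by linarith+
      show "(\<lambda>k. real (k + 1) * (Im (p k) - r * Im (p (k + 1)))\<^sup>2) summable_on UNIV"
        using summable_on_int_foldD(1)[OF Im_sum] unfolding Im_h fold1 .
      show "(\<lambda>k. (Im (p k) - r * Im (p (k + 1))) * Im (y (int (k + 1)))) summable_on UNIV"
        using summable_on_int_foldD(1)[OF part_sum(2)] unfolding Im_h fold1 .
    qed (simp_all only: Im_y Im_p t0 y0 zero_complex.simps)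
    then show ?thesis unfolding Im_h fold1 .
  qed
  have ry: "real_seq y" unfolding y_def by (rule real_seq_kconv[OF rz])
  have neg: "z (- int n - 1) = cnj (z (int n + 1))" "y (- int n - 1) = cnj (y (int n + 1))" for n
    using rz ry unfolding real_seq_def by (metis minus_add_distrib diff_conv_add_uminus)+
  \<comment> \<open>Conjugate symmetry doubles the positive frequencies. Frequency 0 contributes
    nothing: \<open>y\<close> vanishes there on this side, and the weight |k| does on the
    other.\<close>
  have "2 * (\<Sum>\<^sub>\<infinity>k. Re (cnj (z k) * y k)) = 2 * (2 * (\<Sum>\<^sub>\<infinity>n. Re (cnj (z (int n + 1)) * y (int n + 1))))"
    by (simp only: infsum_int_fold[OF ip_sum] neg complex_cnj_cnj) (use y0 in simp)
  also have "(\<Sum>\<^sub>\<infinity>n. Re (cnj (z (int n + 1)) * y (int n + 1)))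
     = (\<Sum>\<^sub>\<infinity>k. Re (z (int k + 1)) * Re (y (int k + 1))) + (\<Sum>\<^sub>\<infinity>k. Im (z (int k + 1)) * Im (y (int k + 1)))"
    by (subst infsum_add[symmetric]) (use summable_on_int_foldD(1)[OF part_sum(1)] summable_on_int_foldD(1)[OF part_sum(2)] in simp_all)
  also have "2 * (2 * ((\<Sum>\<^sub>\<infinity>k. Re (z (int k + 1)) * Re (y (int k + 1))) + (\<Sum>\<^sub>\<infinity>k. Im (z (int k + 1)) * Im (y (int k + 1)))))
     \<le> 2 * ((\<Sum>\<^sub>\<infinity>k. real_of_int \<bar>int k + 1\<bar> * (Re (z (int k + 1)))\<^sup>2) + (\<Sum>\<^sub>\<infinity>k. real_of_int \<bar>int k + 1\<bar> * (Im (z (int k + 1)))\<^sup>2))"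
    using Re_le Im_le by simp
  also have "(\<Sum>\<^sub>\<infinity>k. real_of_int \<bar>int k + 1\<bar> * (Re (z (int k + 1)))\<^sup>2) + (\<Sum>\<^sub>\<infinity>k. real_of_int \<bar>int k + 1\<bar> * (Im (z (int k + 1)))\<^sup>2)
     = (\<Sum>\<^sub>\<infinity>k. real_of_int \<bar>int k + 1\<bar> * (cmod (z (int k + 1)))\<^sup>2)"
    by (subst infsum_add[symmetric]) (use summable_on_int_foldD(1)[OF Re_sum] summable_on_int_foldD(1)[OF Im_sum] in \<open>simp_all add: cmod_power2 distrib_left\<close>)
  also have "2 * \<dots> = (\<Sum>\<^sub>\<infinity>k. real_of_int \<bar>k\<bar> * (cmod (z k))\<^sup>2)"
  proof -
    have "real_of_int \<bar>- int n - 1\<bar> = real_of_int \<bar>int n + 1\<bar>" for n by simp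
    then show ?thesis by (simp only: infsum_int_fold[OF sq_sum] neg complex_mod_cnj)
  qed
  finally show ?thesis unfolding y_def .
qed

end

section \<open>The quadratic form of the second variation\<close>

definition ip :: "(int \<Rightarrow> complex) \<Rightarrow> (int \<Rightarrow> complex) \<Rightarrow> real" where
  "ip x v = (\<Sum>\<^sub>\<infinity>k. Re (cnj (x k) * v k))"

definition wip :: "(int \<Rightarrow> complex) \<Rightarrow> (int \<Rightarrow> complex) \<Rightarrow> real" where
  "wip x v = (\<Sum>\<^sub>\<infinity>k. real_of_int \<bar>k\<bar> * Re (cnj (x k) * v k))"

lemma decaying_bounded: "decaying a \<Longrightarrow> \<exists>B. \<forall>k. cmod (a k) \<le> B"
  by (elim decayingE) blast

lemma ip_summable:
  assumes "decaying x" "decaying v"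
  shows "(\<lambda>k. Re (cnj (x k) * v k)) summable_on UNIV" "(\<lambda>k. real_of_int \<bar>k\<bar> * Re (cnj (x k) * v k)) summable_on UNIV"
proof -
  have b: "\<bar>Re (cnj (x k) * v k)\<bar> \<le> cmod (x k) * cmod (v k)" for k
    using abs_Re_le_cmod[of "cnj (x k) * v k"] by (simp only: norm_mult complex_mod_cnj)
  have "1 * \<bar>Re (cnj (x k) * v k)\<bar> \<le> (1 + real_of_int \<bar>k\<bar>) * (cmod (x k) * cmod (v k))" for k
    by (intro mult_mono b) auto
  then have 1: "norm (Re (cnj (x k) * v k)) \<le> 1 * ((1 + real_of_int \<bar>k\<bar>) * (cmod (x k) * cmod (v k)))" for k
    by (simp only: mult_1 real_norm_def)
  show "(\<lambda>k. Re (cnj (x k) * v k)) summable_on UNIV"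
    by (rule decaying_weighted_summable[OF assms 1]) simp
  have "real_of_int \<bar>k\<bar> * \<bar>Re (cnj (x k) * v k)\<bar> \<le> (1 + real_of_int \<bar>k\<bar>) * (cmod (x k) * cmod (v k))" for k
    by (intro mult_mono b) auto
  then have 2: "norm (real_of_int \<bar>k\<bar> * Re (cnj (x k) * v k)) \<le> 1 * ((1 + real_of_int \<bar>k\<bar>) * (cmod (x k) * cmod (v k)))" for k
    by (simp only: mult_1 real_norm_def abs_mult) simp
  show "(\<lambda>k. real_of_int \<bar>k\<bar> * Re (cnj (x k) * v k)) summable_on UNIV"
    by (rule decaying_weighted_summable[OF assms 2]) simp
qed

lemma Re_cnj_self: "Re (cnj a * a) = (cmod a)\<^sup>2"
  unfolding cmod_power2 by (simp flip: power2_eq_square)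

lemma Re_cnj_mult_commute: "Re (cnj a * b) = Re (cnj b * a)"
  by (simp add: mult.commute)

lemma ip_commute: "ip x v = ip v x"
  unfolding ip_def by (intro infsum_cong) (rule Re_cnj_mult_commute)

lemma wip_commute: "wip x v = wip v x"
  unfolding wip_def by (intro infsum_cong arg_cong2[where f = times]) (auto intro: Re_cnj_mult_commute)

lemma ip_add_right:
  assumes "decaying x" "decaying v" "decaying w"
  shows "ip x (\<lambda>k. v k + w k) = ip x v + ip x w" "wip x (\<lambda>k. v k + w k) = wip x v + wip x w"
  unfolding ip_def wip_def
  by (simp_all only: distrib_left plus_complex.simps infsum_add ip_summable assms)

lemma ip_add_left:
  assumes "decaying x" "decaying v" "decaying w"
  shows "ip (\<lambda>k. v k + w k) x = ip v x + ip w x" "wip (\<lambda>k. v k + w k) x = wip v x + wip w x"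
  using ip_add_right[OF assms] by (simp_all only: ip_commute[of _ x] wip_commute[of _ x])

lemma ip_cmult_right:
  "ip x (\<lambda>k. of_real c * v k) = c * ip x v" "wip x (\<lambda>k. of_real c * v k) = c * wip x v"
  unfolding ip_def wip_def by (subst infsum_cmult_right'[symmetric]; simp add: algebra_simps)+

lemma ip_cmult_left:
  "ip (\<lambda>k. of_real c * v k) x = c * ip v x" "wip (\<lambda>k. of_real c * v k) x = c * wip v x"
  using ip_cmult_right by (simp_all only: ip_commute[of _ x] wip_commute[of _ x])

lemma ip_self: "ip v v = (\<Sum>\<^sub>\<infinity>k. (cmod (v k))\<^sup>2)" "wip v v = (\<Sum>\<^sub>\<infinity>k. real_of_int \<bar>k\<bar> * (cmod (v k))\<^sup>2)"
  unfolding ip_def wip_def by (simp_all only: Re_cnj_self)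

lemma ip_self_nonneg: "ip v v \<ge> 0" "wip v v \<ge> 0"
  unfolding ip_self by (simp_all add: infsum_nonneg)

lemma ip_self_ge:
  assumes "decaying v"
  shows "(cmod (v k))\<^sup>2 \<le> ip v v"
proof -
  have "(\<lambda>k. (cmod (v k))\<^sup>2) summable_on UNIV"
    using ip_summable(1)[OF assms assms] by (simp only: Re_cnj_self)
  from finite_sum_le_infsum[OF this, of "{k}"] show ?thesis unfolding ip_self by simp
qed

lemma ip_add_self_le:
  assumes "decaying v" "decaying w"
  shows "ip (\<lambda>k. v k + w k) (\<lambda>k. v k + w k) \<le> 2 * ip v v + 2 * ip w w"
proof -
  have sv: "(\<lambda>k. (cmod (u k))\<^sup>2) summable_on UNIV" if "decaying u" for u
    using ip_summable(1)[OF that that] by (simp only: Re_cnj_self)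
  have "ip (\<lambda>k. v k + w k) (\<lambda>k. v k + w k) \<le> (\<Sum>\<^sub>\<infinity>k. 2 * (cmod (v k))\<^sup>2 + 2 * (cmod (w k))\<^sup>2)"
    unfolding ip_self
  proof (rule infsum_mono)
    fix k :: int
    have "(cmod (v k + w k))\<^sup>2 \<le> (cmod (v k) + cmod (w k))\<^sup>2"
      by (intro power_mono norm_triangle_ineq) auto
    also have "\<dots> \<le> 2 * (cmod (v k))\<^sup>2 + 2 * (cmod (w k))\<^sup>2"
      using zero_le_power2[of "cmod (v k) - cmod (w k)"] by (simp add: power2_eq_square algebra_simps)
    finally show "(cmod (v k + w k))\<^sup>2 \<le> 2 * (cmod (v k))\<^sup>2 + 2 * (cmod (w k))\<^sup>2" .
  qed (intro sv decaying_add summable_on_add summable_on_cmult_right assms)+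
  also have "\<dots> = 2 * ip v v + 2 * ip w w"
    unfolding ip_self using sv[OF assms(1)] sv[OF assms(2)]
    by (simp add: infsum_add infsum_cmult_right' summable_on_cmult_right)
  finally show ?thesis .
qed

context poisson_kernel
begin

text \<open>The l^1 norm of the kernel, which by Schur's test bounds the convolution on l^2.\<close>

definition kmass :: real where "kmass = infsum (ker r) UNIV"

lemma kmass_nonneg: "kmass \<ge> 0"
  unfolding kmass_def by (intro infsum_nonneg) (auto intro: less_imp_le ker_pos)

lemma ker_square_has_sum:
  assumes "decaying v"
  shows "((\<lambda>(k, l). ker r (k - l) * (cmod (v k))\<^sup>2) has_sum kmass * ip v v) (UNIV \<times> UNIV)"
proof -
  have sv: "((\<lambda>k. (cmod (v k))\<^sup>2) has_sum ip v v) UNIV"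
    using ip_summable(1)[OF assms assms] unfolding ip_self by (intro has_sum_infsum) (simp only: Re_cnj_self)
  have 1: "((\<lambda>l. (\<lambda>(k, l). ker r (k - l) * (cmod (v k))\<^sup>2) (k, l)) has_sum kmass * (cmod (v k))\<^sup>2) UNIV" for k
    unfolding prod.case kmass_def by (intro has_sum_cmult_left ker_shift_has_sum)
  have 2: "((\<lambda>k. kmass * (cmod (v k))\<^sup>2) has_sum kmass * ip v v) UNIV"
    by (intro has_sum_cmult_right sv)
  have "(\<lambda>(k, l). ker r (k - l) * (cmod (v k))\<^sup>2) summable_on (UNIV \<times> UNIV)"
    by (rule summable_on_SigmaI[OF 1 has_sum_imp_summable[OF 2]]) (use ker_pos in \<open>auto simp: less_imp_le\<close>)
  from has_sum_SigmaI[OF 1 2 this] show ?thesis .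
qed

text \<open>Written as an absolutely convergent double sum, the form is visibly symmetric, and the
  arithmetic-geometric mean inequality gives the Schur bound.\<close>

lemma kconv_form:
  assumes "decaying x" "decaying v"
  shows "((\<lambda>(k, l). ker r (k - l) * Re (cnj (x k) * v l)) has_sum ip x (kconv r v)) (UNIV \<times> UNIV)"
    and "\<bar>ip x (kconv r v)\<bar> \<le> kmass * (ip x x + ip v v) / 2"
proof -
  let ?G = "\<lambda>(k, l). ker r (k - l) * Re (cnj (x k) * v l)"
  let ?H = "\<lambda>p. ((\<lambda>(k, l). ker r (k - l) * (cmod (x k))\<^sup>2) p + (\<lambda>(k, l). ker r (k - l) * (cmod (v l))\<^sup>2) p) / 2"
  have "((\<lambda>(k, l). ker r (k - l) * (cmod (v l))\<^sup>2) has_sum kmass * ip v v) (UNIV \<times> UNIV)"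
    using ker_square_has_sum[OF assms(2)] by (subst has_sum_swap) (simp only: prod.case ker_minus_commute)
  then have H: "(?H has_sum (kmass * ip x x + kmass * ip v v) / 2) (UNIV \<times> UNIV)"
    by (intro has_sum_divide_const has_sum_add ker_square_has_sum assms)
  have GH: "norm (?G p) \<le> ?H p" for p
  proof -
    obtain k l where p: "p = (k, l)" by force
    have "\<bar>Re (cnj (x k) * v l)\<bar> \<le> cmod (x k) * cmod (v l)"
      using abs_Re_le_cmod[of "cnj (x k) * v l"] by (simp only: norm_mult complex_mod_cnj)
    also have "\<dots> \<le> ((cmod (x k))\<^sup>2 + (cmod (v l))\<^sup>2) / 2"
      using zero_le_power2[of "cmod (x k) - cmod (v l)"] by (simp add: power2_eq_square algebra_simps)
    finally have "ker r (k - l) * \<bar>Re (cnj (x k) * v l)\<bar> \<le> ker r (k - l) * (((cmod (x k))\<^sup>2 + (cmod (v l))\<^sup>2) / 2)"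
      by (intro mult_left_mono) (auto intro: less_imp_le ker_pos)
    then show ?thesis unfolding p
      by (simp only: prod.case real_norm_def abs_mult abs_of_pos[OF ker_pos] distrib_left times_divide_eq_right)
  qed
  have sG: "?G summable_on (UNIV \<times> UNIV)"
    by (rule abs_summable_summable, rule summable_on_comparison_test[OF has_sum_imp_summable[OF H]]) (use GH in auto)
  obtain B where B: "\<And>k. cmod (v k) \<le> B" using decayingE[OF assms(2)] by metis
  have inner: "((\<lambda>l. ?G (k, l)) has_sum Re (cnj (x k) * kconv r v k)) UNIV" for k
  proof -
    have "((\<lambda>l. Re (cnj (x k) * (of_real (ker r (k - l)) * v l))) has_sum Re (cnj (x k) * kconv r v k)) UNIV"
      by (intro has_sum_Re has_sum_cmult_right kconv_has_sum[of v B] B)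
    then show ?thesis by (simp add: algebra_simps)
  qed
  have "((\<lambda>k. Re (cnj (x k) * kconv r v k)) has_sum ip x (kconv r v)) UNIV"
    unfolding ip_def by (intro has_sum_infsum ip_summable decaying_kconv assms)
  from has_sum_SigmaI[OF inner this sG] show 1: "(?G has_sum ip x (kconv r v)) (UNIV \<times> UNIV)" .
  have "norm (ip x (kconv r v)) \<le> (kmass * ip x x + kmass * ip v v) / 2"
    by (rule norm_infsum_le[OF 1 H]) (rule GH)
  then show "\<bar>ip x (kconv r v)\<bar> \<le> kmass * (ip x x + ip v v) / 2" by (simp add: distrib_left)
qed

lemma kconv_symmetric:
  assumes "decaying x" "decaying v"
  shows "ip x (kconv r v) = ip v (kconv r x)"
proof -
  have "((\<lambda>(k, l). ker r (k - l) * Re (cnj (x k) * v l)) has_sum ip v (kconv r x)) (UNIV \<times> UNIV)"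
    using kconv_form(1)[OF assms(2,1)] by (subst has_sum_swap) (simp only: prod.case ker_minus_commute Re_cnj_mult_commute)
  with kconv_form(1)[OF assms] show ?thesis by (rule has_sum_unique)
qed

definition qform :: "(int \<Rightarrow> complex) \<Rightarrow> (int \<Rightarrow> complex) \<Rightarrow> real" where
  "qform x v = wip x v + \<omega> * ip x v - 2 * ip x (kconv r v)"

lemma qform_commute: "decaying x \<Longrightarrow> decaying v \<Longrightarrow> qform x v = qform v x"
  unfolding qform_def by (simp add: kconv_symmetric[of x v] ip_commute[of x v] wip_commute[of x v])

lemma kconv_add:
  assumes "decaying x" "decaying v"
  shows "kconv r (\<lambda>k. x k + v k) = (\<lambda>k. kconv r x k + kconv r v k)"
proof
  fix k
  obtain B where B: "\<And>k. cmod (x k) \<le> B" using decayingE[OF assms(1)] by metis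
  obtain D where D: "\<And>k. cmod (v k) \<le> D" using decayingE[OF assms(2)] by metis
  have "((\<lambda>l. of_real (ker r (k - l)) * x l + of_real (ker r (k - l)) * v l) has_sum (kconv r x k + kconv r v k)) UNIV"
    by (intro has_sum_add kconv_has_sum[of x B] kconv_has_sum[of v D] B D)
  then show "kconv r (\<lambda>k. x k + v k) k = kconv r x k + kconv r v k"
    unfolding kconv_def[of r "\<lambda>k. x k + v k"] by (simp add: distrib_left infsumI)
qed

lemma kconv_cmult: "kconv r (\<lambda>k. c * v k) = (\<lambda>k. c * kconv r v k)"
  unfolding kconv_def by (subst infsum_cmult_right'[symmetric]) (simp add: mult_ac)

lemma qform_add_right:
  assumes "decaying x" "decaying v" "decaying w"
  shows "qform x (\<lambda>k. v k + w k) = qform x v + qform x w"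
  unfolding qform_def
  by (simp add: kconv_add assms ip_add_right decaying_kconv algebra_simps)

lemma qform_cmult_right: "qform x (\<lambda>k. of_real c * v k) = c * qform x v"
  unfolding qform_def by (simp add: kconv_cmult ip_cmult_right algebra_simps)

lemma qform_add_self:
  assumes "decaying v" "decaying w"
  shows "qform (\<lambda>k. v k + w k) (\<lambda>k. v k + w k) = qform v v + 2 * qform w v + qform w w"
proof -
  have d: "decaying (\<lambda>k. v k + w k)" by (intro decaying_add assms)
  show ?thesis
    using qform_add_right[OF d assms] qform_add_right[OF assms(1) assms] qform_add_right[OF assms(2) assms]
      qform_commute[OF d assms(1)] qform_commute[OF d assms(2)] qform_commute[OF assms] by simp
qed

text \<open>\<open>P\<close>, \<open>DP\<close> and \<open>HDP\<close> are the coefficients of the Poisson kernel \<open>P\<close>, of \<open>|D| P\<close> and of \<open>P'\<close>.\<close>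

definition P :: "int \<Rightarrow> complex" where "P k = of_real (ker r k)"
definition DP :: "int \<Rightarrow> complex" where "DP k = of_real (real_of_int \<bar>k\<bar> * ker r k)"
definition HDP :: "int \<Rightarrow> complex" where "HDP k = \<i> * of_real (real_of_int k * ker r k)"

lemma decaying_basis: "decaying P" "decaying DP" "decaying HDP"
proof -
  show "decaying P" unfolding P_def by (rule decaying_ker)
  have *: "real_of_int \<bar>k\<bar> * ker r k \<le> 1 * ((1 + real_of_int \<bar>k\<bar>) ^ 1 * ker r k)" for k
    using ker_pos[of k] by (simp add: distrib_right)
  show "decaying DP" unfolding DP_def
    by (rule decaying_ker_poly[of _ 1 1]) (use * ker_pos in \<open>simp_all add: norm_mult less_imp_le\<close>)
  show "decaying HDP" unfolding HDP_def
    by (rule decaying_ker_poly[of _ 1 1]) (use * ker_pos in \<open>simp_all add: norm_mult less_imp_le\<close>)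
qed

lemma kconv_basis:
  "kconv r P k = DP k + of_real \<omega> * P k"
  "kconv r DP k = of_real (((real_of_int \<bar>k\<bar>)\<^sup>2 + \<omega> * real_of_int \<bar>k\<bar> + \<sigma>) / 2 * ker r k)"
  "kconv r HDP k = \<i> * of_real ((real_of_int \<bar>k\<bar> + \<omega>) / 2 * real_of_int k * ker r k)"
proof -
  show "kconv r P k = DP k + of_real \<omega> * P k"
    using kconv_ker[of k] unfolding P_def DP_def by (simp add: algebra_simps)
  show "kconv r DP k = of_real (((real_of_int \<bar>k\<bar>)\<^sup>2 + \<omega> * real_of_int \<bar>k\<bar> + \<sigma>) / 2 * ker r k)"
    using kconv_abs_ker[of k] unfolding DP_def .
  show "kconv r HDP k = \<i> * of_real ((real_of_int \<bar>k\<bar> + \<omega>) / 2 * real_of_int k * ker r k)"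
    unfolding HDP_def kconv_cmult using kconv_odd_ker[of k] by simp
qed

lemma ip_P_eq:
  assumes "decaying v"
  shows "ip P v = Re (kconv r v 0)"
proof -
  obtain B where B: "\<And>k. cmod (v k) \<le> B" using decayingE[OF assms] by metis
  have "((\<lambda>l. Re (of_real (ker r (0 - l)) * v l)) has_sum Re (kconv r v 0)) UNIV"
    by (intro has_sum_Re kconv_has_sum[of v B] B)
  then show ?thesis unfolding ip_def P_def by (simp add: infsumI)
qed

text \<open>Pairing with P is convolution at frequency 0, so the table is read off from the explicit
  convolutions. The last two entries vanish because \<open>HDP\<close> is purely imaginary while the
  other two sequences are real.\<close>

lemma ip_basis:
  "ip P P = \<omega>" "ip P DP = \<sigma> / 2" "ip DP DP = \<sigma> * \<omega> / 2" "ip HDP HDP = \<sigma> * \<omega> / 2"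
  "ip P HDP = 0" "ip DP HDP = 0"
proof -
  show "ip P P = \<omega>" by (simp add: ip_P_eq decaying_basis kconv_basis) (simp add: DP_def P_def ker_def)
  show "ip P DP = \<sigma> / 2" by (simp add: ip_P_eq decaying_basis kconv_basis) (simp add: ker_def)
  let ?v = "\<lambda>l. complex_of_real ((real_of_int \<bar>l\<bar>)\<^sup>2 * ker r l)"
  have "decaying (\<lambda>k. of_real ((\<lambda>n. (real n)\<^sup>2) (nat \<bar>k\<bar>) * ker r k))"
    by (rule decaying_cubic_ker[of _ 1]) (use cubic_bounds(3) in auto)
  then have dv: "decaying ?v" by simp
  then obtain B where B: "\<forall>k. cmod (?v k) \<le> B" using decaying_bounded by blast
  have "((\<lambda>l. Re (of_real (ker r (0 - l)) * ?v l)) has_sum Re (kconv r ?v 0)) UNIV"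
    by (intro has_sum_Re kconv_has_sum[of ?v B] B[rule_format])
  then have S: "((\<lambda>l. (real_of_int l)\<^sup>2 * (ker r l)\<^sup>2) has_sum \<sigma> * \<omega> / 2) UNIV"
    unfolding kconv_square_ker by (simp add: power2_eq_square mult_ac)
  show "ip DP DP = \<sigma> * \<omega> / 2" "ip HDP HDP = \<sigma> * \<omega> / 2"
    using infsumI[OF S] unfolding ip_self DP_def HDP_def by (simp_all add: norm_mult power_mult_distrib)
  show "ip P HDP = 0" "ip DP HDP = 0" by (simp_all add: ip_def P_def DP_def HDP_def)
qed

text \<open>The operator |D| + omega - 2 P maps P to -(|D| P + omega P), |D| P to -sigma P and P' to
  0; in the second case the terms |D|^2 P and omega |D| P cancel.\<close>

lemma qform_basis:
  assumes "decaying x"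
  shows "qform x P = - ip x DP - \<omega> * ip x P" "qform x DP = - \<sigma> * ip x P" "qform x HDP = 0"
proof -
  have "kconv r P = (\<lambda>k. DP k + of_real \<omega> * P k)" using kconv_basis(1) by (rule ext)
  moreover have "wip x P = ip x DP" unfolding wip_def ip_def P_def DP_def by (intro infsum_cong) simp
  ultimately show "qform x P = - ip x DP - \<omega> * ip x P"
    unfolding qform_def by (simp add: ip_add_right assms decaying_basis decaying_cmult ip_cmult_right)
  have dk: "decaying (\<lambda>k. 2 * kconv r DP k)" "decaying (\<lambda>k. of_real (- \<omega>) * DP k)" "decaying (\<lambda>k. of_real (- \<sigma>) * P k)"
    by (intro decaying_cmult decaying_kconv decaying_basis)+
  have "wip x DP = ip x (\<lambda>k. 2 * kconv r DP k + (of_real (- \<omega>) * DP k + of_real (- \<sigma>) * P k))"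
    unfolding wip_def ip_def kconv_basis by (intro infsum_cong) (simp add: DP_def P_def power2_eq_square field_simps)
  also have "\<dots> = ip x (\<lambda>k. 2 * kconv r DP k) + (- \<omega> * ip x DP - \<sigma> * ip x P)"
    by (simp only: ip_add_right assms dk decaying_add ip_cmult_right)
  also have "ip x (\<lambda>k. 2 * kconv r DP k) = 2 * ip x (kconv r DP)"
    using ip_cmult_right(1)[of x 2] by simp
  finally show "qform x DP = - \<sigma> * ip x P" unfolding qform_def by simp
  have dk: "decaying (\<lambda>k. 2 * kconv r HDP k)" "decaying (\<lambda>k. of_real (- \<omega>) * HDP k)"
    by (intro decaying_cmult decaying_kconv decaying_basis)+
  have "wip x HDP = ip x (\<lambda>k. 2 * kconv r HDP k + of_real (- \<omega>) * HDP k)"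
    unfolding wip_def ip_def kconv_basis by (intro infsum_cong) (simp add: HDP_def field_simps)
  also have "\<dots> = ip x (\<lambda>k. 2 * kconv r HDP k) - \<omega> * ip x HDP"
    by (simp only: ip_add_right assms dk decaying_add ip_cmult_right)
  also have "ip x (\<lambda>k. 2 * kconv r HDP k) = 2 * ip x (kconv r HDP)"
    using ip_cmult_right(1)[of x 2] by simp
  finally show "qform x HDP = 0" unfolding qform_def by simp
qed

end

text \<open>Finsler's lemma in the plane. The hypothesis is positivity on the null line of l x + m
  y, which is spanned by (m, -l); a large multiple of the squared functional restores positivity in
  the other direction.\<close>

lemma binary_form_coercive:
  fixes a b c l m :: real
  assumes D: "a * m\<^sup>2 - 2 * b * l * m + c * l\<^sup>2 > 0"
  shows "\<exists>K\<ge>0. \<exists>e>0. \<forall>x y. e * (x\<^sup>2 + y\<^sup>2) \<le> a * x\<^sup>2 + 2 * b * x * y + c * y\<^sup>2 + K * (l * x + m * y)\<^sup>2"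
proof -
  define n where "n = l\<^sup>2 + m\<^sup>2"
  \<comment> \<open>Up to the factor n^2, these are the coefficients of the form in the orthogonal
    coordinates u = l x + m y and w = m x - l y: d of w^2, g of u^2 and h of 2 u w.\<close>
  define d where "d = a * m\<^sup>2 - 2 * b * l * m + c * l\<^sup>2"
  define g where "g = a * l\<^sup>2 + 2 * b * l * m + c * m\<^sup>2"
  define h where "h = a * l * m + b * (m\<^sup>2 - l\<^sup>2) - c * l * m"
  have d0: "d > 0" using D by (simp add: d_def)
  have "l \<noteq> 0 \<or> m \<noteq> 0" using D by auto
  then have n0: "n > 0" unfolding n_def by (simp add: sum_power2_gt_zero_iff)
  \<comment> \<open>K outweighs |g| and the cross term, which is completed to a square with half of
    d w^2; what remains is d/2 in both directions.\<close>
  define K where "K = (d / 2 + 2 * h\<^sup>2 / d + \<bar>g\<bar>) / n\<^sup>2"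
  define e where "e = d / (2 * n)"
  have "e * (x\<^sup>2 + y\<^sup>2) \<le> a * x\<^sup>2 + 2 * b * x * y + c * y\<^sup>2 + K * (l * x + m * y)\<^sup>2" for x y
  proof -
    let ?Q = "a * x\<^sup>2 + 2 * b * x * y + c * y\<^sup>2"
    define u where "u = l * x + m * y"
    define w where "w = m * x - l * y"
    have e1: "n\<^sup>2 * ?Q = g * u\<^sup>2 + 2 * h * u * w + d * w\<^sup>2"
      unfolding n_def g_def h_def d_def u_def w_def by algebra
    have e2: "n * (x\<^sup>2 + y\<^sup>2) = u\<^sup>2 + w\<^sup>2"
      unfolding n_def u_def w_def by algebra
    have "0 \<le> (d / 2) * (w + 2 * h / d * u)\<^sup>2" using d0 by simp
    also have "\<dots> = d / 2 * w\<^sup>2 + 2 * h * u * w + 2 * h\<^sup>2 / d * u\<^sup>2"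
      using d0 by (simp add: power2_eq_square field_simps)
    finally have "0 \<le> d / 2 * w\<^sup>2 + 2 * h * u * w + 2 * h\<^sup>2 / d * u\<^sup>2" .
    moreover have "0 \<le> (g + \<bar>g\<bar>) * u\<^sup>2" by simp
    moreover have Kn: "n\<^sup>2 * (K * u\<^sup>2) = (d / 2 + 2 * h\<^sup>2 / d + \<bar>g\<bar>) * u\<^sup>2" using n0 by (simp add: K_def)
    moreover have en: "n\<^sup>2 * (e * (x\<^sup>2 + y\<^sup>2)) = d / 2 * (n * (x\<^sup>2 + y\<^sup>2))"
      using n0 by (simp add: e_def power2_eq_square)
    ultimately have "n\<^sup>2 * (e * (x\<^sup>2 + y\<^sup>2)) \<le> n\<^sup>2 * (?Q + K * u\<^sup>2)"
      unfolding en e2 distrib_left[of "n\<^sup>2" ?Q] e1 Kn by (simp only: distrib_left distrib_right)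
    then show ?thesis using n0 unfolding u_def by (simp add: mult_le_cancel_left_pos)
  qed
  moreover have "K \<ge> 0" "e > 0" using d0 n0 by (simp_all add: K_def e_def)
  ultimately show ?thesis by blast
qed

lemma ip_Cauchy_Schwarz:
  assumes "decaying x" "decaying v"
  shows "(ip x v)\<^sup>2 \<le> ip x x * ip v v"
proof (cases "ip x x = 0")
  case True
  have "x k = 0" for k using ip_self_ge[OF assms(1), of k] True by simp
  then show ?thesis by (simp add: ip_def)
next
  case False
  then have pos: "ip x x > 0" using ip_self_nonneg(1)[of x] by linarith
  define t where "t = - ip x v / ip x x"
  have dx: "decaying (\<lambda>k. of_real t * x k)" by (intro decaying_cmult assms)
  have "0 \<le> ip (\<lambda>k. v k + of_real t * x k) (\<lambda>k. v k + of_real t * x k)" by (rule ip_self_nonneg)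
  also have "\<dots> = ip v v + 2 * t * ip x v + t * t * ip x x"
    by (simp add: ip_add_left ip_add_right decaying_add dx assms ip_cmult_left ip_cmult_right ip_commute[of v x] distrib_left)
  also have "\<dots> = ip v v - (ip x v)\<^sup>2 / ip x x"
    using pos by (simp add: t_def power2_eq_square field_simps)
  finally show ?thesis using pos by (simp add: field_simps)
qed

text \<open>An equivalent squared \<open>H\<^sup>1\<^sup>/\<^sup>2\<close> norm.\<close>

definition hsq :: "(int \<Rightarrow> complex) \<Rightarrow> real" where
  "hsq v = (\<Sum>\<^sub>\<infinity>k. (1 + real_of_int \<bar>k\<bar>) * (cmod (v k))\<^sup>2)"

lemma hsq_summable:
  assumes "decaying v"
  shows "(\<lambda>k. (1 + real_of_int \<bar>k\<bar>) * (cmod (v k))\<^sup>2) summable_on UNIV"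
  by (rule decaying_weighted_summable[OF assms assms, of _ 1]) (simp_all add: power2_eq_square abs_mult)

lemma hsq_eq:
  assumes "decaying v"
  shows "hsq v = ip v v + wip v v"
  using ip_summable[OF assms assms] unfolding hsq_def ip_self Re_cnj_self
  by (subst infsum_add[symmetric]) (simp_all add: distrib_right)

lemma hsq_nonneg: "hsq v \<ge> 0"
  unfolding hsq_def by (intro infsum_nonneg) auto

context poisson_kernel
begin

text \<open>Orthogonality to P makes the convolution vanish at frequency 0. Orthogonality to |D| P
  and to P' are the real and imaginary parts of one complex condition: the power series of the
  positive frequencies has derivative 0 at r.\<close>

lemma qform_orthogonal:
  assumes dz: "decaying z" and rz: "real_seq z" and z: "ip P z = 0" "ip DP z = 0" "ip HDP z = 0"
  shows "\<omega> * ip z z \<le> qform z z"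
proof -
  have "real_seq (kconv r z)" by (rule real_seq_kconv[OF rz])
  then have "kconv r z (- 0) = cnj (kconv r z 0)" unfolding real_seq_def by blast
  then have "Im (kconv r z 0) = 0" by (simp add: complex_eq_iff)
  moreover have "Re (kconv r z 0) = 0" using ip_P_eq[OF dz] z(1) by simp
  ultimately have z0: "kconv r z 0 = 0" by (simp add: complex_eq_iff)
  have neg: "z (- int n - 1) = cnj (z (int n + 1))" for n
    using rz[unfolded real_seq_def, rule_format, of "int n + 1"] by (simp only: minus_add_distrib diff_conv_add_uminus)
  let ?g = "\<lambda>n. real (n + 1) * r ^ (n + 1)"
  have kn: "real_of_int \<bar>int n + 1\<bar> * ker r (int n + 1) = ?g n" "real_of_int \<bar>- int n - 1\<bar> * ker r (- int n - 1) = ?g n"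
    "real_of_int (int n + 1) * ker r (int n + 1) = ?g n" "real_of_int (- int n - 1) * ker r (- int n - 1) = - ?g n" for n
  proof -
    have "nat \<bar>int n + 1\<bar> = n + 1" "nat \<bar>- int n - 1\<bar> = n + 1" by linarith+
    then show "real_of_int \<bar>int n + 1\<bar> * ker r (int n + 1) = ?g n" "real_of_int \<bar>- int n - 1\<bar> * ker r (- int n - 1) = ?g n"
      "real_of_int (int n + 1) * ker r (int n + 1) = ?g n" "real_of_int (- int n - 1) * ker r (- int n - 1) = - ?g n"
      unfolding ker_def by (simp_all add: algebra_simps)
  qed
  have D: "(\<lambda>k. real_of_int \<bar>k\<bar> * ker r k * Re (z k)) summable_on UNIV" "(\<lambda>k. real_of_int k * ker r k * Im (z k)) summable_on UNIV"
    using ip_summable(1)[OF decaying_basis(2) dz] ip_summable(1)[OF decaying_basis(3) dz] by (simp_all add: DP_def HDP_def)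
  have "0 = (\<Sum>\<^sub>\<infinity>k. real_of_int \<bar>k\<bar> * ker r k * Re (z k))" using z(2) by (simp add: ip_def DP_def)
  also have "\<dots> = 2 * (\<Sum>\<^sub>\<infinity>n. ?g n * Re (z (int n + 1)))"
    by (simp only: infsum_int_fold[OF D(1)] kn neg complex_cnj) simp
  finally have R: "(\<Sum>\<^sub>\<infinity>n. ?g n * Re (z (int n + 1))) = 0" by simp
  have "0 = (\<Sum>\<^sub>\<infinity>k. real_of_int k * ker r k * Im (z k))" using z(3) by (simp add: ip_def HDP_def)
  also have "\<dots> = 2 * (\<Sum>\<^sub>\<infinity>n. ?g n * Im (z (int n + 1)))"
    by (simp only: infsum_int_fold[OF D(2)] kn neg complex_cnj) simp
  finally have I: "(\<Sum>\<^sub>\<infinity>n. ?g n * Im (z (int n + 1))) = 0" by simp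
  have "((\<lambda>n. complex_of_real (?g n * Re (z (int n + 1)))) has_sum of_real 0) UNIV"
    using has_sum_infsum[OF summable_on_int_foldD(1)[OF D(1)]] unfolding kn R by (rule has_sum_of_real)
  moreover have "((\<lambda>n. \<i> * complex_of_real (?g n * Im (z (int n + 1)))) has_sum \<i> * of_real 0) UNIV"
    using has_sum_infsum[OF summable_on_int_foldD(1)[OF D(2)]] unfolding kn I by (intro has_sum_cmult_right has_sum_of_real)
  ultimately have "((\<lambda>n. complex_of_real (?g n * Re (z (int n + 1))) + \<i> * complex_of_real (?g n * Im (z (int n + 1)))) has_sum (of_real 0 + \<i> * of_real 0)) UNIV"
    by (rule has_sum_add)
  moreover have "complex_of_real (?g n * Re (z (int n + 1))) + \<i> * complex_of_real (?g n * Im (z (int n + 1))) = of_real (?g n) * z (int n + 1)" for n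
    by (subst (3) complex_eq) (simp add: algebra_simps)
  ultimately have "((\<lambda>n. of_real (?g n) * z (int n + 1)) has_sum 0) UNIV" by simp
  from kernel_form_le_weight[OF dz rz z0 this] show ?thesis
    unfolding qform_def ip_self by (simp add: ip_def)
qed

text \<open>The decomposition v = w + z along the span is orthogonal for the form as well, since the
  operator preserves the span. Finsler's lemma handles P and |D| P, \<open>qform_orthogonal\<close>
  handles z, and the P' component, invisible to the form, is recovered from Im (v 1) = 0.\<close>

lemma qform_coercive:
  assumes \<kappa>: "\<kappa> > 0" "\<kappa> < 1"
  shows "\<exists>K\<ge>0. \<exists>g>0. \<forall>v. decaying v \<longrightarrow> real_seq v \<longrightarrow> Im (v 1) = 0 \<longrightarrow>
    g * hsq v \<le> qform v v + K * (ip P v + \<kappa> * ip DP v)\<^sup>2"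
proof -
  \<comment> \<open>The values of the penalty functional on P and on |D| P.\<close>
  define l where "l = \<omega> + \<kappa> * \<sigma> / 2"
  define m where "m = \<sigma> / 2 + \<kappa> * \<sigma> * \<omega> / 2"
  \<comment> \<open>The matrix of the form in the basis P, |D| P. Its determinant is negative, so
    there is exactly one negative direction.\<close>
  let ?a = "- (\<omega>\<^sup>2 + \<sigma> / 2)" and ?b = "- (\<sigma> * \<omega>)" and ?c = "- (\<sigma>\<^sup>2 / 2)"
  have s: "\<sigma> = \<omega> * \<omega> - 1" by (simp add: \<sigma>_def power2_eq_square)
  \<comment> \<open>The form on the null line of the penalty; the last factor is positive because 0
    < kappa < 1 and omega > 1.\<close>
  have "8 * (?a * m\<^sup>2 - 2 * ?b * l * m + ?c * l\<^sup>2) = \<sigma>\<^sup>2 * (\<omega>\<^sup>2 + 1) * (1 + 2 * \<kappa> * \<omega> - \<kappa>\<^sup>2)"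
    unfolding l_def m_def s by (simp add: field_simps) algebra
  moreover have "\<kappa>\<^sup>2 < 1" using \<kappa> by (simp add: power_less_one_iff abs_square_less_1)
  then have "0 < 1 + 2 * \<kappa> * \<omega> - \<kappa>\<^sup>2" using \<kappa> omega_ge_1 mult_pos_pos[of \<kappa> \<omega>] by linarith
  then have "0 < \<sigma>\<^sup>2 * (\<omega>\<^sup>2 + 1) * (1 + 2 * \<kappa> * \<omega> - \<kappa>\<^sup>2)"
    using sigma_pos by (intro mult_pos_pos) (auto simp: add_nonneg_pos)
  ultimately have "0 < 8 * (?a * m\<^sup>2 - 2 * ?b * l * m + ?c * l\<^sup>2)" by (simp only:)
  then have "?a * m\<^sup>2 - 2 * ?b * l * m + ?c * l\<^sup>2 > 0" by (rule zero_less_mult_pos) simp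
  from binary_form_coercive[OF this] obtain K e where K: "K \<ge> 0" and e: "e > 0"
    and bf: "\<And>x y. e * (x\<^sup>2 + y\<^sup>2) \<le> ?a * x\<^sup>2 + 2 * ?b * x * y + ?c * y\<^sup>2 + K * (l * x + m * y)\<^sup>2"
    by blast
  have w0: "\<omega> > 0" using omega_ge_1 by linarith
  \<comment> \<open>C1 bounds the squared norm of the span component by its coordinates, C2 that of
    v by the penalised form, and C3 adds the part of \<open>hsq\<close> with the weight |k|.\<close>
  define C1 where "C1 = \<omega> + \<sigma> + \<sigma> * \<omega>"
  have C1: "C1 > 0" using w0 sigma_pos by (simp add: C1_def add_pos_pos)
  define C2 where "C2 = 2 * C1 / e + (2 * C1 / r\<^sup>2 + 2) / \<omega>"
  have C2: "C2 > 0" using C1 e w0 r0 by (simp add: C2_def add_pos_pos)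
  define C3 where "C3 = C2 + 1 + 2 * kmass * C2"
  have C3: "C3 > 0" using C2 kmass_nonneg by (simp add: C3_def add_pos_nonneg)
  have "1 / C3 * hsq v \<le> qform v v + K * (ip P v + \<kappa> * ip DP v)\<^sup>2"
    if dv: "decaying v" and rv: "real_seq v" and im: "Im (v 1) = 0" for v
  proof -
    define A where "A = ip P v"
    define B where "B = ip DP v"
    \<comment> \<open>The Gram determinant of P and |D| P. The next two coefficients come from
      Cramer's rule, while P' is orthogonal to both.\<close>
    define \<Delta> where "\<Delta> = \<sigma> * (\<omega>\<^sup>2 + 1) / 4"
    have D0: "\<Delta> > 0" using sigma_pos by (simp add: \<Delta>_def add_nonneg_pos)
    define \<alpha> where "\<alpha> = (A * (\<sigma> * \<omega> / 2) - B * (\<sigma> / 2)) / \<Delta>"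
    define \<beta> where "\<beta> = (\<omega> * B - A * (\<sigma> / 2)) / \<Delta>"
    define \<gamma> where "\<gamma> = ip HDP v / (\<sigma> * \<omega> / 2)"
    have D: "\<Delta> = \<omega> * (\<sigma> * \<omega> / 2) - (\<sigma> / 2) * (\<sigma> / 2)" unfolding \<Delta>_def s by (simp add: field_simps) algebra
    have ab: "\<alpha> * \<omega> + \<beta> * (\<sigma> / 2) = A" "\<alpha> * (\<sigma> / 2) + \<beta> * (\<sigma> * \<omega> / 2) = B"
    proof -
      have X: "\<alpha> * \<Delta> = A * (\<sigma> * \<omega> / 2) - B * (\<sigma> / 2)" "\<beta> * \<Delta> = \<omega> * B - A * (\<sigma> / 2)"
        using D0 by (simp_all add: \<alpha>_def \<beta>_def)
      have "(\<alpha> * \<omega> + \<beta> * (\<sigma> / 2)) * \<Delta> = (\<alpha> * \<Delta>) * \<omega> + (\<beta> * \<Delta>) * (\<sigma> / 2)"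
        "(\<alpha> * (\<sigma> / 2) + \<beta> * (\<sigma> * \<omega> / 2)) * \<Delta> = (\<alpha> * \<Delta>) * (\<sigma> / 2) + (\<beta> * \<Delta>) * (\<sigma> * \<omega> / 2)"
        by (simp_all add: algebra_simps)
      then have "(\<alpha> * \<omega> + \<beta> * (\<sigma> / 2)) * \<Delta> = A * \<Delta>" "(\<alpha> * (\<sigma> / 2) + \<beta> * (\<sigma> * \<omega> / 2)) * \<Delta> = B * \<Delta>"
        unfolding X by (simp_all add: D field_simps)
      then show "\<alpha> * \<omega> + \<beta> * (\<sigma> / 2) = A" "\<alpha> * (\<sigma> / 2) + \<beta> * (\<sigma> * \<omega> / 2) = B"
        using D0 by simp_all
    qed
    have g: "\<gamma> * (\<sigma> * \<omega> / 2) = ip HDP v" using sigma_pos w0 by (simp add: \<gamma>_def)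
    define w where "w k = of_real \<alpha> * P k + (of_real \<beta> * DP k + of_real \<gamma> * HDP k)" for k
    define z where "z k = v k + of_real (-1) * w k" for k
    have dP: "decaying (\<lambda>k. of_real t * P k)" "decaying (\<lambda>k. of_real t * DP k)" "decaying (\<lambda>k. of_real t * HDP k)" for t
      by (intro decaying_cmult decaying_basis)+
    have dw: "decaying w" unfolding w_def by (intro decaying_add dP)
    have dmw: "decaying (\<lambda>k. of_real (-1) * w k)" by (rule decaying_cmult[OF dw])
    have dz: "decaying z" unfolding z_def by (rule decaying_add[OF dv dmw])
    have ipw: "ip x w = \<alpha> * ip x P + (\<beta> * ip x DP + \<gamma> * ip x HDP)" if "decaying x" for x
      unfolding w_def by (simp only: ip_add_right that dP decaying_add ip_cmult_right)
    have sym: "ip DP P = \<sigma> / 2" "ip HDP P = 0" "ip HDP DP = 0"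
      by (subst ip_commute, rule ip_basis)+
    have wP: "ip P w = A" "ip DP w = B" "ip HDP w = ip HDP v"
      using ab g by (simp_all add: ipw decaying_basis ip_basis sym)
    have ipz: "ip x z = ip x v - ip x w" if "decaying x" for x
      unfolding z_def by (simp only: ip_add_right that dv dmw ip_cmult_right)
    have zP: "ip P z = 0" "ip DP z = 0" "ip HDP z = 0"
      by (simp_all add: ipz decaying_basis wP A_def B_def)
    have rw: "real_seq w" unfolding real_seq_def w_def P_def DP_def HDP_def by simp
    have rz: "real_seq z" using rv rw unfolding real_seq_def z_def by simp
    have vwz: "v = (\<lambda>k. w k + z k)" by (simp add: z_def)
    have qw: "qform x w = - \<alpha> * (ip x DP + \<omega> * ip x P) - \<beta> * \<sigma> * ip x P" if "decaying x" for x
      unfolding w_def by (simp only: qform_add_right that dP decaying_add qform_cmult_right qform_basis) (simp add: algebra_simps)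
    have qzw: "qform z w = 0" using zP by (simp add: qw dz ip_commute[of z])
    have "qform v v = qform w w + qform z z"
      by (subst (1 2) vwz) (simp add: qform_add_self dw dz qzw)
    also have "qform w w = ?a * \<alpha>\<^sup>2 + 2 * ?b * \<alpha> * \<beta> + ?c * \<beta>\<^sup>2"
      unfolding qw[OF dw] ip_commute[of w] wP ab[symmetric] by (simp add: power2_eq_square field_simps)
    finally have qv: "qform v v = ?a * \<alpha>\<^sup>2 + 2 * ?b * \<alpha> * \<beta> + ?c * \<beta>\<^sup>2 + qform z z" .
    have lm: "ip P v + \<kappa> * ip DP v = l * \<alpha> + m * \<beta>"
      unfolding A_def[symmetric] B_def[symmetric] ab[symmetric] l_def m_def by (simp add: field_simps)
    define \<Lambda> where "\<Lambda> = qform v v + K * (ip P v + \<kappa> * ip DP v)\<^sup>2"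
    have L1: "e * (\<alpha>\<^sup>2 + \<beta>\<^sup>2) + \<omega> * ip z z \<le> \<Lambda>"
      using bf[of \<alpha> \<beta>] qform_orthogonal[OF dz rz zP] unfolding \<Lambda>_def qv lm by linarith
    \<comment> \<open>P and |D| P have real coefficients, so the normalisation of v at frequency 1
      forces z to compensate the P' part of w.\<close>
    have gz: "\<gamma>\<^sup>2 * r\<^sup>2 \<le> ip z z"
    proof -
      have "Im (w 1) = \<gamma> * r" by (simp add: w_def P_def DP_def HDP_def ker_def)
      then have "Im (z 1) = - (\<gamma> * r)" using im by (simp add: z_def)
      then have "\<gamma>\<^sup>2 * r\<^sup>2 \<le> (cmod (z 1))\<^sup>2" by (simp add: cmod_power2 power_mult_distrib)
      also have "\<dots> \<le> ip z z" by (rule ip_self_ge[OF dz])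
      finally show ?thesis .
    qed
    have "ip w w = \<alpha> * A + (\<beta> * B + \<gamma> * ip HDP v)" unfolding ipw[OF dw] ip_commute[of w P] ip_commute[of w DP] ip_commute[of w HDP] wP ..
    also have "\<dots> = \<omega> * \<alpha>\<^sup>2 + \<sigma> * (\<alpha> * \<beta>) + \<sigma> * \<omega> / 2 * \<beta>\<^sup>2 + \<sigma> * \<omega> / 2 * \<gamma>\<^sup>2"
      unfolding ab[symmetric] g[symmetric] by (simp add: power2_eq_square field_simps)
    also have "\<dots> \<le> C1 * \<alpha>\<^sup>2 + C1 * \<beta>\<^sup>2 + C1 * \<gamma>\<^sup>2"
    proof -
      have "\<alpha> * \<beta> \<le> (\<alpha>\<^sup>2 + \<beta>\<^sup>2) / 2"
        using zero_le_power2[of "\<alpha> - \<beta>"] by (simp add: power2_eq_square algebra_simps)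
      then have "\<sigma> * (\<alpha> * \<beta>) \<le> \<sigma> * ((\<alpha>\<^sup>2 + \<beta>\<^sup>2) / 2)" using sigma_pos by (intro mult_left_mono) auto
      moreover have "0 \<le> \<omega> * \<beta>\<^sup>2" "0 \<le> \<omega> * \<gamma>\<^sup>2" "0 \<le> \<sigma> * \<alpha>\<^sup>2" "0 \<le> \<sigma> * \<beta>\<^sup>2" "0 \<le> \<sigma> * \<gamma>\<^sup>2"
        "0 \<le> \<sigma> * \<omega> * \<alpha>\<^sup>2" "0 \<le> \<sigma> * \<omega> * \<beta>\<^sup>2" "0 \<le> \<sigma> * \<omega> * \<gamma>\<^sup>2"
        using sigma_pos w0 by simp_all
      ultimately show ?thesis unfolding C1_def by (simp add: distrib_right distrib_left)
    qed
    finally have iw: "ip w w \<le> C1 * (\<alpha>\<^sup>2 + \<beta>\<^sup>2) + C1 * \<gamma>\<^sup>2" by (simp add: distrib_left)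
    have "ip v v \<le> 2 * ip w w + 2 * ip z z" by (subst (1 2) vwz) (rule ip_add_self_le[OF dw dz])
    also have "\<dots> \<le> 2 * C1 * (\<alpha>\<^sup>2 + \<beta>\<^sup>2) + (2 * C1 / r\<^sup>2 + 2) * ip z z"
    proof -
      have "C1 * \<gamma>\<^sup>2 = C1 / r\<^sup>2 * (\<gamma>\<^sup>2 * r\<^sup>2)" using r0 by simp
      also have "\<dots> \<le> C1 / r\<^sup>2 * ip z z" using C1 by (intro mult_left_mono gz) auto
      finally show ?thesis using iw by (simp add: distrib_right)
    qed
    also have "\<dots> \<le> C2 * (e * (\<alpha>\<^sup>2 + \<beta>\<^sup>2) + \<omega> * ip z z)"
    proof -
      define p where "p = 2 * C1 / e"
      define q where "q = (2 * C1 / r\<^sup>2 + 2) / \<omega>"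
      have pq: "p * e = 2 * C1" "q * \<omega> = 2 * C1 / r\<^sup>2 + 2" "p \<ge> 0" "q \<ge> 0"
        using e w0 C1 unfolding p_def q_def by simp_all
      have "C2 * (e * (\<alpha>\<^sup>2 + \<beta>\<^sup>2) + \<omega> * ip z z) = (p * e) * (\<alpha>\<^sup>2 + \<beta>\<^sup>2) + (q * \<omega>) * ip z z
         + p * (\<omega> * ip z z) + q * (e * (\<alpha>\<^sup>2 + \<beta>\<^sup>2))"
        unfolding C2_def p_def[symmetric] q_def[symmetric] by (simp add: algebra_simps)
      moreover have "0 \<le> p * (\<omega> * ip z z)" "0 \<le> q * (e * (\<alpha>\<^sup>2 + \<beta>\<^sup>2))"
        using pq e w0 ip_self_nonneg(1)[of z] by simp_all
      ultimately show ?thesis unfolding pq by linarith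
    qed
    also have "\<dots> \<le> C2 * \<Lambda>" using C2 by (intro mult_left_mono L1) auto
    finally have iv: "ip v v \<le> C2 * \<Lambda>" .
    \<comment> \<open>The weighted part is recovered from the form itself: the kernel term is
      bounded, with constant \<open>kmass\<close>, by what is already controlled.\<close>
    have "\<bar>ip v (kconv r v)\<bar> \<le> kmass * ip v v" using kconv_form(2)[OF dv dv] by simp
    moreover have "0 \<le> \<omega> * ip v v" using w0 ip_self_nonneg(1)[of v] by simp
    moreover have "qform v v \<le> \<Lambda>" unfolding \<Lambda>_def using K by simp
    moreover have "kmass * ip v v \<le> kmass * (C2 * \<Lambda>)" by (intro mult_left_mono iv kmass_nonneg)
    ultimately have "wip v v \<le> \<Lambda> + 2 * (kmass * (C2 * \<Lambda>))" unfolding qform_def by linarith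
    then have "hsq v \<le> C3 * \<Lambda>" using iv unfolding hsq_eq[OF dv] C3_def by (simp add: algebra_simps)
    then show ?thesis using C3 unfolding \<Lambda>_def by (simp add: field_simps)
  qed
  then show ?thesis using K C3 by (intro exI[of _ K] conjI exI[of _ "1 / C3"]) auto
qed

end

section \<open>The cubic term\<close>

text \<open>The mean of the product of the three functions with coefficients \<open>a\<close>, \<open>b\<close> and \<open>d\<close>.\<close>

definition trip :: "(int \<Rightarrow> complex) \<Rightarrow> (int \<Rightarrow> complex) \<Rightarrow> (int \<Rightarrow> complex) \<Rightarrow> complex" where
  "trip a b d = (\<Sum>\<^sub>\<infinity>(j, l)\<in>UNIV \<times> UNIV. a j * b l * d (- j - l))"

text \<open>The cyclic permutation of frequencies (j, l, m) with j + l + m = 0, of which only j and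
  l are recorded.\<close>

lemma bij_rotate: "bij_betw (\<lambda>(j, l). (l, - j - l)) (UNIV \<times> UNIV) (UNIV \<times> (UNIV :: int set))"
  by (rule bij_betw_byWitness[of _ "\<lambda>(j, l). (- j - l, j)"]) auto

lemma prod_summable:
  fixes f g :: "int \<Rightarrow> real"
  assumes "f summable_on UNIV" "g summable_on UNIV" "\<And>k. f k \<ge> 0" "\<And>k. g k \<ge> 0"
  shows "((\<lambda>(j, l). f j * g l) has_sum (infsum f UNIV * infsum g UNIV)) (UNIV \<times> UNIV)"
proof -
  have 1: "((\<lambda>l. (\<lambda>(j, l). f j * g l) (j, l)) has_sum f j * infsum g UNIV) UNIV" for j
    unfolding prod.case by (intro has_sum_cmult_right has_sum_infsum assms)
  have 2: "((\<lambda>j. f j * infsum g UNIV) has_sum infsum f UNIV * infsum g UNIV) UNIV"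
    by (intro has_sum_cmult_left has_sum_infsum assms)
  have "(\<lambda>(j, l). f j * g l) summable_on (UNIV \<times> UNIV)"
    by (rule summable_on_SigmaI[OF 1 has_sum_imp_summable[OF 2]]) (use assms in auto)
  from has_sum_SigmaI[OF 1 2 this] show ?thesis .
qed

text \<open>The third slot may be merely bounded: it will hold the coefficients of a derivative in
  space or in time.\<close>

lemma trip_has_sum_bounded:
  assumes "decaying a" "decaying b" "\<And>k. cmod (d k) \<le> B"
  shows "((\<lambda>(j, l). a j * b l * d (- j - l)) has_sum trip a b d) (UNIV \<times> UNIV)"
proof -
  have "(\<lambda>p. B * (\<lambda>(j, l). cmod (a j) * cmod (b l)) p) summable_on (UNIV \<times> UNIV)"
    by (intro summable_on_cmult_right has_sum_imp_summable[OF prod_summable] decaying_norm_summable assms) auto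
  then have "(\<lambda>p. norm ((\<lambda>(j, l). a j * b l * d (- j - l)) p)) summable_on (UNIV \<times> UNIV)"
  proof (rule summable_on_comparison_test)
    fix p :: "int \<times> int"
    obtain j l where p: "p = (j, l)" by force
    have "cmod (a j) * cmod (b l) * cmod (d (- j - l)) \<le> cmod (a j) * cmod (b l) * B"
      by (intro mult_left_mono assms) auto
    then show "norm ((\<lambda>(j, l). a j * b l * d (- j - l)) p) \<le> B * (\<lambda>(j, l). cmod (a j) * cmod (b l)) p"
      unfolding p by (simp add: norm_mult mult_ac)
  qed auto
  then show ?thesis unfolding trip_def by (rule has_sum_infsum[OF abs_summable_summable])
qed

lemma trip_has_sum:
  assumes "decaying a" "decaying b" "decaying d"
  shows "((\<lambda>(j, l). a j * b l * d (- j - l)) has_sum trip a b d) (UNIV \<times> UNIV)"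
proof -
  obtain B where "\<forall>k. cmod (d k) \<le> B" using decaying_bounded[OF assms(3)] by blast
  then show ?thesis using trip_has_sum_bounded[OF assms(1,2), of d B] by blast
qed

lemma trip_rotate: "trip d a b = trip a b d"
proof -
  have "trip a b d = (\<Sum>\<^sub>\<infinity>p\<in>UNIV \<times> UNIV. (\<lambda>(j, l). a j * b l * d (- j - l)) ((\<lambda>(j, l). (l, - j - l)) p))"
    unfolding trip_def by (rule infsum_reindex_bij_betw[OF bij_rotate, symmetric])
  also have "\<dots> = trip d a b"
    unfolding trip_def by (intro infsum_cong) (auto simp: mult_ac)
  finally show ?thesis by simp
qed

lemma trip_swap: "trip b a d = trip a b d"
proof -
  have bij: "bij_betw (\<lambda>(j, l). (l, j)) (UNIV \<times> UNIV) (UNIV \<times> (UNIV :: int set))"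
    by (rule bij_betw_byWitness[of _ "\<lambda>(j, l). (l, j)"]) auto
  have e: "- l - j = - j - l" for j l :: int by simp
  have "trip a b d = (\<Sum>\<^sub>\<infinity>p\<in>UNIV \<times> UNIV. (\<lambda>(j, l). a j * b l * d (- j - l)) ((\<lambda>(j, l). (l, j)) p))"
    unfolding trip_def by (rule infsum_reindex_bij_betw[OF bij, symmetric])
  also have "\<dots> = trip b a d"
    unfolding trip_def by (intro infsum_cong) (auto simp: mult_ac e)
  finally show ?thesis by simp
qed

lemma trip_add:
  assumes "decaying a" "decaying a'" "decaying b" "decaying d"
  shows "trip (\<lambda>k. a k + a' k) b d = trip a b d + trip a' b d"
proof -
  have "((\<lambda>p. (\<lambda>(j, l). a j * b l * d (- j - l)) p + (\<lambda>(j, l). a' j * b l * d (- j - l)) p) has_sum (trip a b d + trip a' b d)) (UNIV \<times> UNIV)"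
    by (intro has_sum_add trip_has_sum assms)
  then show ?thesis unfolding trip_def[of "\<lambda>k. a k + a' k"]
    by (intro infsumI) (simp add: case_prod_unfold algebra_simps)
qed

lemma trip_cmult: "trip (\<lambda>k. c * a k) b d = c * trip a b d"
  unfolding trip_def by (subst infsum_cmult_right'[symmetric]) (simp add: case_prod_unfold mult_ac)

lemma trip_expand:
  assumes f: "decaying f" and v: "decaying v"
  shows "trip (\<lambda>k. f k + v k) (\<lambda>k. f k + v k) (\<lambda>k. f k + v k) = trip f f f + 3 * trip v f f + 3 * trip v v f + trip v v v"
proof -
  let ?s = "\<lambda>k. f k + v k"
  have s: "decaying ?s" by (rule decaying_add[OF f v])
  have 1: "trip ?s x y = trip f x y + trip v x y" if "decaying x" "decaying y" for x y
    by (rule trip_add[OF f v that])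
  have 2: "trip x ?s y = trip x f y + trip x v y" if "decaying x" "decaying y" for x y
    using 1[OF that] by (simp only: trip_swap[of ?s x] trip_swap[of f x] trip_swap[of v x])
  have 3: "trip x y ?s = trip x y f + trip x y v" if "decaying x" "decaying y" for x y
    using 1[OF that] by (simp only: trip_rotate[of ?s x] trip_rotate[of f x] trip_rotate[of v x])
  have 4: "trip f v f = trip v f f" "trip f f v = trip v f f" "trip v f v = trip v v f" "trip f v v = trip v v f"
    using trip_swap[of f v f] trip_rotate[of v f f] trip_rotate[of v v f] trip_swap[of v f v] by simp_all
  show ?thesis
    by (simp only: 1 2 3 f v s) (simp add: 4)
qed

text \<open>The summand whose denominator is the smallest of the three is already at least
  1.\<close>

lemma one_le_sum_geometric_means:
  fixes x y z :: real
  assumes "x > 0" "y > 0" "z > 0"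
  shows "1 \<le> sqrt (y * z) / x + sqrt (x * z) / y + sqrt (x * y) / z"
proof -
  have *: "1 \<le> sqrt (b * d) / a" if "a > 0" "a \<le> b" "a \<le> d" for a b d :: real
  proof -
    have "sqrt (a * a) \<le> sqrt (b * d)" using that by (intro real_sqrt_le_mono mult_mono) auto
    then show ?thesis using that by simp
  qed
  have nn: "sqrt (y * z) / x \<ge> 0" "sqrt (x * z) / y \<ge> 0" "sqrt (x * y) / z \<ge> 0" using assms by simp_all
  consider "x \<le> y" "x \<le> z" | "y \<le> x" "y \<le> z" | "z \<le> x" "z \<le> y" by linarith
  then show ?thesis using nn *[of x y z] *[of y x z] *[of z x y] assms by cases linarith+
qed

text \<open>The lowest of the three frequencies can be given negative weight, since the two others absorb the
  compensating positive weight; the remaining sum over the lowest frequency then converges.\<close>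

lemma trip_bound:
  assumes dv: "decaying v"
  shows "cmod (trip v v v) \<le> 3 * ((1 + (\<Sum>\<^sub>\<infinity>k. (psi k)\<^sup>2)) / 2) * (sqrt (hsq v) * hsq v)"
proof -
  let ?w = "\<lambda>k. 1 + real_of_int \<bar>k\<bar>"
  define X where "X k = sqrt (?w k) * cmod (v k)" for k
  define \<Psi> where "\<Psi> = (\<Sum>\<^sub>\<infinity>k. (psi k)\<^sup>2)"
  have X0: "X k \<ge> 0" for k by (simp add: X_def)
  have X2: "(X k)\<^sup>2 = ?w k * (cmod (v k))\<^sup>2" for k by (simp add: X_def power_mult_distrib)
  have hX: "((\<lambda>k. (X k)\<^sup>2) has_sum hsq v) UNIV"
    unfolding X2 hsq_def by (intro has_sum_infsum hsq_summable dv)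
  have psi2: "(\<lambda>k. (psi k)\<^sup>2) summable_on UNIV"
  proof (rule summable_on_comparison_test[OF psi_summable])
    show "(psi k)\<^sup>2 \<le> psi k" for k
      using psi_le_1[of k] psi_pos[of k] by (simp add: power2_eq_square mult_left_le_one_le)
  qed auto
  define S where "S = (\<Sum>\<^sub>\<infinity>k. X k * psi k)"
  \<comment> \<open>The free scale s, later 1 / sqrt (hsq v), makes the bound on S homogeneous of
    degree 1 in v, in place of the Cauchy-Schwarz inequality.\<close>
  have AM: "X k * psi k \<le> (s * (X k)\<^sup>2 + (psi k)\<^sup>2 / s) / 2" if "s > 0" for s k
  proof -
    have "0 \<le> (s * X k - psi k)\<^sup>2 / s" using that by simp
    also have "\<dots> = s * (X k)\<^sup>2 - 2 * (X k * psi k) + (psi k)\<^sup>2 / s"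
      using that by (simp add: power2_eq_square field_simps)
    finally show ?thesis by simp
  qed
  have AMs: "((\<lambda>k. (s * (X k)\<^sup>2 + (psi k)\<^sup>2 / s) / 2) has_sum (s * hsq v + \<Psi> / s) / 2) UNIV" for s
    unfolding \<Psi>_def by (intro has_sum_divide_const has_sum_add has_sum_cmult_right hX has_sum_infsum psi2)
  have Ss: "(\<lambda>k. X k * psi k) summable_on UNIV"
    by (rule summable_on_comparison_test[OF has_sum_imp_summable[OF AMs[of 1]]]) (use AM[of 1] X0 psi_pos in \<open>auto simp: less_imp_le\<close>)
  have S_le: "S \<le> sqrt (hsq v) * ((1 + \<Psi>) / 2)"
  proof (cases "hsq v = 0")
    case True
    have "X k = 0" for k
      using finite_sum_le_has_sum[OF hX, of "{k}"] True by simp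
    then show ?thesis using True by (simp add: S_def)
  next
    case False
    then have h: "hsq v > 0" using hsq_nonneg[of v] by linarith
    let ?s = "1 / sqrt (hsq v)"
    have "S \<le> (?s * hsq v + \<Psi> / ?s) / 2"
      unfolding S_def by (rule has_sum_mono[OF has_sum_infsum[OF Ss] AMs[of ?s]]) (rule AM, use h in simp)
    also have "\<dots> = sqrt (hsq v) * ((1 + \<Psi>) / 2)"
      using h by (simp add: real_div_sqrt field_simps)
    finally show ?thesis .
  qed
  \<comment> \<open>The majorant for a lowest frequency in the first place; its two rotations cover
    the other places.\<close>
  let ?H = "\<lambda>(j, k). (X j * psi j) * (((X k)\<^sup>2 + (X (- j - k))\<^sup>2) / 2)"
  have H1: "((\<lambda>k. ?H (j, k)) has_sum (X j * psi j) * hsq v) UNIV" for j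
  proof -
    have "bij_betw (\<lambda>k. - j - k) UNIV UNIV" by (rule bij_betw_byWitness[of _ "\<lambda>k. - j - k"]) auto
    from has_sum_reindex_bij_betw[OF this, of "\<lambda>k. (X k)\<^sup>2"] hX
    have "((\<lambda>k. (X (- j - k))\<^sup>2) has_sum hsq v) UNIV" by blast
    then have "((\<lambda>k. (X j * psi j) * (((X k)\<^sup>2 + (X (- j - k))\<^sup>2) / 2)) has_sum (X j * psi j) * ((hsq v + hsq v) / 2)) UNIV"
      by (intro has_sum_cmult_right has_sum_divide_const has_sum_add hX)
    then show ?thesis by simp
  qed
  have H2: "((\<lambda>j. (X j * psi j) * hsq v) has_sum S * hsq v) UNIV"
    unfolding S_def by (intro has_sum_cmult_left has_sum_infsum Ss)
  have "?H summable_on (UNIV \<times> UNIV)"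
    by (rule summable_on_SigmaI[OF H1 has_sum_imp_summable[OF H2]]) (use X0 psi_pos in \<open>auto simp: less_imp_le\<close>)
  from has_sum_SigmaI[OF H1 H2 this] have H: "(?H has_sum S * hsq v) (UNIV \<times> UNIV)" .
  let ?\<rho> = "\<lambda>(j, l). (l, - j - l) :: int \<times> int"
  have HR: "((\<lambda>p. ?H (?\<rho> p)) has_sum S * hsq v) (UNIV \<times> UNIV)"
    using has_sum_reindex_bij_betw[OF bij_rotate, of ?H] H by blast
  have HRR: "((\<lambda>p. ?H (?\<rho> (?\<rho> p))) has_sum S * hsq v) (UNIV \<times> UNIV)"
    using has_sum_reindex_bij_betw[OF bij_rotate, of "\<lambda>p. ?H (?\<rho> p)"] HR by blast
  have "((\<lambda>p. ?H p + ?H (?\<rho> p) + ?H (?\<rho> (?\<rho> p))) has_sum (S * hsq v + S * hsq v + S * hsq v)) (UNIV \<times> UNIV)"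
    by (intro has_sum_add H HR HRR)
  moreover have "norm ((\<lambda>(j, l). v j * v l * v (- j - l)) p) \<le> ?H p + ?H (?\<rho> p) + ?H (?\<rho> (?\<rho> p))" for p
  proof -
    obtain j l where p: "p = (j, l)" by force
    define m where "m = - j - l"
    have sum0: "- l - m = j" "- m - j = l" "- j - l = m" by (simp_all add: m_def)
    have vX: "cmod (v a) * (sqrt (?w b * ?w d) / ?w a) * (cmod (v b) * cmod (v d)) \<le> (X a * psi a) * (((X b)\<^sup>2 + (X d)\<^sup>2) / 2)" for a b d
    proof -
      have "X a * psi a = cmod (v a) / ?w a"
      proof -
        \<comment> \<open>The exponent 3/2 in \<open>psi\<close> is exactly what turns sqrt w into 1
          / w.\<close>
        have "sqrt (?w a) * psi a = ?w a powr (1/2 + - 3/2)"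
          unfolding psi_def powr_add by (simp add: powr_half_sqrt)
        also have "\<dots> = 1 / ?w a" by (simp add: powr_minus divide_simps)
        finally have "(sqrt (?w a) * psi a) * cmod (v a) = (1 / ?w a) * cmod (v a)" by (simp only:)
        then show ?thesis unfolding X_def by (simp add: mult_ac)
      qed
      moreover have "sqrt (?w b * ?w d) * (cmod (v b) * cmod (v d)) = X b * X d"
        unfolding X_def by (simp add: real_sqrt_mult)
      ultimately have "cmod (v a) * (sqrt (?w b * ?w d) / ?w a) * (cmod (v b) * cmod (v d)) = (X a * psi a) * (X b * X d)"
        by (metis (no_types, opaque_lifting) mult.assoc mult.commute times_divide_eq_left)
      also have "\<dots> \<le> (X a * psi a) * (((X b)\<^sup>2 + (X d)\<^sup>2) / 2)"
        using X0[of a] psi_pos[of a] zero_le_power2[of "X b - X d"]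
        by (intro mult_left_mono) (auto simp: power2_eq_square algebra_simps)
      finally show ?thesis .
    qed
    let ?t = "cmod (v j) * cmod (v l) * cmod (v m)"
    have "?t * 1 \<le> ?t * (sqrt (?w l * ?w m) / ?w j + sqrt (?w j * ?w m) / ?w l + sqrt (?w j * ?w l) / ?w m)"
      by (intro mult_left_mono one_le_sum_geometric_means) auto
    also have "\<dots> = cmod (v j) * (sqrt (?w l * ?w m) / ?w j) * (cmod (v l) * cmod (v m))
        + cmod (v l) * (sqrt (?w m * ?w j) / ?w l) * (cmod (v m) * cmod (v j))
        + cmod (v m) * (sqrt (?w j * ?w l) / ?w m) * (cmod (v j) * cmod (v l))"
      by (simp only: distrib_left mult_ac)
    also have "\<dots> \<le> (X j * psi j) * (((X l)\<^sup>2 + (X m)\<^sup>2) / 2) + (X l * psi l) * (((X m)\<^sup>2 + (X j)\<^sup>2) / 2)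
        + (X m * psi m) * (((X j)\<^sup>2 + (X l)\<^sup>2) / 2)"
      by (intro add_mono vX)
    finally show ?thesis unfolding p prod.case sum0 norm_mult by simp
  qed
  ultimately have "cmod (trip v v v) \<le> S * hsq v + S * hsq v + S * hsq v"
    by (intro norm_infsum_le[OF trip_has_sum[OF dv dv dv]])
  also have "\<dots> = 3 * (S * hsq v)" by simp
  also have "\<dots> \<le> 3 * ((sqrt (hsq v) * ((1 + \<Psi>) / 2)) * hsq v)"
    by (intro mult_left_mono mult_right_mono S_le hsq_nonneg) simp
  finally show ?thesis unfolding \<Psi>_def by (simp add: mult_ac)
qed

section \<open>The Lyapunov function\<close>

lemma trip_cmult_mid: "trip a (\<lambda>k. c * b k) d = c * trip a b d"
  using trip_cmult[of c b a d] by (simp only: trip_swap[of "\<lambda>k. c * b k" a] trip_swap[of b a])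

lemma trip_cmult_last: "trip a b (\<lambda>k. c * d k) = c * trip a b d"
  using trip_cmult[of c d a b] by (simp only: trip_rotate)

definition momentum :: "real \<Rightarrow> (int \<Rightarrow> complex) \<Rightarrow> real" where
  "momentum \<kappa> a = ip a a + \<kappa> * wip a a"

definition energy :: "(int \<Rightarrow> complex) \<Rightarrow> real" where
  "energy a = ip a a / 2 + Re (trip a a a) / 6"

context poisson_kernel
begin

text \<open>Summing over the second frequency produces P^2, which is |D| P + omega P.\<close>

lemma trip_P_P:
  assumes dv: "decaying v"
  shows "Re (trip v P P) = ip DP v + \<omega> * ip P v"
proof -
  obtain B where B: "\<And>k. cmod (P k) \<le> B" using decayingE[OF decaying_basis(1)] by metis
  have 1: "((\<lambda>l. (\<lambda>(j, l). v j * P l * P (- j - l)) (j, l)) has_sum v j * kconv r P (- j)) UNIV" for j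
  proof -
    have "((\<lambda>l. v j * (of_real (ker r (- j - l)) * P l)) has_sum v j * kconv r P (- j)) UNIV"
      by (intro has_sum_cmult_right kconv_has_sum[of P B] B)
    then show ?thesis unfolding prod.case P_def by (simp only: mult_ac)
  qed
  have "((\<lambda>j. Re (v j * kconv r P (- j))) has_sum Re (trip v P P)) UNIV"
    by (intro has_sum_Re has_sum_SigmaD[OF trip_has_sum[OF dv decaying_basis(1) decaying_basis(1)] 1])
  moreover have "Re (v j * kconv r P (- j)) = Re (cnj (DP j) * v j) + \<omega> * Re (cnj (P j) * v j)" for j
    unfolding kconv_basis by (simp add: DP_def P_def algebra_simps)
  moreover have "((\<lambda>j. Re (cnj (DP j) * v j) + \<omega> * Re (cnj (P j) * v j)) has_sum (ip DP v + \<omega> * ip P v)) UNIV"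
    unfolding ip_def by (intro has_sum_add has_sum_cmult_right has_sum_infsum ip_summable decaying_basis dv)
  ultimately show ?thesis by (simp only: has_sum_unique)
qed

text \<open>Reflecting the first frequency turns the trilinear sum into the double sum of
  \<open>kconv_form\<close>; reality of v makes the reflected coefficient a conjugate.\<close>

lemma trip_last_P:
  assumes dv: "decaying v" and rv: "real_seq v"
  shows "Re (trip v v P) = ip v (kconv r v)"
proof -
  have bij: "bij_betw (\<lambda>(j :: int, l). (- j, l)) (UNIV \<times> UNIV) (UNIV \<times> (UNIV :: int set))"
    by (rule bij_betw_byWitness[of _ "\<lambda>(j, l). (- j, l)"]) auto
  let ?G = "\<lambda>(k, l). ker r (k - l) * Re (cnj (v k) * v l)"
  have "((\<lambda>p. ?G ((\<lambda>(j, l). (- j, l)) p)) has_sum ip v (kconv r v)) (UNIV \<times> UNIV)"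
    using has_sum_reindex_bij_betw[OF bij, of ?G] kconv_form(1)[OF dv dv] by blast
  moreover have "((\<lambda>p. Re ((\<lambda>(j, l). v j * v l * P (- j - l)) p)) has_sum Re (trip v v P)) (UNIV \<times> UNIV)"
    by (intro has_sum_Re trip_has_sum dv decaying_basis)
  moreover have "Re ((\<lambda>(j, l). v j * v l * P (- j - l)) p) = ?G ((\<lambda>(j, l). (- j, l)) p)" for p
    using rv by (simp add: case_prod_unfold P_def real_seq_def algebra_simps)
  ultimately show ?thesis by (simp only: has_sum_unique)
qed

end

text \<open>The condition \<open>speed\<close> is the equation \<open>tanh \<eta> = c \<kappa> / (c - 1)\<close> relating \<open>r\<close> to the wave speed.\<close>

locale rbo_wave = poisson_kernel +
  fixes c \<kappa> :: real
  assumes kappa: "0 < \<kappa>" "\<kappa> < 1" and c0: "0 < c" and speed: "c * \<kappa> * \<omega> = c - 1"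
begin

definition profile :: "int \<Rightarrow> complex" where
  "profile k = of_real (2 * c * \<kappa>) * P k"

definition lyapunov :: "real \<Rightarrow> (int \<Rightarrow> complex) \<Rightarrow> real" where
  "lyapunov K a = (c / 2 * momentum \<kappa> a - energy a) - (c / 2 * momentum \<kappa> profile - energy profile)
     + K * (momentum \<kappa> a - momentum \<kappa> profile)\<^sup>2"

lemma decaying_profile: "decaying profile"
  unfolding profile_def by (intro decaying_cmult decaying_basis)

lemma wip_P: "wip P v = ip DP v"
  unfolding wip_def ip_def P_def DP_def by (intro infsum_cong) simp

lemma ip_profile: "ip profile v = 2 * c * \<kappa> * ip P v" "wip profile v = 2 * c * \<kappa> * ip DP v"
  unfolding profile_def by (simp_all only: ip_cmult_left wip_P)

lemma self_expand:
  assumes "decaying f" "decaying v"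
  shows "ip (\<lambda>k. f k + v k) (\<lambda>k. f k + v k) = ip f f + 2 * ip f v + ip v v"
    "wip (\<lambda>k. f k + v k) (\<lambda>k. f k + v k) = wip f f + 2 * wip f v + wip v v"
  using assms by (simp_all add: ip_add_left ip_add_right decaying_add ip_commute[of v f] wip_commute[of v f])

lemma momentum_expand:
  assumes dv: "decaying v"
  shows "momentum \<kappa> (\<lambda>k. profile k + v k) = momentum \<kappa> profile + 4 * c * \<kappa> * (ip P v + \<kappa> * ip DP v) + momentum \<kappa> v"
  unfolding momentum_def self_expand[OF decaying_profile dv] ip_profile by (simp add: algebra_simps)

text \<open>The action is a cubic polynomial, so its expansion is exact and ends with the cubic term
  of v. The linear terms cancel by the relation \<open>speed\<close>, which is what makes the
  profile critical.\<close>

lemma action_expand: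
  assumes dv: "decaying v" and rv: "real_seq v"
  shows "c / 2 * momentum \<kappa> (\<lambda>k. profile k + v k) - energy (\<lambda>k. profile k + v k)
    = c / 2 * momentum \<kappa> profile - energy profile + c * \<kappa> / 2 * qform v v - Re (trip v v v) / 6"
proof -
  let ?\<rho> = "2 * c * \<kappa>"
  have t1: "trip v profile profile = of_real (?\<rho> * ?\<rho>) * trip v P P"
    unfolding profile_def trip_cmult_mid trip_cmult_last by simp
  have t2: "trip v v profile = of_real ?\<rho> * trip v v P"
    unfolding profile_def trip_cmult_last ..
  have "Re (trip (\<lambda>k. profile k + v k) (\<lambda>k. profile k + v k) (\<lambda>k. profile k + v k))
    = Re (trip profile profile profile) + 3 * (?\<rho> * ?\<rho> * Re (trip v P P)) + 3 * (?\<rho> * Re (trip v v P)) + Re (trip v v v)"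
    unfolding trip_expand[OF decaying_profile dv] t1 t2
    by (simp only: plus_complex.simps Re_complex_of_real Im_complex_of_real times_complex.simps mult_zero_left diff_zero complex_Re_numeral complex_Im_numeral)
  then have E: "energy (\<lambda>k. profile k + v k) = energy profile + ip profile v + ip v v / 2
    + ?\<rho> * ?\<rho> * (ip DP v + \<omega> * ip P v) / 2 + ?\<rho> * ip v (kconv r v) / 2 + Re (trip v v v) / 6"
    unfolding energy_def self_expand[OF decaying_profile dv] trip_P_P[OF dv] trip_last_P[OF dv rv] by (simp add: add_divide_distrib)
  have lin: "c / 2 * (4 * c * \<kappa> * (ip P v + \<kappa> * ip DP v)) = ip profile v + ?\<rho> * ?\<rho> * (ip DP v + \<omega> * ip P v) / 2"
  proof -
    have "ip profile v + ?\<rho> * ?\<rho> * (ip DP v + \<omega> * ip P v) / 2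
      = 2 * c * \<kappa> * ((1 + c * \<kappa> * \<omega>) * ip P v) + 2 * (c * \<kappa>) * (c * \<kappa>) * ip DP v"
      unfolding ip_profile by (simp add: algebra_simps)
    also have "1 + c * \<kappa> * \<omega> = c" using speed by simp
    finally show ?thesis by (simp add: algebra_simps)
  qed
  \<comment> \<open>The same relation turns the coefficient c - 1 of the mean square into c kappa
    omega.\<close>
  have quad: "c / 2 * momentum \<kappa> v - ip v v / 2 - ?\<rho> * ip v (kconv r v) / 2 = c * \<kappa> / 2 * qform v v"
  proof -
    have "c * \<kappa> / 2 * qform v v = c * \<kappa> / 2 * wip v v + (c * \<kappa> * \<omega>) / 2 * ip v v - c * \<kappa> * ip v (kconv r v)"
      unfolding qform_def by (simp add: algebra_simps)
    then show ?thesis unfolding speed momentum_def by (simp add: field_simps)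
  qed
  have "c / 2 * momentum \<kappa> (\<lambda>k. profile k + v k) = c / 2 * momentum \<kappa> profile + c / 2 * (4 * c * \<kappa> * (ip P v + \<kappa> * ip DP v)) + c / 2 * momentum \<kappa> v"
    unfolding momentum_expand[OF dv] by (simp only: distrib_left)
  then show ?thesis unfolding E lin quad[symmetric] by linarith
qed

lemma momentum_le: "decaying v \<Longrightarrow> \<bar>momentum \<kappa> v\<bar> \<le> hsq v"
proof -
  assume "decaying v"
  moreover have "\<kappa> * wip v v \<le> 1 * wip v v" using kappa ip_self_nonneg(2)[of v] by (intro mult_right_mono) auto
  moreover have "0 \<le> \<kappa> * wip v v" using kappa ip_self_nonneg(2)[of v] by simp
  ultimately show ?thesis using ip_self_nonneg(1)[of v] unfolding momentum_def by (simp add: hsq_eq)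
qed

lemma linear_functional_le:
  assumes "decaying v"
  shows "(ip P v + \<kappa> * ip DP v)\<^sup>2 \<le> 2 * (\<omega> + \<sigma> * \<omega>) * hsq v"
proof -
  have iv: "ip v v \<le> hsq v" "0 \<le> ip v v" using ip_self_nonneg[of v] by (simp_all add: hsq_eq assms)
  have w: "\<omega> > 0" "\<sigma> > 0" using omega_ge_1 sigma_pos by linarith+
  have "(ip P v)\<^sup>2 \<le> \<omega> * ip v v" "(ip DP v)\<^sup>2 \<le> \<sigma> * \<omega> / 2 * ip v v"
    using ip_Cauchy_Schwarz[OF decaying_basis(1) assms] ip_Cauchy_Schwarz[OF decaying_basis(2) assms] by (simp_all only: ip_basis)
  moreover have "\<omega> * ip v v \<le> \<omega> * hsq v" "\<sigma> * \<omega> / 2 * ip v v \<le> \<sigma> * \<omega> * hsq v"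
    using w iv by (auto intro!: mult_mono)
  ultimately have a: "(ip P v)\<^sup>2 \<le> \<omega> * hsq v" "(ip DP v)\<^sup>2 \<le> \<sigma> * \<omega> * hsq v" by linarith+
  have "\<kappa>\<^sup>2 \<le> 1" using kappa by (simp add: power_le_one)
  then have "\<kappa>\<^sup>2 * (ip DP v)\<^sup>2 \<le> 1 * (ip DP v)\<^sup>2" by (intro mult_right_mono) auto
  moreover have "(ip P v + \<kappa> * ip DP v)\<^sup>2 \<le> 2 * (ip P v)\<^sup>2 + 2 * (\<kappa>\<^sup>2 * (ip DP v)\<^sup>2)"
    using zero_le_power2[of "ip P v - \<kappa> * ip DP v"] by (simp add: power2_eq_square algebra_simps)
  ultimately show ?thesis using a by (simp add: algebra_simps)
qed

lemma qform_le:
  assumes "decaying v"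
  shows "\<bar>qform v v\<bar> \<le> (1 + \<omega> + 2 * kmass) * hsq v"
proof -
  have iv: "ip v v \<le> hsq v" "0 \<le> ip v v" "wip v v \<le> hsq v" "0 \<le> wip v v"
    using ip_self_nonneg[of v] by (simp_all add: hsq_eq assms)
  have "\<bar>ip v (kconv r v)\<bar> \<le> kmass * ip v v" using kconv_form(2)[OF assms assms] by simp
  also have "\<dots> \<le> kmass * hsq v" by (intro mult_left_mono iv kmass_nonneg)
  finally have "\<bar>ip v (kconv r v)\<bar> \<le> kmass * hsq v" .
  moreover have "\<omega> * ip v v \<le> \<omega> * hsq v" "0 \<le> \<omega> * ip v v" using omega_ge_1 iv by (auto intro!: mult_left_mono)
  ultimately show ?thesis using iv unfolding qform_def by (simp add: distrib_right)
qed

text \<open>The lower bound rests on coercivity, which requires the normalisation at frequency 1,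
  and on smallness against the higher-order terms. The upper bound holds without normalisation, so
  it applies to the initial datum directly.\<close>

lemma Lyapunov_function:
  obtains K N0 C1 C2 where "N0 > 0" "C1 > 0" "C2 > 0"
    and "\<And>v. decaying v \<Longrightarrow> real_seq v \<Longrightarrow> Im (v 1) = 0 \<Longrightarrow> hsq v \<le> N0 \<Longrightarrow>
      C1 * hsq v \<le> lyapunov K (\<lambda>k. profile k + v k)"
    and "\<And>v. decaying v \<Longrightarrow> real_seq v \<Longrightarrow> hsq v \<le> 1 \<Longrightarrow>
      lyapunov K (\<lambda>k. profile k + v k)
      \<le> C2 * hsq v"
proof -
  let ?\<rho> = "4 * c * \<kappa>"
  define T where "T = (3 * ((1 + (\<Sum>\<^sub>\<infinity>k. (psi k)\<^sup>2)) / 2)) / 6"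
  have T0: "T \<ge> 0" unfolding T_def by (intro divide_nonneg_nonneg mult_nonneg_nonneg add_nonneg_nonneg infsum_nonneg) auto
  have trip: "\<bar>Re (trip v v v) / 6\<bar> \<le> T * (sqrt (hsq v) * hsq v)" if "decaying v" for v
    using trip_bound[OF that] abs_Re_le_cmod[of "trip v v v"] unfolding T_def by (simp add: field_simps)
  obtain K g where K: "K \<ge> 0" and g: "g > 0"
    and coer: "\<And>v. decaying v \<Longrightarrow> real_seq v \<Longrightarrow> Im (v 1) = 0 \<Longrightarrow> g * hsq v \<le> qform v v + K * (ip P v + \<kappa> * ip DP v)\<^sup>2"
    using qform_coercive[OF kappa] by metis
  have ck: "c * \<kappa> > 0" using c0 kappa by simp
  \<comment> \<open>The factor 2 compensates the loss in (x + y)^2 >= x^2 / 2 - y^2, where x is the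
    linear part of the momentum deviation and y its quadratic part; the division undoes the scale 4
    c kappa of x.\<close>
  define K' where "K' = (c * \<kappa> / 2) * K * 2 / ?\<rho>\<^sup>2"
  have K': "K' \<ge> 0" using K ck by (simp add: K'_def)
  \<comment> \<open>Half of the coercivity constant; the other half absorbs the cubic term and the
    quartic error of the penalty.\<close>
  define C1 where "C1 = (c * \<kappa> / 2) * g / 2"
  have C1: "C1 > 0" using g ck by (simp add: C1_def)
  \<comment> \<open>Small enough that (T + K') sqrt (hsq v) <= C1, and at most 1 so that the quartic
    error is dominated by a cubic one.\<close>
  define N0 where "N0 = min 1 ((C1 / (T + K' + 1))\<^sup>2)"
  have N0: "N0 > 0" using C1 T0 K' by (simp add: N0_def)
  define M where "M = 2 * ?\<rho>\<^sup>2 * (2 * (\<omega> + \<sigma> * \<omega>)) + 2"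
  define C2 where "C2 = c * \<kappa> / 2 * (1 + \<omega> + 2 * kmass) + T + K' * M + 1"
  have V: "lyapunov K' (\<lambda>k. profile k + v k)
      = c * \<kappa> / 2 * qform v v - Re (trip v v v) / 6 + K' * (?\<rho> * (ip P v + \<kappa> * ip DP v) + momentum \<kappa> v)\<^sup>2"
    if "decaying v" "real_seq v" for v
    unfolding lyapunov_def by (simp only: action_expand[OF that]) (simp add: momentum_expand[OF that(1)])
  have lower: "C1 * hsq v \<le> c * \<kappa> / 2 * qform v v - Re (trip v v v) / 6 + K' * (?\<rho> * (ip P v + \<kappa> * ip DP v) + momentum \<kappa> v)\<^sup>2"
    if dv: "decaying v" and rv: "real_seq v" and im: "Im (v 1) = 0" and small: "hsq v \<le> N0" for v
  proof -
    define l where "l = ip P v + \<kappa> * ip DP v"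
    have h: "0 \<le> hsq v" "hsq v \<le> 1" using small by (auto simp: hsq_nonneg N0_def)
    have "(?\<rho> * l)\<^sup>2 / 2 - (momentum \<kappa> v)\<^sup>2 \<le> (?\<rho> * l + momentum \<kappa> v)\<^sup>2"
      using zero_le_power2[of "?\<rho> * l / 2 + momentum \<kappa> v"] zero_le_power2[of "?\<rho> * l"]
        zero_le_power2[of "?\<rho> * l + 2 * momentum \<kappa> v"] by (simp add: power2_eq_square algebra_simps)
    moreover have "(momentum \<kappa> v)\<^sup>2 \<le> (hsq v)\<^sup>2" using momentum_le[OF dv] by (simp add: abs_le_square_iff[symmetric] h)
    ultimately have "K' * ((?\<rho> * l)\<^sup>2 / 2 - (hsq v)\<^sup>2) \<le> K' * (?\<rho> * l + momentum \<kappa> v)\<^sup>2"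
      by (intro mult_left_mono K') linarith
    moreover have "K' * ((?\<rho> * l)\<^sup>2 / 2) = c * \<kappa> / 2 * (K * l\<^sup>2)"
      using ck unfolding K'_def by (simp add: power_mult_distrib)
    ultimately have a: "c * \<kappa> / 2 * (K * l\<^sup>2) - K' * (hsq v)\<^sup>2 \<le> K' * (?\<rho> * l + momentum \<kappa> v)\<^sup>2"
      by (simp only: right_diff_distrib)
    have "c * \<kappa> / 2 * (g * hsq v) \<le> c * \<kappa> / 2 * (qform v v + K * l\<^sup>2)"
      unfolding l_def using ck by (intro mult_left_mono coer dv rv im) auto
    then have b: "2 * C1 * hsq v \<le> c * \<kappa> / 2 * qform v v + c * \<kappa> / 2 * (K * l\<^sup>2)"
      unfolding C1_def by (simp add: algebra_simps)
    have s: "0 \<le> sqrt (hsq v)" "sqrt (hsq v) * sqrt (hsq v) = hsq v" "sqrt (hsq v) \<le> 1" using h by simp_all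
    have "sqrt (hsq v) \<le> C1 / (T + K' + 1)"
      using small C1 T0 K' by (intro real_le_lsqrt) (auto simp: N0_def h)
    then have "(T + K' + 1) * sqrt (hsq v) \<le> C1" using T0 K' by (simp add: field_simps)
    then have "(T + K') * sqrt (hsq v) \<le> C1" using s(1) unfolding distrib_right by linarith
    then have "(T + K') * sqrt (hsq v) * hsq v \<le> C1 * hsq v" by (intro mult_right_mono h)
    moreover have "(hsq v)\<^sup>2 \<le> sqrt (hsq v) * hsq v"
    proof -
      have "sqrt (hsq v) * sqrt (hsq v) \<le> 1 * sqrt (hsq v)" by (intro mult_right_mono s)
      then show ?thesis using h s unfolding power2_eq_square by (intro mult_right_mono) auto
    qed
    then have "K' * (hsq v)\<^sup>2 \<le> K' * (sqrt (hsq v) * hsq v)" by (intro mult_left_mono K')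
    ultimately have "T * (sqrt (hsq v) * hsq v) + K' * (hsq v)\<^sup>2 \<le> C1 * hsq v" by (simp add: distrib_right distrib_left mult_ac)
    then show ?thesis using a b trip[OF dv] unfolding l_def[symmetric] by linarith
  qed
  have upper: "c * \<kappa> / 2 * qform v v - Re (trip v v v) / 6 + K' * (?\<rho> * (ip P v + \<kappa> * ip DP v) + momentum \<kappa> v)\<^sup>2 \<le> C2 * hsq v"
    if dv: "decaying v" and rv: "real_seq v" and small: "hsq v \<le> 1" for v
  proof -
    define l where "l = ip P v + \<kappa> * ip DP v"
    have h: "0 \<le> hsq v" by (rule hsq_nonneg)
    have h2: "(hsq v)\<^sup>2 \<le> hsq v" using small h by (simp add: power2_eq_square mult_left_le_one_le)
    have "(?\<rho> * l + momentum \<kappa> v)\<^sup>2 \<le> 2 * (?\<rho> * l)\<^sup>2 + 2 * (momentum \<kappa> v)\<^sup>2"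
      using zero_le_power2[of "?\<rho> * l - momentum \<kappa> v"] by (simp add: power2_eq_square algebra_simps)
    moreover have "(momentum \<kappa> v)\<^sup>2 \<le> (hsq v)\<^sup>2" using momentum_le[OF dv] by (simp add: abs_le_square_iff[symmetric] h)
    moreover have "(?\<rho> * l)\<^sup>2 \<le> ?\<rho>\<^sup>2 * (2 * (\<omega> + \<sigma> * \<omega>) * hsq v)"
      unfolding power_mult_distrib[of ?\<rho> l] unfolding l_def by (intro mult_left_mono linear_functional_le dv) auto
    moreover have "M * hsq v = 2 * (?\<rho>\<^sup>2 * (2 * (\<omega> + \<sigma> * \<omega>) * hsq v)) + 2 * hsq v"
      unfolding M_def by (simp only: distrib_right mult.assoc)
    ultimately have "(?\<rho> * l + momentum \<kappa> v)\<^sup>2 \<le> M * hsq v"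
      using h2 by linarith
    then have "K' * (?\<rho> * l + momentum \<kappa> v)\<^sup>2 \<le> K' * (M * hsq v)" by (intro mult_left_mono K')
    moreover have "c * \<kappa> / 2 * qform v v \<le> c * \<kappa> / 2 * ((1 + \<omega> + 2 * kmass) * hsq v)"
      using qform_le[OF dv] ck by (intro mult_left_mono) auto
    moreover have "T * (sqrt (hsq v) * hsq v) \<le> T * (1 * hsq v)"
      using small h by (intro mult_left_mono mult_right_mono T0) auto
    ultimately show ?thesis using trip[OF dv] h unfolding l_def[symmetric] C2_def by (simp only: distrib_right mult_1 mult.assoc)
  qed
  have "C2 > 0" unfolding C2_def M_def using ck T0 K' omega_ge_1 sigma_pos kmass_nonneg
    by (intro add_nonneg_pos add_nonneg_nonneg mult_nonneg_nonneg) auto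
  then show thesis using that[of N0 C1 C2 K'] N0 C1 lower upper V by (metis (no_types, lifting))
qed

end

section \<open>Conservation laws\<close>

lemma filterlim_exhausting_finite_sets:
  fixes A :: "nat \<Rightarrow> 'a set"
  assumes "\<And>n. finite (A n)" "\<And>m n. m \<le> n \<Longrightarrow> A m \<subseteq> A n" "\<And>x. \<exists>n. x \<in> A n"
  shows "filterlim A (finite_subsets_at_top UNIV) sequentially"
  unfolding filterlim_finite_subsets_at_top
proof safe
  fix X :: "'a set" assume X: "finite X"
  then have "\<exists>n. X \<subseteq> A n"
  proof (induction X)
    case (insert x X)
    then obtain n m where "X \<subseteq> A n" "x \<in> A m" using assms(3) by blast
    then have "insert x X \<subseteq> A (max m n)" using assms(2)[of n "max m n"] assms(2)[of m "max m n"] by auto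
    then show ?case by blast
  qed auto
  then obtain n where "X \<subseteq> A n" by blast
  then have "\<forall>m\<ge>n. X \<subseteq> A m" using assms(2) by blast
  then show "\<forall>\<^sub>F n in sequentially. finite (A n) \<and> X \<subseteq> A n \<and> A n \<subseteq> UNIV"
    using assms(1) unfolding eventually_sequentially by blast
qed

text \<open>Truncations that are compatible with the symmetry \<open>(j, l, m) \<mapsto> (l, m, j)\<close> of the triples with \<open>j + l + m = 0\<close>.\<close>

definition Iset :: "nat \<Rightarrow> int set" where
  "Iset n = {- int n..int n}"

definition Aset :: "nat \<Rightarrow> (int \<times> int) set" where
  "Aset n = {(j, l). j \<in> Iset n \<and> l \<in> Iset n \<and> - j - l \<in> Iset n}"

lemma finite_Iset: "finite (Iset n)" by (simp add: Iset_def)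

lemma finite_Aset: "finite (Aset n)"
  by (rule finite_subset[of _ "Iset n \<times> Iset n"]) (auto simp: Aset_def finite_Iset)

lemma tendsto_sum_Iset:
  fixes f :: "int \<Rightarrow> 'a::real_normed_vector"
  assumes "(f has_sum S) UNIV"
  shows "(\<lambda>n. sum f (Iset n)) \<longlonglongrightarrow> S"
proof -
  have "\<exists>n. x \<in> Iset n" for x by (intro exI[of _ "nat \<bar>x\<bar>"]) (auto simp: Iset_def)
  then have "filterlim Iset (finite_subsets_at_top UNIV) sequentially"
    by (intro filterlim_exhausting_finite_sets finite_Iset) (auto simp: Iset_def)
  with assms show ?thesis unfolding has_sum_def by (rule filterlim_compose)
qed

lemma tendsto_sum_Aset:
  fixes f :: "int \<times> int \<Rightarrow> 'a::real_normed_vector"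
  assumes "(f has_sum S) (UNIV \<times> UNIV)"
  shows "(\<lambda>n. sum f (Aset n)) \<longlonglongrightarrow> S"
proof -
  have "\<exists>n. x \<in> Aset n" for x
    by (cases x, intro exI[of _ "nat \<bar>fst x\<bar> + nat \<bar>snd x\<bar>"]) (auto simp: Aset_def Iset_def)
  then have "filterlim Aset (finite_subsets_at_top UNIV) sequentially"
    by (intro filterlim_exhausting_finite_sets finite_Aset) (auto simp: Aset_def Iset_def)
  with assms show ?thesis unfolding has_sum_def UNIV_Times_UNIV by (rule filterlim_compose)
qed

lemma bij_rotate_Aset: "bij_betw (\<lambda>(j, l). (l, - j - l)) (Aset n) (Aset n)"
  by (rule bij_betw_byWitness[of _ "\<lambda>(j, l). (- j - l, j)"]) (auto simp: Aset_def Iset_def)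

text \<open>The fundamental theorem for the gauge integral needs no regularity of \<open>G n\<close> in the time variable.\<close>

lemma equal_by_vanishing_derivative:
  fixes F G :: "nat \<Rightarrow> real \<Rightarrow> real"
  assumes "s \<le> t" "\<And>n x. x \<in> {s..t} \<Longrightarrow> (F n has_real_derivative G n x) (at x)"
    and "\<And>n x. x \<in> {s..t} \<Longrightarrow> \<bar>G n x\<bar> \<le> M" "\<And>x. x \<in> {s..t} \<Longrightarrow> (\<lambda>n. G n x) \<longlonglongrightarrow> 0"
    and "(\<lambda>n. F n s) \<longlonglongrightarrow> u" "(\<lambda>n. F n t) \<longlonglongrightarrow> v"
  shows "u = v"
proof -
  have I: "(G n has_integral F n t - F n s) {s..t}" for n
    using assms(2) by (intro fundamental_theorem_of_calculus assms(1))
      (auto simp: has_real_derivative_iff_has_vector_derivative[symmetric] intro: has_field_derivative_at_within)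
  have "(\<lambda>n. integral {s..t} (G n)) \<longlonglongrightarrow> integral {s..t} (\<lambda>x. 0)"
    by (rule dominated_convergence(2)[where h = "\<lambda>x. M"]) (use I assms(3,4) in \<open>auto intro: has_integral_integrable\<close>)
  then have "(\<lambda>n. F n t - F n s) \<longlonglongrightarrow> 0" using integral_unique[OF I] by simp
  moreover have "(\<lambda>n. F n t - F n s) \<longlonglongrightarrow> v - u" by (intro tendsto_diff assms)
  ultimately show ?thesis using LIMSEQ_unique by fastforce
qed

section \<open>Convolutions and the trilinear sum\<close>

definition conv :: "(int \<Rightarrow> complex) \<Rightarrow> (int \<Rightarrow> complex) \<Rightarrow> int \<Rightarrow> complex" where
  "conv a b k = (\<Sum>\<^sub>\<infinity>j. a j * b (k - j))"

lemma bij_conv: "bij_betw (\<lambda>(k, j). (j, k - j)) (UNIV \<times> UNIV) (UNIV \<times> (UNIV :: int set))"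
  by (rule bij_betw_byWitness[of _ "\<lambda>(j, l). (j + l, j)"]) auto

lemma conv_term_summable:
  assumes "decaying a" "\<And>k. cmod (b k) \<le> B"
  shows "((\<lambda>j. a j * b (k - j)) has_sum conv a b k) UNIV"
  unfolding conv_def
proof (rule has_sum_infsum[OF abs_summable_summable])
  have "(\<lambda>j. cmod (a j) * B) summable_on UNIV"
    by (intro summable_on_cmult_left decaying_norm_summable assms)
  then show "(\<lambda>j. norm (a j * b (k - j))) summable_on UNIV"
    by (rule summable_on_comparison_test) (auto simp: norm_mult intro!: mult_left_mono assms)
qed

text \<open>The double sum regrouped by the total frequency of the first two factors.\<close>

lemma conv_has_sum_trip:
  assumes a: "decaying a" and b: "decaying b" and d: "\<And>k. cmod (d k) \<le> B"
  shows "((\<lambda>k. conv a b k * d (- k)) has_sum trip a b d) UNIV"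
proof -
  obtain C where C: "\<And>k. cmod (b k) \<le> C" using decayingE[OF b] by metis
  let ?h = "\<lambda>(j, l). a j * b l * d (- j - l)"
  have "((\<lambda>p. ?h ((\<lambda>(k, j). (j, k - j)) p)) has_sum trip a b d) (UNIV \<times> UNIV)"
    by (rule has_sum_reindex_bij_betw[OF bij_conv, of ?h, THEN iffD2, OF trip_has_sum_bounded[OF a b d]])
  moreover have "?h ((\<lambda>(k, j). (j, k - j)) p) = (\<lambda>(k, j). a j * b (k - j) * d (- k)) p" for p
  proof -
    obtain k j where p: "p = (k, j)" by force
    have "- j - (k - j) = - k" by simp
    then show ?thesis unfolding p prod.case by (simp only:)
  qed
  ultimately have 1: "((\<lambda>(k, j). a j * b (k - j) * d (- k)) has_sum trip a b d) (UNIV \<times> UNIV)" by (simp only:)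
  have 2: "((\<lambda>j. (\<lambda>(k, j). a j * b (k - j) * d (- k)) (k, j)) has_sum conv a b k * d (- k)) UNIV" for k
    unfolding prod.case by (intro has_sum_cmult_left conv_term_summable[OF a C])
  show ?thesis by (rule has_sum_SigmaD[OF 1 2])
qed

text \<open>A majorant for the coefficients of a product. Its finite total mass bounds truncated
  sums uniformly in the truncation.\<close>

definition psi_conv :: "int \<Rightarrow> real" where
  "psi_conv k = (\<Sum>\<^sub>\<infinity>j. psi j * psi (k - j))"

definition psi_mass :: real where "psi_mass = infsum psi UNIV"

lemma psi_has_sum: "(psi has_sum psi_mass) UNIV"
  unfolding psi_mass_def by (rule has_sum_infsum[OF psi_summable])

lemma psi_conv_term: "((\<lambda>j. psi j * psi (k - j)) has_sum psi_conv k) UNIV"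
  unfolding psi_conv_def
proof (rule has_sum_infsum, rule summable_on_comparison_test[OF psi_summable])
  show "psi j * psi (k - j) \<le> psi j" for j
    using mult_left_mono[OF psi_le_1[of "k - j"], of "psi j"] psi_pos[of j] by simp
qed (auto simp: psi_pos less_imp_le)

lemma psi_conv_has_sum: "(psi_conv has_sum psi_mass * psi_mass) UNIV"
proof -
  let ?h = "\<lambda>(j, l). psi j * psi l"
  have "(?h has_sum psi_mass * psi_mass) (UNIV \<times> UNIV)"
    unfolding psi_mass_def by (intro prod_summable psi_summable) (simp_all add: psi_pos less_imp_le)
  then have "((\<lambda>p. ?h ((\<lambda>(k, j). (j, k - j)) p)) has_sum psi_mass * psi_mass) (UNIV \<times> UNIV)"
    by (rule has_sum_reindex_bij_betw[OF bij_conv, of ?h, THEN iffD2])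
  then have 1: "((\<lambda>(k, j). psi j * psi (k - j)) has_sum psi_mass * psi_mass) (UNIV \<times> UNIV)"
    by (simp add: case_prod_unfold)
  show ?thesis by (rule has_sum_SigmaD[OF 1]) (simp add: psi_conv_term)
qed

lemma psi_conv_bounds: "0 \<le> psi_conv k" "psi_conv k \<le> psi_mass"
proof -
  show "0 \<le> psi_conv k" by (rule has_sum_nonneg[OF psi_conv_term]) (simp add: psi_pos less_imp_le)
  show "psi_conv k \<le> psi_mass"
  proof (rule has_sum_mono[OF psi_conv_term psi_has_sum])
    show "psi j * psi (k - j) \<le> psi j" for j
      using mult_left_mono[OF psi_le_1[of "k - j"], of "psi j"] psi_pos[of j] by simp
  qed
qed

lemma conv_bound:
  assumes C: "\<And>k. cmod (a k) \<le> C * psi k" "\<And>k. cmod (b k) \<le> C * psi k"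
  shows "cmod (conv a b k) \<le> C\<^sup>2 * psi_conv k"
proof -
  have da: "decaying a" using C(1) unfolding decaying_def by blast
  have C0: "C \<ge> 0" using order_trans[OF norm_ge_zero C(1)[of 0]] psi_pos[of 0] by (simp add: zero_le_mult_iff)
  have bC: "cmod (b l) \<le> C" for l
    using C(2)[of l] mult_left_mono[OF psi_le_1[of l] C0] by simp
  have "((\<lambda>j. C\<^sup>2 * (psi j * psi (k - j))) has_sum C\<^sup>2 * psi_conv k) UNIV"
    by (intro has_sum_cmult_right psi_conv_term)
  then show ?thesis
  proof (rule norm_infsum_le[OF conv_term_summable[OF da bC]])
    fix j
    have "cmod (a j) * cmod (b (k - j)) \<le> (C * psi j) * (C * psi (k - j))"
      by (intro mult_mono C) (use C0 psi_pos[of j] in auto)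
    then show "norm (a j * b (k - j)) \<le> C\<^sup>2 * (psi j * psi (k - j))"
      by (simp add: norm_mult power2_eq_square mult_ac)
  qed
qed

text \<open>The mean of u^2 u_x vanishes: adding up the cyclic permutations turns the factor from
  the derivative into j + l + m = 0.\<close>

lemma trip_derivative_zero:
  assumes da: "decaying a"
  shows "trip a a (\<lambda>k. of_int k * a k) = 0"
proof -
  obtain C where C: "C > 0" "\<And>k. cmod (a k) \<le> C * psi k" using decayingE[OF da] by metis
  let ?d = "\<lambda>k. of_int k * a k"
  have d: "cmod (?d k) \<le> C" for k by (rule derivative_bound[OF C(2)])
  let ?h = "\<lambda>(j, l). a j * a l * ?d (- j - l)"
  let ?\<rho> = "\<lambda>(j, l). (l, - j - l) :: int \<times> int"
  let ?T = "trip a a ?d"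
  have 1: "(?h has_sum ?T) (UNIV \<times> UNIV)" by (rule trip_has_sum_bounded[OF da da d])
  have 2: "((\<lambda>p. ?h (?\<rho> p)) has_sum ?T) (UNIV \<times> UNIV)"
    by (rule has_sum_reindex_bij_betw[OF bij_rotate, of ?h, THEN iffD2, OF 1])
  have 3: "((\<lambda>p. ?h (?\<rho> (?\<rho> p))) has_sum ?T) (UNIV \<times> UNIV)"
    by (rule has_sum_reindex_bij_betw[OF bij_rotate, of "\<lambda>p. ?h (?\<rho> p)", THEN iffD2, OF 2])
  have "((\<lambda>p. ?h p + ?h (?\<rho> p) + ?h (?\<rho> (?\<rho> p))) has_sum (?T + ?T + ?T)) (UNIV \<times> UNIV)"
    by (intro has_sum_add 1 2 3)
  moreover have "?h p + ?h (?\<rho> p) + ?h (?\<rho> (?\<rho> p)) = 0" for p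
  proof -
    obtain j l where p: "p = (j, l)" by force
    define m where "m = - j - l"
    have s: "- l - m = j" "- m - j = l" "- j - l = m" by (simp_all add: m_def)
    have "of_int j + of_int l + of_int m = (0 :: complex)" by (simp add: m_def)
    moreover have "?h p + ?h (?\<rho> p) + ?h (?\<rho> (?\<rho> p)) = (of_int j + of_int l + of_int m) * (a j * a l * a m)"
      unfolding p prod.case s by (simp add: algebra_simps)
    ultimately show ?thesis by simp
  qed
  ultimately have "((\<lambda>p. 0) has_sum (?T + ?T + ?T)) ((UNIV :: int set) \<times> (UNIV :: int set))" by (simp only:)
  then have "?T + ?T + ?T = 0" using has_sum_unique has_sum_0_simp by blast
  then show ?thesis by (simp add: mult_2[symmetric])
qed

text \<open>The equation solved for the time derivative: \<open>conv (a t) (a t)\<close> are the coefficients of \<open>u\<^sup>2\<close>.\<close>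

locale rbo_flow =
  fixes \<kappa> :: real and a :: "real \<Rightarrow> int \<Rightarrow> complex"
  assumes kappa_pos: "\<kappa> > 0"
    and real: "real_seq (a t)"
    and locally_decaying: "\<exists>C e. e > 0 \<and> (\<forall>s. \<bar>s - t\<bar> < e \<longrightarrow> (\<forall>k. cmod (a s k) \<le> C * psi k))"
    and ode: "((\<lambda>\<tau>. a \<tau> k) has_vector_derivative
      (- \<i> * of_real (\<kappa> * of_int k / (1 + \<kappa> * of_int \<bar>k\<bar>)) * (a t k + conv (a t) (a t) k / 2))) (at t)"
begin

definition b :: "real \<Rightarrow> int \<Rightarrow> complex" where
  "b t k = - \<i> * of_real (\<kappa> * of_int k / (1 + \<kappa> * of_int \<bar>k\<bar>)) * (a t k + conv (a t) (a t) k / 2)"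

lemma decaying_a: "decaying (a t)"
proof -
  obtain C e where "e > 0" "\<And>s k. \<bar>s - t\<bar> < e \<Longrightarrow> cmod (a s k) \<le> C * psi k"
    using locally_decaying by blast
  from this(2)[of t] this(1) show ?thesis unfolding decaying_def by auto
qed

lemma deriv_a: "((\<lambda>\<tau>. a \<tau> k) has_vector_derivative b t k) (at t)"
  using ode unfolding b_def .

lemma real_b: "b t (- k) = cnj (b t k)"
proof -
  have "((\<lambda>\<tau>. cnj (a \<tau> k)) has_vector_derivative cnj (b t k)) (at t)"
    by (rule bounded_linear.has_vector_derivative[OF bounded_linear_cnj deriv_a])
  moreover have "(\<lambda>\<tau>. cnj (a \<tau> k)) = (\<lambda>\<tau>. a \<tau> (- k))" using real by (auto simp: real_seq_def)
  ultimately have "((\<lambda>\<tau>. a \<tau> (- k)) has_vector_derivative cnj (b t k)) (at t)" by (simp only:)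
  with deriv_a show ?thesis by (rule vector_derivative_unique_at)
qed

text \<open>The regularising term makes the symbol kappa k / (1 + kappa |k|) at most 1 in modulus,
  so that passing to the time derivative loses no power of k.\<close>

lemma b_bound:
  assumes C: "\<And>k. cmod (a t k) \<le> C * psi k"
  shows "cmod (b t k) \<le> C + C\<^sup>2 * psi_mass"
proof -
  have C0: "C \<ge> 0" using order_trans[OF norm_ge_zero C[of 0]] psi_pos[of 0] by (simp add: zero_le_mult_iff)
  have q: "\<bar>\<kappa> * of_int k / (1 + \<kappa> * of_int \<bar>k\<bar>)\<bar> \<le> 1"
    using kappa_pos by (simp add: abs_mult divide_simps add_pos_nonneg)
  have "cmod (a t k) \<le> C" using C[of k] mult_left_mono[OF psi_le_1[of k] C0] by simp
  moreover have "cmod (conv (a t) (a t) k) \<le> C\<^sup>2 * psi_mass"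
    using conv_bound[OF C C, of k] mult_left_mono[OF psi_conv_bounds(2)[of k], of "C\<^sup>2"] by simp
  moreover have "cmod (conv (a t) (a t) k / 2) \<le> cmod (conv (a t) (a t) k)"
    by (simp add: norm_divide)
  ultimately have "cmod (a t k + conv (a t) (a t) k / 2) \<le> C + C\<^sup>2 * psi_mass"
    using norm_triangle_ineq[of "a t k" "conv (a t) (a t) k / 2"] by linarith
  then have "\<bar>\<kappa> * of_int k / (1 + \<kappa> * of_int \<bar>k\<bar>)\<bar> * cmod (a t k + conv (a t) (a t) k / 2) \<le> 1 * (C + C\<^sup>2 * psi_mass)"
    by (intro mult_mono q) auto
  then show ?thesis unfolding b_def norm_mult norm_of_real by simp
qed

lemma deriv_square: "((\<lambda>\<tau>. (cmod (a \<tau> k))\<^sup>2) has_real_derivative 2 * Re (cnj (a t k) * b t k)) (at t)"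
proof -
  have R: "((\<lambda>\<tau>. Re (a \<tau> k)) has_real_derivative Re (b t k)) (at t)"
    and I: "((\<lambda>\<tau>. Im (a \<tau> k)) has_real_derivative Im (b t k)) (at t)"
    unfolding has_real_derivative_iff_has_vector_derivative
    by (rule bounded_linear.has_vector_derivative[OF _ deriv_a], simp add: bounded_linear_Re bounded_linear_Im)+
  show ?thesis unfolding cmod_power2
    by (rule derivative_eq_intros R I refl)+ (simp add: power2_eq_square algebra_simps)
qed

text \<open>The weight 1 + kappa |k| cancels the denominator in the equation. The linear term
  contributes nothing to the derivative, and the quadratic term leaves a truncation of a multiple of
  the mean of u^2 u_x, which tends to 0.\<close>

lemma momentum_locally_constant:
  assumes st: "s \<le> t" and C: "\<And>x k. x \<in> {s..t} \<Longrightarrow> cmod (a x k) \<le> C * psi k"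
  shows "momentum \<kappa> (a s) = momentum \<kappa> (a t)"
proof -
  define F where "F n x = (\<Sum>k\<in>Iset n. (1 + \<kappa> * of_int \<bar>k\<bar>) * (cmod (a x k))\<^sup>2)" for n x
  define G where "G n x = (\<Sum>k\<in>Iset n. \<kappa> * Im (conv (a x) (a x) k * (of_int k * a x (- k))))" for n x
  have C0: "C \<ge> 0" using order_trans[OF norm_ge_zero C[of s 0]] st psi_pos[of 0] by (simp add: zero_le_mult_iff)
  have lim: "(\<lambda>n. F n x) \<longlonglongrightarrow> momentum \<kappa> (a x)" for x
  proof -
    have "((\<lambda>k. (cmod (a x k))\<^sup>2 + \<kappa> * (of_int \<bar>k\<bar> * (cmod (a x k))\<^sup>2)) has_sum momentum \<kappa> (a x)) UNIV"
      unfolding momentum_def ip_self using ip_summable[OF decaying_a decaying_a, of x x] unfolding Re_cnj_self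
      by (intro has_sum_add has_sum_cmult_right has_sum_infsum)
    from tendsto_sum_Iset[OF this] show ?thesis unfolding F_def by (simp add: algebra_simps)
  qed
  show ?thesis
  proof (rule equal_by_vanishing_derivative[of s t F G "\<kappa> * (C * C\<^sup>2 * (psi_mass * psi_mass))"])
    fix n x
    have "(F n has_real_derivative (\<Sum>k\<in>Iset n. (1 + \<kappa> * of_int \<bar>k\<bar>) * (2 * Re (cnj (a x k) * b x k)))) (at x)"
      unfolding F_def by (intro DERIV_sum DERIV_cmult deriv_square)
    moreover have "(1 + \<kappa> * of_int \<bar>k\<bar>) * (2 * Re (cnj (a x k) * b x k)) = \<kappa> * Im (conv (a x) (a x) k * (of_int k * a x (- k)))" for k
    proof -
      have aux: "p * (2 * Re (cnj u * w)) = 2 * Re (cnj u * (of_real p * w))" for p u w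
        by (simp add: algebra_simps)
      have p: "1 + \<kappa> * of_int \<bar>k\<bar> > 0" using kappa_pos by (intro add_pos_nonneg) auto
      have "of_real (1 + \<kappa> * of_int \<bar>k\<bar>) * b x k = - \<i> * of_real (\<kappa> * of_int k) * (a x k + conv (a x) (a x) k / 2)"
        unfolding b_def using p by (simp only: of_real_divide) (simp add: field_simps del: of_real_add)
      then have "(1 + \<kappa> * of_int \<bar>k\<bar>) * (2 * Re (cnj (a x k) * b x k)) = 2 * Re (cnj (a x k) * (- \<i> * of_real (\<kappa> * of_int k) * (a x k + conv (a x) (a x) k / 2)))"
        using aux[of "1 + \<kappa> * of_int \<bar>k\<bar>" "a x k" "b x k"] by (simp only:)
      also have "\<dots> = \<kappa> * Im (conv (a x) (a x) k * (of_int k * cnj (a x k)))"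
        by (simp add: field_simps)
      finally show ?thesis using real[of x] by (simp add: real_seq_def)
    qed
    ultimately show "(F n has_real_derivative G n x) (at x)" unfolding G_def by simp
  next
    fix n x assume x: "x \<in> {s..t}"
    have "\<bar>G n x\<bar> \<le> (\<Sum>k\<in>Iset n. \<kappa> * (C * C\<^sup>2 * psi_conv k))"
      unfolding G_def
    proof (rule order_trans[OF sum_abs sum_mono])
      fix k
      have d: "cmod (of_int k * a x (- k)) \<le> C" using derivative_bound[of "a x" C "- k", OF C[OF x]] by simp
      have "\<bar>Im (conv (a x) (a x) k * (of_int k * a x (- k)))\<bar> \<le> cmod (conv (a x) (a x) k) * cmod (of_int k * a x (- k))"
        using abs_Im_le_cmod[of "conv (a x) (a x) k * (of_int k * a x (- k))"] by (simp only: norm_mult)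
      also have "\<dots> \<le> (C\<^sup>2 * psi_conv k) * C"
        by (intro mult_mono conv_bound C[OF x] d) (auto simp: psi_conv_bounds)
      finally show "\<bar>\<kappa> * Im (conv (a x) (a x) k * (of_int k * a x (- k)))\<bar> \<le> \<kappa> * (C * C\<^sup>2 * psi_conv k)"
        using kappa_pos by (simp only: abs_mult) (simp add: mult_ac)
    qed
    also have "\<dots> = \<kappa> * (C * C\<^sup>2) * sum psi_conv (Iset n)" by (simp only: sum_distrib_left mult.assoc)
    also have "\<dots> \<le> \<kappa> * (C * C\<^sup>2) * (psi_mass * psi_mass)"
      using kappa_pos C0 finite_sum_le_has_sum[OF psi_conv_has_sum finite_Iset[of n]] psi_conv_bounds
      by (intro mult_left_mono) auto
    finally show "\<bar>G n x\<bar> \<le> \<kappa> * (C * C\<^sup>2 * (psi_mass * psi_mass))" by (simp add: mult_ac)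
  next
    fix x assume x: "x \<in> {s..t}"
    obtain D where D: "D > 0" "\<And>k. cmod (a x k) \<le> D * psi k" using decayingE[OF decaying_a] by metis
    have d: "cmod (of_int k * a x k) \<le> D" for k by (rule derivative_bound[OF D(2)])
    have "((\<lambda>k. conv (a x) (a x) k * (of_int (- k) * a x (- k))) has_sum 0) UNIV"
      using conv_has_sum_trip[of "a x" "a x" "\<lambda>k. of_int k * a x k" D, OF decaying_a decaying_a d] unfolding trip_derivative_zero[OF decaying_a] .
    then have "((\<lambda>k. - \<kappa> * Im (conv (a x) (a x) k * (of_int (- k) * a x (- k)))) has_sum - \<kappa> * Im 0) UNIV"
      by (intro has_sum_cmult_right has_sum_Im)
    moreover have "- \<kappa> * Im (conv (a x) (a x) k * (of_int (- k) * a x (- k))) = \<kappa> * Im (conv (a x) (a x) k * (of_int k * a x (- k)))" for k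
      by (simp add: algebra_simps)
    ultimately have "((\<lambda>k. \<kappa> * Im (conv (a x) (a x) k * (of_int k * a x (- k)))) has_sum 0) UNIV"
      by (simp only: zero_complex.simps mult_zero_right)
    from tendsto_sum_Iset[OF this] show "(\<lambda>n. G n x) \<longlonglongrightarrow> 0" unfolding G_def .
  qed (use st lim in auto)
qed

text \<open>Hamiltonian structure: u + u^2 / 2 is the gradient of the energy, and the equation
  applies a skew multiplier to it, so its pairing with the time derivative vanishes frequency by
  frequency.\<close>

lemma energy_locally_constant:
  assumes st: "s \<le> t" and C: "\<And>x k. x \<in> {s..t} \<Longrightarrow> cmod (a x k) \<le> C * psi k"
  shows "energy (a s) = energy (a t)"
proof -
  let ?h = "\<lambda>x (j, l). a x j * a x l * b x (- j - l)"
  define F where "F n x = (\<Sum>k\<in>Iset n. (cmod (a x k))\<^sup>2) / 2 + Re (\<Sum>(j, l)\<in>Aset n. a x j * a x l * a x (- j - l)) / 6" for n x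
  define G where "G n x = (\<Sum>k\<in>Iset n. Re (cnj (a x k) * b x k)) + Re (sum (?h x) (Aset n)) / 2" for n x
  define B where "B = C + C\<^sup>2 * psi_mass"
  have C0: "C \<ge> 0" using order_trans[OF norm_ge_zero C[of s 0]] st psi_pos[of 0] by (simp add: zero_le_mult_iff)
  have B: "cmod (b x k) \<le> B" if "x \<in> {s..t}" for x k
    unfolding B_def by (rule b_bound[OF C[OF that]])
  have B0: "B \<ge> 0" using order_trans[OF norm_ge_zero B[of s 0]] st by simp
  have lim: "(\<lambda>n. F n x) \<longlonglongrightarrow> energy (a x)" for x
  proof -
    have "((\<lambda>k. (cmod (a x k))\<^sup>2) has_sum ip (a x) (a x)) UNIV"
      unfolding ip_self using ip_summable(1)[OF decaying_a decaying_a, of x x] unfolding Re_cnj_self by (rule has_sum_infsum)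
    note l1 = tendsto_sum_Iset[OF this]
    note l2 = tendsto_sum_Aset[OF trip_has_sum[OF decaying_a decaying_a decaying_a, of x x x]]
    show ?thesis unfolding F_def energy_def by (intro tendsto_intros l1 l2) auto
  qed
  show ?thesis
  proof (rule equal_by_vanishing_derivative[of s t F G "B * (C * psi_mass) + B * (C\<^sup>2 * (psi_mass * psi_mass)) / 2"])
    fix n x
    let ?d = "\<lambda>(j, l). a x j * a x l * b x (- j - l) + (a x j * b x l + b x j * a x l) * a x (- j - l)"
    have "((\<lambda>x. \<Sum>p\<in>Aset n. (\<lambda>(j, l). a x j * a x l * a x (- j - l)) p) has_vector_derivative sum ?d (Aset n)) (at x)"
      by (intro has_vector_derivative_sum) (auto intro!: has_vector_derivative_mult deriv_a)
    \<comment> \<open>The truncation is invariant under rotation, hence the three sums from the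
      product rule coincide.\<close>
    moreover have "sum ?d (Aset n) = 3 * sum (?h x) (Aset n)"
    proof -
      let ?\<rho> = "\<lambda>(j, l). (l, - j - l) :: int \<times> int"
      have e1: "(\<Sum>p\<in>Aset n. ?h x (?\<rho> p)) = sum (?h x) (Aset n)"
        by (rule sum.reindex_bij_betw[OF bij_rotate_Aset])
      have e2: "(\<Sum>p\<in>Aset n. ?h x (?\<rho> (?\<rho> p))) = sum (?h x) (Aset n)"
        using sum.reindex_bij_betw[OF bij_rotate_Aset, of "\<lambda>p. ?h x (?\<rho> p)" n] e1 by simp
      have "?d p = ?h x p + ?h x (?\<rho> p) + ?h x (?\<rho> (?\<rho> p))" for p
      proof -
        obtain j l where p: "p = (j, l)" by force
        define m where "m = - j - l"
        have s: "- l - m = j" "- m - j = l" "- j - l = m" by (simp_all add: m_def)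
        show ?thesis unfolding p prod.case s by (simp add: algebra_simps)
      qed
      then have "sum ?d (Aset n) = (\<Sum>p\<in>Aset n. ?h x p + ?h x (?\<rho> p) + ?h x (?\<rho> (?\<rho> p)))"
        by (intro sum.cong refl)
      then show ?thesis by (simp only: sum.distrib e1 e2) simp
    qed
    ultimately have "((\<lambda>x. Re (\<Sum>p\<in>Aset n. (\<lambda>(j, l). a x j * a x l * a x (- j - l)) p)) has_real_derivative Re (3 * sum (?h x) (Aset n))) (at x)"
      unfolding has_real_derivative_iff_has_vector_derivative
      by (intro bounded_linear.has_vector_derivative[OF bounded_linear_Re]) simp
    moreover have "((\<lambda>x. \<Sum>k\<in>Iset n. (cmod (a x k))\<^sup>2) has_real_derivative (\<Sum>k\<in>Iset n. 2 * Re (cnj (a x k) * b x k))) (at x)"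
      by (intro DERIV_sum deriv_square)
    ultimately have "(F n has_real_derivative (\<Sum>k\<in>Iset n. 2 * Re (cnj (a x k) * b x k)) / 2 + Re (3 * sum (?h x) (Aset n)) / 6) (at x)"
      unfolding F_def by (intro DERIV_add DERIV_cdivide)
    moreover have r3: "Re (3 * z) = 3 * Re z" for z by simp
    have "(\<Sum>k\<in>Iset n. 2 * Re (cnj (a x k) * b x k)) / 2 + Re (3 * sum (?h x) (Aset n)) / 6 = G n x"
      unfolding G_def sum_distrib_left[symmetric] r3 by simp
    ultimately show "(F n has_real_derivative G n x) (at x)" by (simp only:)
  next
    fix n x assume x: "x \<in> {s..t}"
    have "\<bar>\<Sum>k\<in>Iset n. Re (cnj (a x k) * b x k)\<bar> \<le> (\<Sum>k\<in>Iset n. B * (C * psi k))"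
    proof (rule order_trans[OF sum_abs sum_mono])
      fix k
      have "\<bar>Re (cnj (a x k) * b x k)\<bar> \<le> cmod (a x k) * cmod (b x k)"
        using abs_Re_le_cmod[of "cnj (a x k) * b x k"] by (simp only: norm_mult complex_mod_cnj)
      also have "\<dots> \<le> (C * psi k) * B"
        by (intro mult_mono C[OF x] B[OF x]) (use C0 psi_pos[of k] in auto)
      finally show "\<bar>Re (cnj (a x k) * b x k)\<bar> \<le> B * (C * psi k)" by (simp only: mult_ac)
    qed
    also have "\<dots> = B * C * sum psi (Iset n)" by (simp only: sum_distrib_left mult.assoc)
    also have "\<dots> \<le> B * C * psi_mass"
      using B0 C0 finite_sum_le_has_sum[OF psi_has_sum finite_Iset[of n]] psi_pos
      by (intro mult_left_mono) (auto simp: less_imp_le)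
    finally have 1: "\<bar>\<Sum>k\<in>Iset n. Re (cnj (a x k) * b x k)\<bar> \<le> B * (C * psi_mass)" by (simp add: mult_ac)
    have "cmod (sum (?h x) (Aset n)) \<le> (\<Sum>p\<in>Aset n. (B * C\<^sup>2) * (\<lambda>(j, l). psi j * psi l) p)"
    proof (rule sum_norm_le)
      fix p :: "int \<times> int"
      obtain j l where p: "p = (j, l)" by force
      have "cmod (a x j) * cmod (a x l) * cmod (b x (- j - l)) \<le> (C * psi j) * (C * psi l) * B"
        by (intro mult_mono C[OF x] B[OF x] mult_nonneg_nonneg) (use C0 psi_pos in \<open>auto simp: less_imp_le\<close>)
      then show "cmod (?h x p) \<le> (B * C\<^sup>2) * (\<lambda>(j, l). psi j * psi l) p"
        unfolding p by (simp add: norm_mult power2_eq_square mult_ac)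
    qed
    also have "\<dots> = (B * C\<^sup>2) * (\<Sum>p\<in>Aset n. (\<lambda>(j, l). psi j * psi l) p)" by (rule sum_distrib_left[symmetric])
    also have "\<dots> \<le> (B * C\<^sup>2) * (psi_mass * psi_mass)"
    proof (rule mult_left_mono)
      have "((\<lambda>(j, l). psi j * psi l) has_sum psi_mass * psi_mass) (UNIV \<times> UNIV)"
        unfolding psi_mass_def by (intro prod_summable psi_summable) (simp_all add: psi_pos less_imp_le)
      from finite_sum_le_has_sum[OF this finite_Aset[of n]]
      show "(\<Sum>p\<in>Aset n. (\<lambda>(j, l). psi j * psi l) p) \<le> psi_mass * psi_mass"
        using psi_pos by (auto simp: less_imp_le)
    qed (use B0 in simp)
    finally have "\<bar>Re (sum (?h x) (Aset n))\<bar> \<le> (B * C\<^sup>2) * (psi_mass * psi_mass)"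
      using abs_Re_le_cmod[of "sum (?h x) (Aset n)"] by linarith
    then have 2: "\<bar>Re (sum (?h x) (Aset n)) / 2\<bar> \<le> B * (C\<^sup>2 * (psi_mass * psi_mass)) / 2" by (simp add: mult_ac)
    show "\<bar>G n x\<bar> \<le> B * (C * psi_mass) + B * (C\<^sup>2 * (psi_mass * psi_mass)) / 2"
      unfolding G_def using 1 2 abs_triangle_ineq[of "\<Sum>k\<in>Iset n. Re (cnj (a x k) * b x k)" "Re (sum (?h x) (Aset n)) / 2"] by linarith
  next
    fix x assume x: "x \<in> {s..t}"
    have "(\<lambda>k. Re (cnj (a x k) * b x k)) summable_on UNIV"
    proof (rule abs_summable_summable, rule summable_on_comparison_test)
      show "(\<lambda>k. cmod (a x k) * B) summable_on UNIV" by (intro summable_on_cmult_left decaying_norm_summable decaying_a)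
      fix k
      have "\<bar>Re (cnj (a x k) * b x k)\<bar> \<le> cmod (a x k) * cmod (b x k)"
        using abs_Re_le_cmod[of "cnj (a x k) * b x k"] by (simp only: norm_mult complex_mod_cnj)
      also have "\<dots> \<le> cmod (a x k) * B" by (intro mult_left_mono B[OF x]) simp
      finally show "norm (Re (cnj (a x k) * b x k)) \<le> cmod (a x k) * B" by simp
    qed simp
    then have 1: "((\<lambda>k. Re (cnj (a x k) * b x k)) has_sum (\<Sum>\<^sub>\<infinity>k. Re (cnj (a x k) * b x k))) UNIV" by (rule has_sum_infsum)
    let ?S = "(\<Sum>\<^sub>\<infinity>k. Re (cnj (a x k) * b x k)) + Re (trip (a x) (a x) (b x)) / 2"
    have "((\<lambda>k. Re (cnj (a x k) * b x k) + Re (conv (a x) (a x) k * b x (- k)) / 2) has_sum ?S) UNIV"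
      by (intro has_sum_add 1 has_sum_divide_const has_sum_Re conv_has_sum_trip[OF decaying_a decaying_a B[OF x]])
    moreover have "Re (cnj (a x k) * b x k) + Re (conv (a x) (a x) k * b x (- k)) / 2 = 0" for k
    proof -
      let ?g = "a x k + conv (a x) (a x) k / 2"
      have "Re (cnj (a x k) * b x k) + Re (conv (a x) (a x) k * b x (- k)) / 2 = Re (?g * cnj (b x k))"
        unfolding real_b by (simp add: field_simps)
      also have "cnj (b x k) = \<i> * of_real (\<kappa> * of_int k / (1 + \<kappa> * of_int \<bar>k\<bar>)) * cnj ?g"
        unfolding b_def by simp
      also have "?g * (\<i> * of_real (\<kappa> * of_int k / (1 + \<kappa> * of_int \<bar>k\<bar>)) * cnj ?g)
          = \<i> * of_real (\<kappa> * of_int k / (1 + \<kappa> * of_int \<bar>k\<bar>) * (cmod ?g)\<^sup>2)"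
        unfolding of_real_mult complex_norm_square by (simp only: mult_ac)
      also have "Re \<dots> = 0" by (simp only: Re_i_times Im_complex_of_real minus_zero)
      finally show ?thesis .
    qed
    ultimately have "((\<lambda>k. 0) has_sum ?S) (UNIV :: int set)" by (simp only:)
    then have S: "?S = 0" using has_sum_unique has_sum_0_simp by blast
    have "(\<lambda>n. G n x) \<longlonglongrightarrow> ?S" unfolding G_def
      by (intro tendsto_intros tendsto_sum_Iset[OF 1] tendsto_sum_Aset[OF trip_has_sum_bounded[OF decaying_a decaying_a B[OF x]]]) auto
    then show "(\<lambda>n. G n x) \<longlonglongrightarrow> 0" unfolding S .
  qed (use st lim in auto)
qed

text \<open>The decay bound is uniform only near each time, so the two quantities are first locally
  constant; connectedness of the line does the rest.\<close>

lemma conservation_laws: "momentum \<kappa> (a t) = momentum \<kappa> (a s)" "energy (a t) = energy (a s)"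
proof -
  have "\<forall>x\<in>UNIV. eventually (\<lambda>y. (momentum \<kappa> (a x), energy (a x)) = (momentum \<kappa> (a y), energy (a y))) (at x within UNIV)"
  proof
    fix x :: real
    obtain C e where e: "e > 0" and C: "\<And>s k. \<bar>s - x\<bar> < e \<Longrightarrow> cmod (a s k) \<le> C * psi k"
      using locally_decaying by blast
    have "(momentum \<kappa> (a x), energy (a x)) = (momentum \<kappa> (a y), energy (a y))" if "\<bar>y - x\<bar> < e" for y
    proof (cases "x \<le> y")
      case True
      have "cmod (a z k) \<le> C * psi k" if "z \<in> {x..y}" for z k using C[of z k] that \<open>\<bar>y - x\<bar> < e\<close> True by auto
      then show ?thesis using momentum_locally_constant[OF True] energy_locally_constant[OF True] by blast
    next
      case False
      then have le: "y \<le> x" by simp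
      have "cmod (a z k) \<le> C * psi k" if "z \<in> {y..x}" for z k using C[of z k] that \<open>\<bar>y - x\<bar> < e\<close> le by auto
      then show ?thesis using momentum_locally_constant[OF le] energy_locally_constant[OF le] by metis
    qed
    then show "eventually (\<lambda>y. (momentum \<kappa> (a x), energy (a x)) = (momentum \<kappa> (a y), energy (a y))) (at x within UNIV)"
      unfolding eventually_at dist_real_def using e by auto
  qed
  then have "(momentum \<kappa> (a t), energy (a t)) = (momentum \<kappa> (a s), energy (a s))"
    using connected_local_const[OF connected_UNIV, of t s "\<lambda>x. (momentum \<kappa> (a x), energy (a x))"] by blast
  then show "momentum \<kappa> (a t) = momentum \<kappa> (a s)" "energy (a t) = energy (a s)" by simp_all
qed

end

section \<open>Fourier series of periodic functions\<close>

locale torus =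
  fixes L :: real
  assumes L0: "L > 0"
begin

abbreviation M :: "real measure" where "M \<equiv> lebesgue_on {- L..L}"

definition ch :: "int \<Rightarrow> real \<Rightarrow> complex" where
  "ch k x = cis (of_int k * pi * x / L)"

lemma fourier_coeff_ch: "fourier_coeff L f k = 1 / of_real (2 * L) * (\<integral>x. of_real (f x) * ch (- k) x \<partial>M)"
  unfolding fourier_coeff_def ch_def by simp

lemma ch_mult: "ch j x * ch k x = ch (j + k) x"
  unfolding ch_def cis_mult by (simp add: ring_distribs add_divide_distrib)

lemma norm_ch [simp]: "cmod (ch k x) = 1"
  by (simp add: ch_def)

lemma ch_0 [simp]: "ch 0 x = 1"
  by (simp add: ch_def)

lemma continuous_ch: "continuous_on S (ch k)"
  unfolding ch_def by (intro continuous_intros) (use L0 in auto)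

lemma measurable_continuous: "continuous_on UNIV f \<Longrightarrow> f \<in> borel_measurable M"
  by (rule continuous_imp_measurable_on_sets_lebesgue) (auto intro: continuous_on_subset)

lemma measurable_ch [measurable]: "ch k \<in> borel_measurable M"
  by (rule measurable_continuous[OF continuous_ch])

lemma integrable_mult_bounded:
  fixes h g :: "real \<Rightarrow> complex"
  assumes h: "integrable M h" and [measurable]: "g \<in> borel_measurable M" and B: "\<And>x. x \<in> {-L..L} \<Longrightarrow> cmod (g x) \<le> B"
  shows "integrable M (\<lambda>x. h x * g x)"
proof (rule Bochner_Integration.integrable_bound)
  show "integrable M (\<lambda>x. of_real B * h x)" by (intro integrable_mult_right h)
  show "(\<lambda>x. h x * g x) \<in> borel_measurable M" using h by measurable
  have "cmod (h x * g x) \<le> cmod (of_real B * h x)" if "x \<in> {-L..L}" for x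
  proof -
    have "cmod (h x) * cmod (g x) \<le> cmod (h x) * \<bar>B\<bar>" by (intro mult_left_mono) (use B[OF that] in auto)
    then show ?thesis by (simp add: norm_mult mult.commute)
  qed
  then show "AE x in M. cmod (h x * g x) \<le> cmod (of_real B * h x)" by (intro AE_I2) simp
qed

lemma integrable_mult_ch: "integrable M h \<Longrightarrow> integrable M (\<lambda>x. h x * ch k x)"
  by (rule integrable_mult_bounded[where B = 1]) auto

lemma integral_ch: "(\<integral>x. ch n x \<partial>M) = (if n = 0 then of_real (2 * L) else 0)"
proof -
  have i: "integrable M (ch n)" by (rule continuous_imp_integrable_real[OF continuous_ch])
  have e: "(\<integral>x. ch n x \<partial>M) = integral {-L..L} (ch n)" by (rule lebesgue_integral_eq_integral[OF i]) auto
  show ?thesis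
  proof (cases "n = 0")
    case True
    have "integral {-L..L} (ch n) = integral {-L..L} (\<lambda>x. 1)" using True by (intro integral_cong) simp
    then show ?thesis using True L0 unfolding e by (simp add: scaleR_conv_of_real)
  next
    case False
    define w where "w = \<i> * of_real (of_int n * pi / L)"
    have w0: "w \<noteq> 0" using False L0 by (simp add: w_def)
    have chw: "ch n x = exp (w * of_real x)" for x
      unfolding ch_def cis_conv_exp w_def by (simp add: mult_ac)
    have D: "((\<lambda>x. exp (w * of_real x) / w) has_vector_derivative exp (w * of_real x)) (at x within {-L..L})" for x
    proof -
      have "((\<lambda>z. exp (w * z) / w) has_field_derivative exp (w * of_real x)) (at (of_real x))"
        using w0 by (auto intro!: derivative_eq_intros)
      then show ?thesis by (rule has_vector_derivative_real_field)
    qed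
    have "((\<lambda>x. exp (w * of_real x)) has_integral (exp (w * of_real L) / w - exp (w * of_real (- L)) / w)) {-L..L}"
      by (rule fundamental_theorem_of_calculus) (use L0 D in auto)
    moreover have "exp (w * of_real L) = exp (w * of_real (- L))"
    proof -
      have "exp (w * of_real L) = cis (of_int n * pi)" "exp (w * of_real (- L)) = cis (- (of_int n * pi))"
        using L0 chw[of L] chw[of "- L"] unfolding ch_def by simp_all
      moreover have "sin (of_int n * pi) = 0" by (rule sin_integer_2pi[of "of_int n / 2", simplified] | simp add: sin_zero_iff_int2)+
      ultimately show ?thesis by (simp add: complex_eq_iff)
    qed
    ultimately have "integral {-L..L} (ch n) = 0" unfolding chw[abs_def] by (simp add: integral_unique)
    then show ?thesis using False e by simp
  qed
qed

definition fseries :: "(int \<Rightarrow> complex) \<Rightarrow> real \<Rightarrow> complex" where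
  "fseries s x = (\<Sum>\<^sub>\<infinity>k. s k * ch k x)"

lemma fseries_has_sum:
  assumes "(\<lambda>k. cmod (s k)) summable_on UNIV"
  shows "((\<lambda>k. s k * ch k x) has_sum fseries s x) UNIV"
  unfolding fseries_def by (rule has_sum_infsum[OF abs_summable_summable]) (simp add: norm_mult assms)

lemma norm_fseries_le:
  assumes "(\<lambda>k. cmod (s k)) summable_on UNIV"
  shows "cmod (fseries s x) \<le> (\<Sum>\<^sub>\<infinity>k. cmod (s k))"
  by (rule norm_infsum_le[OF fseries_has_sum[OF assms] has_sum_infsum[OF assms]]) (simp add: norm_mult)

lemma measurable_fseries:
  assumes "(\<lambda>k. cmod (s k)) summable_on UNIV"
  shows "fseries s \<in> borel_measurable M"
proof (rule borel_measurable_LIMSEQ_metric)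
  show "(\<lambda>x. \<Sum>k\<in>Iset n. s k * ch k x) \<in> borel_measurable M" for n by measurable
  show "(\<lambda>n. \<Sum>k\<in>Iset n. s k * ch k x) \<longlonglongrightarrow> fseries s x" for x
    by (rule tendsto_sum_Iset[OF fseries_has_sum[OF assms]])
qed

text \<open>Dominated convergence along the partial sums over \<open>Iset\<close> identifies the
  value; summability in the unordered sense is proved separately, and the two limits are
  compared.\<close>

lemma fseries_integral:
  assumes s: "(\<lambda>k. cmod (s k)) summable_on UNIV" and g: "integrable M g"
  shows "((\<lambda>k. s k * (\<integral>x. ch k x * g x \<partial>M)) has_sum (\<integral>x. fseries s x * g x \<partial>M)) UNIV"
    and "integrable M (\<lambda>x. fseries s x * g x)"
proof -
  let ?T = "\<Sum>\<^sub>\<infinity>k. cmod (s k)"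
  have [measurable]: "g \<in> borel_measurable M" using g by measurable
  have ig: "integrable M (\<lambda>x. ch k x * g x)" for k
    using integrable_mult_ch[OF g] by (simp add: mult.commute)
  show "integrable M (\<lambda>x. fseries s x * g x)"
    using integrable_mult_bounded[OF g measurable_fseries[OF s] norm_fseries_le[OF s]] by (simp add: mult.commute)
  have partial: "(\<integral>x. (\<Sum>k\<in>Iset n. s k * ch k x) * g x \<partial>M) = (\<Sum>k\<in>Iset n. s k * (\<integral>x. ch k x * g x \<partial>M))" for n
    by (simp add: sum_distrib_right mult.assoc Bochner_Integration.integral_sum ig)
  have lim: "(\<lambda>n. \<integral>x. (\<Sum>k\<in>Iset n. s k * ch k x) * g x \<partial>M) \<longlonglongrightarrow> (\<integral>x. fseries s x * g x \<partial>M)"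
  proof (rule integral_dominated_convergence[where w = "\<lambda>x. ?T * cmod (g x)"])
    show "(\<lambda>x. fseries s x * g x) \<in> borel_measurable M" using measurable_fseries[OF s] by measurable
    show "(\<lambda>x. (\<Sum>k\<in>Iset n. s k * ch k x) * g x) \<in> borel_measurable M" for n by measurable
    show "integrable M (\<lambda>x. ?T * cmod (g x))" using g by simp
    show "AE x in M. (\<lambda>n. (\<Sum>k\<in>Iset n. s k * ch k x) * g x) \<longlonglongrightarrow> fseries s x * g x"
      by (intro AE_I2 tendsto_mult tendsto_sum_Iset[OF fseries_has_sum[OF s]] tendsto_const)
    show "AE x in M. norm ((\<Sum>k\<in>Iset n. s k * ch k x) * g x) \<le> ?T * cmod (g x)" for n
    proof (rule AE_I2)
      fix x
      have "cmod (\<Sum>k\<in>Iset n. s k * ch k x) \<le> (\<Sum>k\<in>Iset n. cmod (s k))"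
        by (rule sum_norm_le) (simp add: norm_mult)
      also have "\<dots> \<le> ?T" by (rule finite_sum_le_infsum[OF s finite_Iset]) auto
      finally show "norm ((\<Sum>k\<in>Iset n. s k * ch k x) * g x) \<le> ?T * cmod (g x)"
        unfolding norm_mult by (intro mult_right_mono) auto
    qed
  qed
  have bnd: "cmod (\<integral>x. ch k x * g x \<partial>M) \<le> (\<integral>x. cmod (g x) \<partial>M)" for k
    using integral_norm_bound[of M "\<lambda>x. ch k x * g x"] by (simp add: norm_mult)
  have "(\<lambda>k. s k * (\<integral>x. ch k x * g x \<partial>M)) summable_on UNIV"
  proof (rule abs_summable_summable, rule summable_on_comparison_test)
    show "(\<lambda>k. cmod (s k) * (\<integral>x. cmod (g x) \<partial>M)) summable_on UNIV" by (intro summable_on_cmult_left s)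
    show "norm (s k * (\<integral>x. ch k x * g x \<partial>M)) \<le> cmod (s k) * (\<integral>x. cmod (g x) \<partial>M)" for k
      unfolding norm_mult by (intro mult_left_mono bnd) auto
  qed auto
  then have hs: "((\<lambda>k. s k * (\<integral>x. ch k x * g x \<partial>M)) has_sum (\<Sum>\<^sub>\<infinity>k. s k * (\<integral>x. ch k x * g x \<partial>M))) UNIV"
    by (rule has_sum_infsum)
  have "(\<Sum>\<^sub>\<infinity>k. s k * (\<integral>x. ch k x * g x \<partial>M)) = (\<integral>x. fseries s x * g x \<partial>M)"
    by (rule LIMSEQ_unique[OF tendsto_sum_Iset[OF hs] lim[unfolded partial]])
  with hs show "((\<lambda>k. s k * (\<integral>x. ch k x * g x \<partial>M)) has_sum (\<integral>x. fseries s x * g x \<partial>M)) UNIV" by simp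
qed

lemma integrable_ch: "integrable M (ch k)"
  by (rule continuous_imp_integrable_real[OF continuous_ch])

lemma fseries_coeff:
  assumes s: "(\<lambda>k. cmod (s k)) summable_on UNIV"
  shows "(\<integral>x. fseries s x * ch (- m) x \<partial>M) = of_real (2 * L) * s m"
proof -
  have e: "(\<lambda>k. s k * (\<integral>x. ch k x * ch (- m) x \<partial>M)) = (\<lambda>k. if k = m then of_real (2 * L) * s m else 0)"
    by (rule ext) (simp add: ch_mult integral_ch)
  have F: "((\<lambda>k. if k = m then of_real (2 * L) * s m else 0) has_sum of_real (2 * L) * s m) UNIV"
    by (rule has_sum_finite_neutralI[of "{m}"]) auto
  show ?thesis
    by (rule has_sum_unique[OF fseries_integral(1)[OF s integrable_ch[of "- m"], unfolded e] F])
qed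

text \<open>Uniqueness of Fourier coefficients: this class of functions is stable under multiplication by
  trigonometric polynomials, hence by Stone-Weierstrass such functions are orthogonal to everything.\<close>

definition vanishing :: "(real \<Rightarrow> complex) \<Rightarrow> bool" where
  "vanishing h \<longleftrightarrow> integrable M h \<and> (\<forall>k. (\<integral>x. h x * ch k x \<partial>M) = 0)"

lemma vanishing_add: "vanishing f \<Longrightarrow> vanishing g \<Longrightarrow> vanishing (\<lambda>x. f x + g x)"
  unfolding vanishing_def by (auto simp: distrib_right integrable_mult_ch)

lemma vanishing_cmult: "vanishing f \<Longrightarrow> vanishing (\<lambda>x. c * f x)"
  unfolding vanishing_def by (auto simp: mult.assoc)

lemma vanishing_mult_ch: "vanishing f \<Longrightarrow> vanishing (\<lambda>x. f x * ch j x)"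
  unfolding vanishing_def by (auto simp: mult.assoc ch_mult integrable_mult_ch)

text \<open>A real polynomial at the point \<open>ch 1 x\<close> of the circle is a trigonometric
  polynomial: real linear forms are combinations of \<open>ch 1\<close> and \<open>ch (- 1)\<close>,
  and products are handled by the generality of \<open>h\<close> in the induction.\<close>

lemma vanishing_mult_polynomial:
  assumes "real_polynomial_function q"
  shows "vanishing h \<Longrightarrow> vanishing (\<lambda>x. h x * of_real (q (ch 1 x)))"
  using assms
proof (induction q arbitrary: h rule: real_polynomial_function.induct)
  case lin: (linear f)
  interpret bounded_linear f by (rule lin(1))
  have "of_real (f (ch 1 x)) = ((of_real (f 1) - \<i> * of_real (f \<i>)) / 2) * ch 1 x + ((of_real (f 1) + \<i> * of_real (f \<i>)) / 2) * ch (- 1) x" for x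
  proof -
    have z: "z = Re z *\<^sub>R 1 + Im z *\<^sub>R \<i>" for z :: complex by (simp add: complex_eq_iff)
    have "f (ch 1 x) = Re (ch 1 x) * f 1 + Im (ch 1 x) * f \<i>"
      by (subst z) (simp only: add scaleR real_scaleR_def)
    moreover have "ch 1 x = of_real (Re (ch 1 x)) + \<i> * of_real (Im (ch 1 x))" "ch (- 1) x = of_real (Re (ch 1 x)) - \<i> * of_real (Im (ch 1 x))"
      by (simp_all add: complex_eq_iff ch_def)
    ultimately show ?thesis by (simp add: complex_eq_iff field_simps)
  qed
  then have "(\<lambda>x. h x * of_real (f (ch 1 x))) = (\<lambda>x. ((of_real (f 1) - \<i> * of_real (f \<i>)) / 2) * (h x * ch 1 x) + ((of_real (f 1) + \<i> * of_real (f \<i>)) / 2) * (h x * ch (- 1) x))"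
    by (simp only:) (simp only: distrib_left mult_ac)
  moreover have "vanishing \<dots>" by (intro vanishing_add vanishing_cmult vanishing_mult_ch lin(2))
  ultimately show ?case by simp
next
  case (const c)
  then show ?case using vanishing_cmult[of h "of_real c"] by (simp add: mult.commute)
next
  case (add f g)
  then show ?case using vanishing_add[OF add.IH(1)[OF add.prems] add.IH(2)[OF add.prems]] by (simp add: distrib_left)
next
  case (mult f g)
  show ?case using mult.IH(2)[OF mult.IH(1)[OF mult.prems]] by (simp add: mult.assoc)
qed

lemma vanishing_mult_continuous:
  assumes h: "vanishing h" and g: "continuous_on UNIV g" and per: "g (- L) = g L"
  shows "(\<integral>x. h x * of_real (g x) \<partial>M) = 0"
proof -
  \<comment> \<open>The periodic function moved to the unit circle, where Stone-Weierstrass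
    applies.\<close>
  define G where "G z = g (L * Arg z / pi)" for z
  have G: "G (ch 1 x) = g x" if "x \<in> {-L..L}" for x
  proof (cases "x = - L")
    case True
    \<comment> \<open>At the cut \<open>Arg\<close> is pi, so x = - L is read as L; periodicity
      closes the gap.\<close>
    then have "ch 1 x = cis pi" using L0 by (simp add: ch_def complex_eq_iff)
    then have "Arg (ch 1 x) = pi" using Arg_cis[of pi] by simp
    then show ?thesis using True per by (simp add: G_def)
  next
    case False
    then have "- L < x" "x \<le> L" using that by auto
    then have "- pi < pi * x / L" "pi * x / L \<le> pi" using L0 mult_strict_left_mono[of "- L" x pi] mult_left_mono[of x L pi] by (simp_all add: field_simps)
    then have "Arg (ch 1 x) = pi * x / L" unfolding ch_def by (simp add: Arg_cis)
    then show ?thesis using L0 by (simp add: G_def)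
  qed
  have surj: "ch 1 ` {-L..L} = sphere 0 1"
  proof
    show "ch 1 ` {-L..L} \<subseteq> sphere 0 1" by auto
    show "sphere 0 1 \<subseteq> ch 1 ` {-L..L}"
    proof
      fix z :: complex assume "z \<in> sphere 0 1"
      then have z: "cmod z = 1" "z \<noteq> 0" by auto
      let ?x = "L * Arg z / pi"
      have b: "- pi < Arg z" "Arg z \<le> pi" by (rule mpi_less_Arg Arg_le_pi)+
      then have "?x \<in> {-L..L}"
        using L0 mult_left_mono[of "- pi" "Arg z" L] mult_left_mono[of "Arg z" pi L] by (simp add: field_simps)
      moreover have "ch 1 ?x = z" using z L0 cis_Arg[OF z(2)] by (simp add: ch_def sgn_div_norm)
      ultimately show "z \<in> ch 1 ` {-L..L}" by force
    qed
  qed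
  \<comment> \<open>\<open>Arg\<close> jumps at the cut, so continuity is obtained from a quotient
    map: preimages of closed sets under G are images of compact sets under
    \<open>ch 1\<close>.\<close>
  have contG: "continuous_on (sphere 0 1) G"
  proof (subst continuous_on_closed_vimage)
    show "\<forall>B. closed B \<longrightarrow> closed (G -` B \<inter> sphere 0 1)"
    proof (intro allI impI)
      fix B :: "real set" assume "closed B"
      have "G -` B \<inter> sphere 0 1 = ch 1 ` ({-L..L} \<inter> g -` B)"
        unfolding surj[symmetric] using G by auto
      moreover have "compact ({-L..L} \<inter> g -` B)"
        using \<open>closed B\<close> g by (intro compact_Int_closed closed_vimage) auto
      ultimately show "closed (G -` B \<inter> sphere 0 1)"
        by (simp add: compact_imp_closed compact_continuous_image continuous_ch)
    qed
  qed auto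
  have ih: "integrable M h" using h by (simp add: vanishing_def)
  let ?N = "\<integral>x. cmod (h x) \<partial>M"
  have N0: "?N \<ge> 0" by simp
  have "cmod (\<integral>x. h x * of_real (g x) \<partial>M) \<le> e" if "e > 0" for e
  proof -
    define e' where "e' = e / (?N + 1)"
    have e': "e' > 0" using that N0 by (simp add: e'_def add_nonneg_pos)
    obtain q where q: "real_polynomial_function q" and qG: "\<And>z. z \<in> sphere 0 1 \<Longrightarrow> \<bar>G z - q z\<bar> < e'"
      using Stone_Weierstrass_real_polynomial_function[OF compact_sphere contG e'] by blast
    have gq: "\<bar>g x - q (ch 1 x)\<bar> \<le> e'" if "x \<in> {-L..L}" for x
      using qG[of "ch 1 x"] G[OF that] by simp
    have vq: "vanishing (\<lambda>x. h x * of_real (q (ch 1 x)))" by (rule vanishing_mult_polynomial[OF q h])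
    then have iq: "integrable M (\<lambda>x. h x * of_real (q (ch 1 x)))" and zq: "(\<integral>x. h x * of_real (q (ch 1 x)) \<partial>M) = 0"
      unfolding vanishing_def by (auto dest: spec[of _ 0])
    obtain Bg where Bg: "\<forall>x\<in>{-L..L}. \<bar>g x\<bar> \<le> Bg"
      using compact_imp_bounded[OF compact_continuous_image[OF continuous_on_subset[OF g] compact_Icc[of "-L" L]]]
      unfolding bounded_iff ball_simps real_norm_def by blast
    have igg: "integrable M (\<lambda>x. h x * of_real (g x))"
      by (rule integrable_mult_bounded[OF ih, of _ Bg])
         (use Bg in \<open>auto intro!: measurable_continuous continuous_intros g\<close>)
    have "(\<integral>x. h x * of_real (g x) \<partial>M) = (\<integral>x. h x * of_real (g x) - h x * of_real (q (ch 1 x)) \<partial>M)"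
      using igg iq zq by simp
    also have "cmod \<dots> \<le> (\<integral>x. cmod (h x * of_real (g x) - h x * of_real (q (ch 1 x))) \<partial>M)"
      by (rule integral_norm_bound)
    also have "\<dots> \<le> (\<integral>x. e' * cmod (h x) \<partial>M)"
    proof (rule integral_mono)
      show "integrable M (\<lambda>x. cmod (h x * of_real (g x) - h x * of_real (q (ch 1 x))))"
        using igg iq by (intro integrable_norm Bochner_Integration.integrable_diff)
      show "integrable M (\<lambda>x. e' * cmod (h x))" using ih by simp
      fix x assume "x \<in> space M"
      then have x: "x \<in> {-L..L}" by simp
      have "cmod (h x * of_real (g x) - h x * of_real (q (ch 1 x))) = cmod (h x) * \<bar>g x - q (ch 1 x)\<bar>"
        by (simp only: right_diff_distrib[symmetric] of_real_diff[symmetric] norm_mult norm_of_real)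
      also have "\<dots> \<le> cmod (h x) * e'" by (intro mult_left_mono gq x) auto
      finally show "cmod (h x * of_real (g x) - h x * of_real (q (ch 1 x))) \<le> e' * cmod (h x)" by (simp add: mult.commute)
    qed
    also have "\<dots> = e' * ?N" by simp
    also have "\<dots> \<le> e" using that N0 by (simp add: e'_def divide_simps add_nonneg_pos)
    finally show ?thesis .
  qed
  then have "cmod (\<integral>x. h x * of_real (g x) \<partial>M) \<le> 0" using field_le_epsilon[of "cmod (\<integral>x. h x * of_real (g x) \<partial>M)" 0] by simp
  then show ?thesis by simp
qed

lemma vanishing_mult_measurable:
  assumes h: "vanishing h" and \<phi>: "\<phi> \<in> borel_measurable M" and b: "\<And>x. \<bar>\<phi> x\<bar> \<le> (1 :: real)"
  shows "(\<integral>x. h x * of_real (\<phi> x) \<partial>M) = 0"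
proof -
  have "\<phi> measurable_on {-L..L}" using \<phi> by (subst measurable_on_iff_borel_measurable) auto
  then obtain N g where N: "negligible N" and g: "\<And>n. continuous_on UNIV (g n)"
    and gl: "\<And>x. x \<notin> N \<Longrightarrow> (\<lambda>n. g n x) \<longlonglongrightarrow> (if x \<in> {-L..L} then \<phi> x else 0)"
    unfolding measurable_on_def by blast
  \<comment> \<open>Clipping to [-1, 1] gives domination by h. The cut-off factor vanishes at both
    ends, which makes the approximant periodic, and is eventually 1 at each interior point.\<close>
  define c where "c n x = max (-1) (min 1 (g n x)) * max 0 (min 1 (real n * (L - \<bar>x\<bar>)))" for n x
  have cc: "continuous_on UNIV (c n)" for n
    unfolding c_def by (intro continuous_intros g)
  have c1: "\<bar>c n x\<bar> \<le> 1" for n x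
  proof -
    have "\<bar>max (-1) (min 1 (g n x))\<bar> * \<bar>max 0 (min 1 (real n * (L - \<bar>x\<bar>)))\<bar> \<le> 1 * 1"
      by (intro mult_mono) auto
    then show ?thesis by (simp add: c_def abs_mult)
  qed
  have ih: "integrable M h" using h by (simp add: vanishing_def)
  have [measurable]: "h \<in> borel_measurable M" using ih by measurable
  have [measurable]: "c n \<in> borel_measurable M" for n by (rule measurable_continuous[OF cc])
  note \<phi>[measurable]
  have cl: "(\<lambda>n. c n x) \<longlonglongrightarrow> \<phi> x" if "x \<notin> N" "x \<in> {-L..L}" "x \<noteq> L" "x \<noteq> - L" for x
  proof -
    have pos: "L - \<bar>x\<bar> > 0" using that by auto
    have 1: "(\<lambda>n. max (-1) (min 1 (g n x))) \<longlonglongrightarrow> max (-1) (min 1 (\<phi> x))"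
      using gl[OF that(1)] that(2) by (intro tendsto_intros) simp
    have "eventually (\<lambda>n. real n \<ge> 1 / (L - \<bar>x\<bar>)) sequentially"
      using filterlim_real_sequentially unfolding filterlim_at_top by blast
    then have "eventually (\<lambda>n. max 0 (min 1 (real n * (L - \<bar>x\<bar>))) = 1) sequentially"
    proof eventually_elim
      case (elim n)
      then have "1 \<le> real n * (L - \<bar>x\<bar>)" using pos by (simp add: divide_simps mult.commute)
      then show ?case by simp
    qed
    then have 2: "(\<lambda>n. max 0 (min 1 (real n * (L - \<bar>x\<bar>)))) \<longlonglongrightarrow> 1" by (rule tendsto_eventually)
    have "max (-1) (min 1 (\<phi> x)) = \<phi> x" using b[of x] by auto
    then show ?thesis using tendsto_mult[OF 1 2] unfolding c_def by simp
  qed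
  have "(\<lambda>n. \<integral>x. h x * of_real (c n x) \<partial>M) \<longlonglongrightarrow> (\<integral>x. h x * of_real (\<phi> x) \<partial>M)"
  proof (rule integral_dominated_convergence[where w = "\<lambda>x. cmod (h x)"])
    show "integrable M (\<lambda>x. cmod (h x))" using ih by simp
    have "N \<union> {L, - L} \<in> null_sets lebesgue"
      using N by (simp add: negligible_iff_null_sets[symmetric] negligible_Un negligible_finite)
    then have "AE x in lebesgue. x \<notin> N \<union> {L, - L}" by (rule AE_not_in)
    then have "AE x in lebesgue. x \<in> {-L..L} \<longrightarrow> (\<lambda>n. h x * of_real (c n x)) \<longlonglongrightarrow> h x * of_real (\<phi> x)"
    proof eventually_elim
      case (elim x)
      then show ?case using cl[of x] by (auto intro!: tendsto_intros)
    qed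
    then show "AE x in M. (\<lambda>n. h x * of_real (c n x)) \<longlonglongrightarrow> h x * of_real (\<phi> x)"
      by (subst AE_restrict_space_iff) auto
    show "AE x in M. norm (h x * of_real (c n x)) \<le> cmod (h x)" for n
      by (intro AE_I2) (simp add: norm_mult c1 mult_left_le)
  qed measurable
  moreover have "(\<integral>x. h x * of_real (c n x) \<partial>M) = 0" for n
    by (rule vanishing_mult_continuous[OF h cc]) (use L0 in \<open>simp add: c_def\<close>)
  ultimately have "(\<lambda>n::nat. 0) \<longlonglongrightarrow> (\<integral>x. h x * of_real (\<phi> x) \<partial>M)" by (simp only:)
  then show ?thesis by (simp only: LIMSEQ_const_iff)
qed

text \<open>Testing against the signs of the real and imaginary parts yields the integrals of their
  absolute values.\<close>

lemma vanishing_AE_0: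
  assumes h: "vanishing h"
  shows "AE x in M. h x = 0"
proof -
  have ih: "integrable M h" using h by (simp add: vanishing_def)
  have [measurable]: "h \<in> borel_measurable M" using ih by measurable
  have z: "AE x in M. F (h x) = 0"
    if F: "bounded_linear F" "\<And>w. \<bar>F w\<bar> \<le> cmod w" "\<And>w t. F (w * of_real t) = F w * t" for F :: "complex \<Rightarrow> real"
  proof -
    have [measurable]: "F \<in> borel_measurable borel"
      using F(1) by (intro borel_measurable_continuous_onI linear_continuous_on)
    have m: "(\<lambda>x. sgn (F (h x))) \<in> borel_measurable M" by measurable
    have "0 = F (\<integral>x. h x * of_real (sgn (F (h x))) \<partial>M)"
      by (subst vanishing_mult_measurable[OF h m]) (auto simp: abs_sgn_eq bounded_linear.linear[OF F(1)] linear_0)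
    also have "\<dots> = (\<integral>x. F (h x * of_real (sgn (F (h x)))) \<partial>M)"
    proof (rule integral_bounded_linear[OF F(1), symmetric])
      show "integrable M (\<lambda>x. h x * of_real (sgn (F (h x))))"
      proof (rule integrable_mult_bounded[OF ih, where B = 1])
        show "(\<lambda>x. complex_of_real (sgn (F (h x)))) \<in> borel_measurable M"
          by (rule borel_measurable_continuous_on[OF _ m]) (intro continuous_intros)
      qed (simp add: abs_sgn_eq)
    qed
    also have "\<dots> = (\<integral>x. \<bar>F (h x)\<bar> \<partial>M)" by (simp add: F(3) abs_sgn)
    finally have "(\<integral>x. \<bar>F (h x)\<bar> \<partial>M) = 0" by simp
    moreover have "integrable M (\<lambda>x. \<bar>F (h x)\<bar>)"
      using integrable_bounded_linear[OF F(1) ih] by simp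
    ultimately have "AE x in M. \<bar>F (h x)\<bar> = 0" by (subst (asm) integral_nonneg_eq_0_iff_AE) auto
    then show ?thesis by simp
  qed
  have "AE x in M. Re (h x) = 0" "AE x in M. Im (h x) = 0"
    by (rule z; simp add: bounded_linear_Re bounded_linear_Im abs_Re_le_cmod abs_Im_le_cmod)+
  then show ?thesis by eventually_elim (simp add: complex_eq_iff)
qed

text \<open>Only the smoother factor u is expanded: its Fourier series converges absolutely and
  equals u almost everywhere by uniqueness, so it can be integrated term by term against the merely
  integrable v.\<close>

lemma fourier_coeff_product:
  fixes u v :: "real \<Rightarrow> real"
  assumes u: "integrable M u" and v: "integrable M v" and s: "(\<lambda>k. cmod (fourier_coeff L u k)) summable_on UNIV"
  shows "fourier_coeff L (\<lambda>x. u x * v x) k = conv (fourier_coeff L u) (fourier_coeff L v) k"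
proof -
  let ?a = "fourier_coeff L u"
  have iu: "integrable M (\<lambda>x. complex_of_real (u x))" and iv: "integrable M (\<lambda>x. complex_of_real (v x))"
    using u v by simp_all
  have nz: "(of_real (2 * L) :: complex) \<noteq> 0" using L0 by simp
  have "vanishing (\<lambda>x. of_real (u x) - fseries ?a x)"
    unfolding vanishing_def
  proof (intro conjI allI)
    have iS: "integrable M (fseries ?a)" using fseries_integral(2)[OF s integrable_ch[of 0]] by simp
    show "integrable M (\<lambda>x. of_real (u x) - fseries ?a x)" using iu iS by simp
    fix k
    have "(\<integral>x. of_real (u x) * ch k x \<partial>M) = of_real (2 * L) * ?a (- k)"
      unfolding fourier_coeff_ch using nz by simp
    moreover have "(\<integral>x. fseries ?a x * ch k x \<partial>M) = of_real (2 * L) * ?a (- k)"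
      using fseries_coeff[OF s, of "- k"] by simp
    ultimately show "(\<integral>x. (of_real (u x) - fseries ?a x) * ch k x \<partial>M) = 0"
      using integrable_mult_ch[OF iu] integrable_mult_ch[OF iS] by (simp add: left_diff_distrib)
  qed
  from vanishing_AE_0[OF this] have ae: "AE x in M. complex_of_real (u x) = fseries ?a x" by simp
  have [measurable]: "u \<in> borel_measurable M" "v \<in> borel_measurable M" "fseries ?a \<in> borel_measurable M"
    using u v measurable_fseries[OF s] by measurable
  have "(\<integral>x. of_real (u x * v x) * ch (- k) x \<partial>M) = (\<integral>x. fseries ?a x * (of_real (v x) * ch (- k) x) \<partial>M)"
    by (rule integral_cong_AE) (measurable, use ae in eventually_elim, simp add: mult.assoc)
  also have "((\<lambda>j. ?a j * (\<integral>x. ch j x * (of_real (v x) * ch (- k) x) \<partial>M)) has_sum \<dots>) UNIV"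
    by (rule fseries_integral(1)[OF s integrable_mult_ch[OF iv]])
  finally have "((\<lambda>j. 1 / of_real (2 * L) * (?a j * (\<integral>x. ch j x * (of_real (v x) * ch (- k) x) \<partial>M))) has_sum fourier_coeff L (\<lambda>x. u x * v x) k) UNIV"
    unfolding fourier_coeff_ch[of "\<lambda>x. u x * v x"] by (rule has_sum_cmult_right)
  moreover have "1 / of_real (2 * L) * (?a j * (\<integral>x. ch j x * (of_real (v x) * ch (- k) x) \<partial>M)) = ?a j * fourier_coeff L v (k - j)" for j
  proof -
    have e: "(\<lambda>x. ch j x * (of_real (v x) * ch (- k) x)) = (\<lambda>x. of_real (v x) * ch (- (k - j)) x)"
      by (rule ext) (simp add: mult.left_commute ch_mult)
    show ?thesis unfolding fourier_coeff_ch[of v] e by simp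
  qed
  ultimately show ?thesis unfolding conv_def by (simp add: infsumI)
qed

end

section \<open>Modulation and the continuity argument\<close>

lemma hsq_add_le:
  assumes "decaying v" "decaying w"
  shows "hsq (\<lambda>k. v k + w k) \<le> 2 * hsq v + 2 * hsq w"
proof -
  have "hsq (\<lambda>k. v k + w k) \<le> (\<Sum>\<^sub>\<infinity>k. 2 * ((1 + real_of_int \<bar>k\<bar>) * (cmod (v k))\<^sup>2) + 2 * ((1 + real_of_int \<bar>k\<bar>) * (cmod (w k))\<^sup>2))"
    unfolding hsq_def
  proof (rule infsum_mono)
    fix k :: int
    have "(cmod (v k + w k))\<^sup>2 \<le> (cmod (v k) + cmod (w k))\<^sup>2"
      by (intro power_mono norm_triangle_ineq) auto
    also have "\<dots> \<le> 2 * (cmod (v k))\<^sup>2 + 2 * (cmod (w k))\<^sup>2"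
      using zero_le_power2[of "cmod (v k) - cmod (w k)"] by (simp add: power2_eq_square algebra_simps)
    finally have "(1 + real_of_int \<bar>k\<bar>) * (cmod (v k + w k))\<^sup>2 \<le> (1 + real_of_int \<bar>k\<bar>) * (2 * (cmod (v k))\<^sup>2 + 2 * (cmod (w k))\<^sup>2)"
      by (intro mult_left_mono) auto
    then show "(1 + real_of_int \<bar>k\<bar>) * (cmod (v k + w k))\<^sup>2 \<le> 2 * ((1 + real_of_int \<bar>k\<bar>) * (cmod (v k))\<^sup>2) + 2 * ((1 + real_of_int \<bar>k\<bar>) * (cmod (w k))\<^sup>2)"
      by (simp only: distrib_left mult.left_commute)
  qed (intro hsq_summable decaying_add summable_on_add summable_on_cmult_right assms)+
  also have "\<dots> = 2 * hsq v + 2 * hsq w"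
    unfolding hsq_def
    by (simp only: infsum_add summable_on_cmult_right hsq_summable assms infsum_cmult_right')
  finally show ?thesis .
qed

lemma hsq_minus_commute: "hsq (\<lambda>k. v k - w k) = hsq (\<lambda>k. w k - v k)"
  unfolding hsq_def by (simp add: norm_minus_commute)

lemma hsq_ge_first:
  assumes "decaying v"
  shows "(cmod (v 1))\<^sup>2 \<le> hsq v"
proof -
  have "2 * (cmod (v 1))\<^sup>2 \<le> hsq v"
    using finite_sum_le_infsum[OF hsq_summable[OF assms], of "{1}"] unfolding hsq_def[symmetric] by simp
  then show ?thesis using zero_le_power2[of "cmod (v 1)"] by linarith
qed

text \<open>The action on Fourier coefficients of the translation by y, with theta = pi y /
  L.\<close>

definition rot :: "real \<Rightarrow> (int \<Rightarrow> complex) \<Rightarrow> int \<Rightarrow> complex" where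
  "rot \<theta> v k = cis (of_int k * \<theta>) * v k"

lemma decaying_rot: "decaying v \<Longrightarrow> decaying (rot \<theta> v)"
  unfolding rot_def by (rule decaying_bounded_mult[where B = 1]) auto

lemma real_seq_rot: "real_seq v \<Longrightarrow> real_seq (rot \<theta> v)"
  unfolding rot_def real_seq_def by (simp add: cis_cnj)

lemma rot_rot: "rot \<theta> (rot \<theta>' v) = rot (\<theta> + \<theta>') v"
  unfolding rot_def by (auto simp: mult.assoc[symmetric] cis_mult distrib_left)

lemma rot_0 [simp]: "rot 0 v = v"
  unfolding rot_def by auto

lemma rot_diff: "rot \<theta> (\<lambda>k. v k - w k) = (\<lambda>k. rot \<theta> v k - rot \<theta> w k)"
  unfolding rot_def by (auto simp: right_diff_distrib)

lemma hsq_rot: "hsq (rot \<theta> v) = hsq v"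
  unfolding hsq_def rot_def by (simp add: norm_mult)

lemma momentum_rot: "momentum \<kappa> (rot \<theta> v) = momentum \<kappa> v"
  unfolding momentum_def ip_self rot_def by (simp add: norm_mult)

text \<open>The three frequencies add up to 0, so the phases cancel.\<close>

lemma energy_rot: "energy (rot \<theta> v) = energy v"
proof -
  have "rot \<theta> v j * rot \<theta> v l * rot \<theta> v (- j - l) = v j * v l * v (- j - l)" for j l
  proof -
    have "cis (of_int j * \<theta>) * cis (of_int l * \<theta>) * cis (of_int (- j - l) * \<theta>) = 1"
      unfolding cis_mult by (simp add: algebra_simps)
    then have "(cis (of_int j * \<theta>) * cis (of_int l * \<theta>) * cis (of_int (- j - l) * \<theta>)) * (v j * v l * v (- j - l)) = 1 * (v j * v l * v (- j - l))"
      by (simp only:)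
    then show ?thesis unfolding rot_def by (simp only: mult_ac mult_1)
  qed
  then have "trip (rot \<theta> v) (rot \<theta> v) (rot \<theta> v) = trip v v v" unfolding trip_def by (simp only:)
  then show ?thesis unfolding energy_def ip_self by (simp add: rot_def norm_mult)
qed

text \<open>Measuring rotations by the chord |cis theta - 1| avoids choosing representatives of
  angles; the chord is what the first Fourier coefficient controls below.\<close>

lemma norm_cis_int_minus_1_le: "cmod (cis (of_int k * \<theta>) - 1) \<le> real_of_int \<bar>k\<bar> * cmod (cis \<theta> - 1)"
proof -
  have n: "cmod (cis (real n * \<theta>) - 1) \<le> real n * cmod (cis \<theta> - 1)" for n
  proof -
    have "cmod (cis \<theta> ^ n - 1 ^ n) \<le> real n * cmod (cis \<theta> - 1)"
      by (rule norm_power_diff) auto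
    then show ?thesis by (simp add: Complex.DeMoivre)
  qed
  show ?thesis
  proof (cases "k \<ge> 0")
    case True
    then show ?thesis using n[of "nat k"] by simp
  next
    case False
    have "cis (of_int k * \<theta>) = cnj (cis (real (nat (- k)) * \<theta>))" using False by (simp add: cis_cnj)
    then have "cmod (cis (of_int k * \<theta>) - 1) = cmod (cis (real (nat (- k)) * \<theta>) - 1)"
      by (metis complex_cnj_diff complex_cnj_one complex_mod_cnj)
    then show ?thesis using n[of "nat (- k)"] False by simp
  qed
qed

context rbo_wave
begin

lemma profile_eq: "profile k = of_real (2 * c * \<kappa> * ker r k)"
  unfolding profile_def P_def by simp

lemma real_seq_profile: "real_seq profile"
  unfolding real_seq_def profile_eq by simp

lemma profile_1_pos: "0 < 2 * c * \<kappa> * ker r 1"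
  using c0 kappa ker_pos[of 1] by simp

lemma profile_rotation_bound:
  obtains S where "S \<ge> 0" "\<And>\<theta>. hsq (\<lambda>k. rot \<theta> profile k - profile k) \<le> S * (cmod (cis \<theta> - 1))\<^sup>2"
proof -
  define B where "B = (2 * c * \<kappa>)\<^sup>2"
  \<comment> \<open>One power of the weight comes from \<open>hsq\<close>, two from the square of
    the chord bound.\<close>
  let ?g = "\<lambda>k. (1 + real_of_int \<bar>k\<bar>) ^ 3 * ker r k"
  have "hsq (\<lambda>k. rot \<theta> profile k - profile k) \<le> (B * infsum ?g UNIV) * (cmod (cis \<theta> - 1))\<^sup>2" for \<theta>
  proof -
    have d: "decaying (\<lambda>k. rot \<theta> profile k - profile k)" by (intro decaying_diff decaying_rot decaying_profile)
    have "hsq (\<lambda>k. rot \<theta> profile k - profile k) \<le> (\<Sum>\<^sub>\<infinity>k. (B * (cmod (cis \<theta> - 1))\<^sup>2) * ?g k)"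
      unfolding hsq_def
    proof (rule infsum_mono[OF hsq_summable[OF d] summable_on_cmult_right[OF weighted_ker_summable]])
      fix k :: int
      let ?w = "1 + real_of_int \<bar>k\<bar>"
      have "cmod (rot \<theta> profile k - profile k) = cmod (cis (of_int k * \<theta>) - 1) * (2 * c * \<kappa> * ker r k)"
      proof -
        have "rot \<theta> profile k - profile k = (cis (of_int k * \<theta>) - 1) * profile k"
          by (simp add: rot_def left_diff_distrib)
        then show ?thesis using c0 kappa ker_pos[of k] unfolding profile_eq by (simp only: norm_mult norm_of_real) simp
      qed
      also have "\<dots> \<le> (?w * cmod (cis \<theta> - 1)) * (2 * c * \<kappa> * ker r k)"
        using norm_cis_int_minus_1_le[of k \<theta>] c0 kappa ker_pos[of k]
        by (intro mult_right_mono) (auto simp: distrib_right intro: order_trans)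
      finally have "(cmod (rot \<theta> profile k - profile k))\<^sup>2 \<le> ((?w * cmod (cis \<theta> - 1)) * (2 * c * \<kappa> * ker r k))\<^sup>2"
        by (intro power_mono) auto
      also have "\<dots> = B * (cmod (cis \<theta> - 1))\<^sup>2 * (?w\<^sup>2 * (ker r k * ker r k))"
        unfolding B_def by (simp add: power_mult_distrib power2_eq_square mult_ac)
      also have "\<dots> \<le> B * (cmod (cis \<theta> - 1))\<^sup>2 * (?w\<^sup>2 * (ker r k * 1))"
        using ker_pos[of k] ker_le_1[of k] by (intro mult_left_mono) (auto simp: B_def)
      finally have "?w * (cmod (rot \<theta> profile k - profile k))\<^sup>2 \<le> ?w * (B * (cmod (cis \<theta> - 1))\<^sup>2 * (?w\<^sup>2 * (ker r k * 1)))"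
        by (intro mult_left_mono) auto
      then show "?w * (cmod (rot \<theta> profile k - profile k))\<^sup>2 \<le> (B * (cmod (cis \<theta> - 1))\<^sup>2) * ?g k"
        by (simp add: power3_eq_cube power2_eq_square mult_ac)
    qed
    also have "\<dots> = (B * infsum ?g UNIV) * (cmod (cis \<theta> - 1))\<^sup>2"
      by (simp only: infsum_cmult_right') (simp only: mult_ac)
    finally show ?thesis .
  qed
  moreover have "0 \<le> B * infsum ?g UNIV"
    using ker_pos by (intro mult_nonneg_nonneg infsum_nonneg) (auto simp: B_def less_imp_le)
  ultimately show thesis using that by blast
qed

text \<open>The new phase makes the first coefficient real and positive, as it is for the profile.
  The phase change is controlled by the error in that single coefficient, hence by the
  distance.\<close>

lemma modulation:
  obtains \<rho> C where "\<rho> > 0" "C > 0"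
    "\<And>a \<theta>. decaying a \<Longrightarrow> hsq (\<lambda>k. a k - rot \<theta> profile k) \<le> \<rho> \<Longrightarrow>
      \<exists>\<theta>'. Im (rot (- \<theta>') a 1 - profile 1) = 0 \<and>
        hsq (\<lambda>k. rot (- \<theta>') a k - profile k) \<le> C * hsq (\<lambda>k. a k - rot \<theta> profile k)"
proof -
  obtain S where S: "S \<ge> 0" "\<And>\<theta>. hsq (\<lambda>k. rot \<theta> profile k - profile k) \<le> S * (cmod (cis \<theta> - 1))\<^sup>2"
    using profile_rotation_bound by blast
  define f1 where "f1 = 2 * c * \<kappa> * ker r 1"
  have f1: "f1 > 0" "profile 1 = of_real f1" using profile_1_pos unfolding f1_def profile_eq by simp_all
  \<comment> \<open>Within this radius the first coefficient stays at least f1 / 2 in modulus, so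
    its argument is meaningful.\<close>
  define \<rho> where "\<rho> = (f1 / 2)\<^sup>2"
  \<comment> \<open>The factors 2 come from \<open>hsq_add_le\<close>, and 16 / f1^2 is the square
    of the factor 4 / f1 between the chord and the error of the first coefficient.\<close>
  define C where "C = 2 + 2 * (S * (16 / f1\<^sup>2))"
  have C: "C > 0" using S(1) by (simp add: C_def add_pos_nonneg)
  have "\<exists>\<theta>'. Im (rot (- \<theta>') a 1 - profile 1) = 0 \<and> hsq (\<lambda>k. rot (- \<theta>') a k - profile k) \<le> C * hsq (\<lambda>k. a k - rot \<theta> profile k)"
    if da: "decaying a" and small: "hsq (\<lambda>k. a k - rot \<theta> profile k) \<le> \<rho>" for a \<theta>
  proof -
    define b where "b = rot (- \<theta>) a"
    define w where "w k = b k - profile k" for k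
    have w_eq: "w = rot (- \<theta>) (\<lambda>k. a k - rot \<theta> profile k)"
      unfolding w_def b_def rot_diff rot_rot by simp
    have hw: "hsq w = hsq (\<lambda>k. a k - rot \<theta> profile k)" unfolding w_eq hsq_rot ..
    have dw: "decaying w" unfolding w_def[abs_def] b_def by (intro decaying_diff decaying_rot da decaying_profile)
    have w1: "(cmod (w 1))\<^sup>2 \<le> hsq w" by (rule hsq_ge_first[OF dw])
    then have "(cmod (w 1))\<^sup>2 \<le> (f1 / 2)\<^sup>2" using small hw unfolding \<rho>_def by linarith
    then have w1': "cmod (w 1) \<le> f1 / 2" by (rule power2_le_imp_le) (use f1(1) in simp)
    have b1: "b 1 = of_real f1 + w 1" by (simp add: w_def f1)
    have bn: "\<bar>cmod (b 1) - f1\<bar> \<le> cmod (w 1)"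
      using norm_triangle_ineq3[of "b 1" "of_real f1"] f1 unfolding b1 by simp
    then have b_ge: "cmod (b 1) \<ge> f1 / 2" using w1' by linarith
    then have b0: "b 1 \<noteq> 0" using f1 by auto
    define \<phi> where "\<phi> = Arg (b 1)"
    have cphi: "of_real (cmod (b 1)) * cis \<phi> = b 1"
      using cis_Arg[OF b0] b0 unfolding \<phi>_def by (simp add: sgn_div_norm scaleR_conv_of_real field_simps)
    have "cmod (cis \<phi> - 1) * cmod (b 1) = cmod (b 1 - of_real (cmod (b 1)))"
    proof -
      have "b 1 - of_real (cmod (b 1)) = of_real (cmod (b 1)) * (cis \<phi> - 1)"
        unfolding right_diff_distrib cphi by simp
      then show ?thesis by (simp only: norm_mult norm_of_real abs_norm_cancel mult.commute)
    qed
    also have "b 1 - of_real (cmod (b 1)) = w 1 + of_real (f1 - cmod (b 1))" using b1 by (simp add: algebra_simps)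
    also have "cmod (w 1 + of_real (f1 - cmod (b 1))) \<le> cmod (w 1) + \<bar>f1 - cmod (b 1)\<bar>" using norm_triangle_ineq[of "w 1" "of_real (f1 - cmod (b 1))"] by (simp only: norm_of_real)
    also have "\<dots> \<le> 2 * cmod (w 1)" using bn by linarith
    finally have "cmod (cis \<phi> - 1) * (f1 / 2) \<le> 2 * cmod (w 1)"
      using mult_left_mono[OF b_ge, of "cmod (cis \<phi> - 1)"] by simp
    then have cis_le: "cmod (cis \<phi> - 1) \<le> 4 / f1 * cmod (w 1)" using f1 by (simp add: field_simps)
    have cis_minus: "cmod (cis (- \<phi>) - 1) = cmod (cis \<phi> - 1)"
      using complex_mod_cnj[of "cis \<phi> - 1"] by (simp add: cis_cnj)
    define v where "v k = rot (- (\<theta> + \<phi>)) a k - profile k" for k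
    have "rot (- (\<theta> + \<phi>)) a = rot (- \<phi>) b" unfolding b_def rot_rot by (simp add: add.commute)
    then have v_eq: "v = (\<lambda>k. rot (- \<phi>) w k + (rot (- \<phi>) profile k - profile k))"
      unfolding v_def[abs_def] w_def[abs_def] rot_diff by auto
    have "rot (- (\<theta> + \<phi>)) a 1 = of_real (cmod (b 1))"
    proof -
      have "rot (- (\<theta> + \<phi>)) a 1 = cis (- \<phi>) * b 1" unfolding \<open>rot (- (\<theta> + \<phi>)) a = rot (- \<phi>) b\<close> by (simp add: rot_def)
      also have "\<dots> = of_real (cmod (b 1)) * (cis (- \<phi>) * cis \<phi>)" using cphi by (metis mult.left_commute)
      finally show ?thesis by (simp add: cis_mult)
    qed
    then have im: "Im (rot (- (\<theta> + \<phi>)) a 1 - profile 1) = 0" by (simp add: f1)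
    have "hsq v \<le> 2 * hsq (rot (- \<phi>) w) + 2 * hsq (\<lambda>k. rot (- \<phi>) profile k - profile k)"
      unfolding v_eq by (intro hsq_add_le decaying_rot decaying_diff dw decaying_profile)
    also have "\<dots> \<le> 2 * hsq w + 2 * (S * (cmod (cis \<phi> - 1))\<^sup>2)"
      using S(2)[of "- \<phi>"] unfolding hsq_rot cis_minus by simp
    also have "\<dots> \<le> 2 * hsq w + 2 * (S * (16 / f1\<^sup>2 * hsq w))"
    proof -
      have "(cmod (cis \<phi> - 1))\<^sup>2 \<le> (4 / f1 * cmod (w 1))\<^sup>2" by (intro power_mono cis_le) auto
      also have "\<dots> = 16 / f1\<^sup>2 * (cmod (w 1))\<^sup>2" by (simp add: power_mult_distrib power_divide)
      also have "\<dots> \<le> 16 / f1\<^sup>2 * hsq w" by (intro mult_left_mono w1) auto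
      finally have "S * (cmod (cis \<phi> - 1))\<^sup>2 \<le> S * (16 / f1\<^sup>2 * hsq w)" by (rule mult_left_mono[OF _ S(1)])
      then show ?thesis by linarith
    qed
    also have "\<dots> = C * hsq w" unfolding C_def by (simp add: algebra_simps)
    finally have "hsq v \<le> C * hsq (\<lambda>k. a k - rot \<theta> profile k)" unfolding hw .
    then show ?thesis using im unfolding v_def by blast
  qed
  moreover have "\<rho> > 0" using f1 by (simp add: \<rho>_def)
  ultimately show thesis using that C by blast
qed

text \<open>A bootstrap: near the orbit, conservation of the Lyapunov function improves a squared
  distance rho1 to rho2. Hence being within rho2 is a locally constant property of time, which
  spreads from time 0 to all times in both directions.\<close>

lemma sequence_stability:
  assumes "\<epsilon> > 0"
  obtains \<delta> where "\<delta> > 0"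
    "\<And>a \<theta> t. (\<And>t. decaying (a t)) \<Longrightarrow> (\<And>t. real_seq (a t)) \<Longrightarrow>
      (\<And>s t. momentum \<kappa> (a s) = momentum \<kappa> (a t)) \<Longrightarrow> (\<And>s t. energy (a s) = energy (a t)) \<Longrightarrow>
      (\<And>t. ((\<lambda>\<tau>. hsq (\<lambda>k. a \<tau> k - a t k)) \<longlongrightarrow> 0) (at t)) \<Longrightarrow>
      hsq (\<lambda>k. a (0 :: real) k - rot \<theta> profile k) \<le> \<delta> \<Longrightarrow> \<exists>\<theta>'. hsq (\<lambda>k. a t k - rot \<theta>' profile k) < \<epsilon>"
proof -
  obtain K N0 C1 C2 where pos: "N0 > 0" "C1 > 0" "C2 > 0"
    and lower: "\<And>v. decaying v \<Longrightarrow> real_seq v \<Longrightarrow> Im (v 1) = 0 \<Longrightarrow> hsq v \<le> N0 \<Longrightarrow> C1 * hsq v \<le> lyapunov K (\<lambda>k. profile k + v k)"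
    and upper: "\<And>v. decaying v \<Longrightarrow> real_seq v \<Longrightarrow> hsq v \<le> 1 \<Longrightarrow> lyapunov K (\<lambda>k. profile k + v k) \<le> C2 * hsq v"
    by (rule Lyapunov_function) blast
  obtain \<rho> C where \<rho>: "\<rho> > 0" "C > 0"
    and md: "\<And>a \<theta>. decaying a \<Longrightarrow> hsq (\<lambda>k. a k - rot \<theta> profile k) \<le> \<rho> \<Longrightarrow>
      \<exists>\<theta>'. Im (rot (- \<theta>') a 1 - profile 1) = 0 \<and>
        hsq (\<lambda>k. rot (- \<theta>') a k - profile k) \<le> C * hsq (\<lambda>k. a k - rot \<theta> profile k)"
    using modulation by blast
  have V_rot: "lyapunov K (rot \<theta> x) = lyapunov K x" for \<theta> x
    unfolding lyapunov_def momentum_rot energy_rot ..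
  \<comment> \<open>Modulation may enlarge the squared distance by the factor C, and the result must
    stay within N0.\<close>
  define \<rho>1 where "\<rho>1 = min \<rho> (N0 / C)"
  have \<rho>1: "\<rho>1 > 0" using \<rho> pos by (simp add: \<rho>1_def)
  have unrot: "hsq (\<lambda>k. rot (- \<theta>') x k - profile k) = hsq (\<lambda>k. x k - rot \<theta>' profile k)" for x \<theta>'
  proof -
    have "(\<lambda>k. rot (- \<theta>') x k - profile k) = rot (- \<theta>') (\<lambda>k. x k - rot \<theta>' profile k)"
      unfolding rot_diff rot_rot by simp
    then show ?thesis by (simp only: hsq_rot)
  qed
  have improve: "\<exists>\<theta>'. hsq (\<lambda>k. x k - rot \<theta>' profile k) \<le> lyapunov K x / C1"
    if dx: "decaying x" and rx: "real_seq x" and near: "hsq (\<lambda>k. x k - rot \<theta> profile k) \<le> \<rho>1" for x \<theta>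
  proof -
    have "hsq (\<lambda>k. x k - rot \<theta> profile k) \<le> \<rho>" using near by (simp add: \<rho>1_def)
    from md[OF dx this] obtain \<theta>' where im: "Im (rot (- \<theta>') x 1 - profile 1) = 0"
      and le: "hsq (\<lambda>k. rot (- \<theta>') x k - profile k) \<le> C * hsq (\<lambda>k. x k - rot \<theta> profile k)" by blast
    define v where "v k = rot (- \<theta>') x k - profile k" for k
    have dv: "decaying v" unfolding v_def[abs_def] by (intro decaying_diff decaying_rot dx decaying_profile)
    have rv: "real_seq v" using real_seq_rot[OF rx, of "- \<theta>'"] real_seq_profile unfolding v_def[abs_def] real_seq_def by simp
    have "C * hsq (\<lambda>k. x k - rot \<theta> profile k) \<le> C * (N0 / C)"
      using near \<rho> by (intro mult_left_mono) (auto simp: \<rho>1_def)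
    then have "hsq v \<le> N0" using le \<rho> unfolding v_def[abs_def] by simp
    then have "C1 * hsq v \<le> lyapunov K (\<lambda>k. profile k + v k)" using im by (intro lower dv rv) (simp_all add: v_def)
    also have "(\<lambda>k. profile k + v k) = rot (- \<theta>') x" by (auto simp: v_def)
    finally have "hsq v \<le> lyapunov K x / C1" using pos unfolding V_rot by (simp add: field_simps)
    then show ?thesis unfolding v_def[abs_def] unrot by blast
  qed
  \<comment> \<open>One quarter, because \<open>hsq_add_le\<close> doubles both squared distances;
    half of epsilon gives the strict inequality.\<close>
  define \<rho>2 where "\<rho>2 = min (\<rho>1 / 4) (\<epsilon> / 2)"
  \<comment> \<open>Small enough for the upper bound to apply, for time 0 to lie in the bootstrap
    region, and for the initial Lyapunov value to be at most C1 rho2.\<close>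
  define \<delta> where "\<delta> = min (min 1 \<rho>1) (C1 * \<rho>2 / C2)"
  have \<rho>2: "\<rho>2 > 0" using \<rho>1 assms by (simp add: \<rho>2_def)
  have \<delta>: "\<delta> > 0" using \<rho>1 \<rho>2 pos by (simp add: \<delta>_def)
  have "\<exists>\<theta>'. hsq (\<lambda>k. a t k - rot \<theta>' profile k) < \<epsilon>"
    if da: "\<And>t. decaying (a t)" and ra: "\<And>t. real_seq (a t)"
      and cm: "\<And>s t. momentum \<kappa> (a s) = momentum \<kappa> (a t)" and ce: "\<And>s t. energy (a s) = energy (a t)"
      and cont: "\<And>t. ((\<lambda>\<tau>. hsq (\<lambda>k. a \<tau> k - a t k)) \<longlongrightarrow> 0) (at t)"
      and init: "hsq (\<lambda>k. a (0 :: real) k - rot \<theta> profile k) \<le> \<delta>" for a \<theta> t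
  proof -
    have V_const: "lyapunov K (a s) = lyapunov K (a 0)" for s unfolding lyapunov_def using cm[of s 0] ce[of s 0] by simp
    have V_init: "lyapunov K (a 0) / C1 \<le> \<rho>2"
    proof -
      define v where "v k = rot (- \<theta>) (a 0) k - profile k" for k
      have dv: "decaying v" unfolding v_def[abs_def] by (intro decaying_diff decaying_rot da decaying_profile)
      have rv: "real_seq v" using real_seq_rot[OF ra, of "- \<theta>"] real_seq_profile unfolding v_def[abs_def] real_seq_def by simp
      have hv: "hsq v \<le> \<delta>" using init unfolding v_def[abs_def] unrot .
      then have "hsq v \<le> 1" by (simp add: \<delta>_def)
      from upper[OF dv rv this] have "lyapunov K (\<lambda>k. profile k + v k) \<le> C2 * hsq v" .
      also have "(\<lambda>k. profile k + v k) = rot (- \<theta>) (a 0)" by (auto simp: v_def)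
      finally have "lyapunov K (a 0) \<le> C2 * hsq v" unfolding V_rot .
      also have "\<dots> \<le> C2 * (C1 * \<rho>2 / C2)" using hv pos by (intro mult_left_mono) (auto simp: \<delta>_def)
      finally show ?thesis using pos by (simp add: field_simps)
    qed
    define A where "A s \<longleftrightarrow> (\<exists>\<theta>'. hsq (\<lambda>k. a s k - rot \<theta>' profile k) \<le> \<rho>2)" for s
    have imp: "A s" if nr: "hsq (\<lambda>k. a s k - rot \<theta>' profile k) \<le> \<rho>1" for s \<theta>'
    proof -
      obtain \<theta>'' where "hsq (\<lambda>k. a s k - rot \<theta>'' profile k) \<le> lyapunov K (a s) / C1" using improve[OF da ra nr] by blast
      also have "\<dots> \<le> \<rho>2" using V_init V_const[of s] by simp
      finally show ?thesis unfolding A_def by blast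
    qed
    have A0: "A 0" using imp[of 0 \<theta>] init by (simp add: \<delta>_def)
    have near: "A s'" if "A s" "hsq (\<lambda>k. a s' k - a s k) < \<rho>1 / 4" for s s'
    proof -
      obtain \<theta>' where h: "hsq (\<lambda>k. a s k - rot \<theta>' profile k) \<le> \<rho>2" using \<open>A s\<close> unfolding A_def by blast
      have "hsq (\<lambda>k. (a s' k - a s k) + (a s k - rot \<theta>' profile k)) \<le> 2 * hsq (\<lambda>k. a s' k - a s k) + 2 * hsq (\<lambda>k. a s k - rot \<theta>' profile k)"
        by (intro hsq_add_le decaying_diff da decaying_rot decaying_profile)
      also have "\<dots> \<le> \<rho>1" using that(2) h unfolding \<rho>2_def by simp
      finally have "hsq (\<lambda>k. a s' k - rot \<theta>' profile k) \<le> \<rho>1" by simp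
      then show ?thesis by (rule imp)
    qed
    \<comment> \<open>\<open>near\<close> can be used with the two times exchanged, so A and its
      negation are both open.\<close>
    have "\<forall>x\<in>UNIV. eventually (\<lambda>y. A x = A y) (at x within UNIV)"
    proof
      fix x :: real
      have "eventually (\<lambda>\<tau>. hsq (\<lambda>k. a \<tau> k - a x k) < \<rho>1 / 4) (at x)"
        using cont[of x] \<rho>1 by (intro order_tendstoD) auto
      then show "eventually (\<lambda>y. A x = A y) (at x within UNIV)"
      proof eventually_elim
        case (elim y)
        then show ?case using near[of x y] near[of y x] hsq_minus_commute[of "a x" "a y"] by auto
      qed
    qed
    then have "A t = A 0" by (intro connected_local_const[OF connected_UNIV]) auto
    with A0 obtain \<theta>' where "hsq (\<lambda>k. a t k - rot \<theta>' profile k) \<le> \<rho>2" unfolding A_def by blast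
    then show ?thesis using assms unfolding \<rho>2_def by (intro exI[of _ \<theta>']) auto
  qed
  with \<delta> show thesis by (rule that)
qed

end

section \<open>Solutions of the equation and the travelling wave\<close>

lemma weight_comparison:
  "sqrt (1 + (real_of_int k)\<^sup>2) \<le> 1 + real_of_int \<bar>k\<bar>" "1 + real_of_int \<bar>k\<bar> \<le> 2 * sqrt (1 + (real_of_int k)\<^sup>2)"
  "1 + real_of_int \<bar>k\<bar> \<le> 2 * (1 + (real_of_int k)\<^sup>2) powr (3/2)" "(1 + real_of_int \<bar>k\<bar>) ^ 3 \<le> 4 * (1 + (real_of_int k)\<^sup>2) powr (3/2)"
proof -
  let ?x = "\<bar>real_of_int k\<bar>"
  let ?s = "sqrt (1 + (real_of_int k)\<^sup>2)"
  have sq: "(real_of_int k)\<^sup>2 = ?x\<^sup>2" by simp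
  have "1 + ?x\<^sup>2 \<le> (1 + ?x)\<^sup>2" by (simp add: power2_eq_square algebra_simps)
  then show "?s \<le> 1 + real_of_int \<bar>k\<bar>" by (intro real_le_lsqrt) (simp_all)
  have le2: "(1 + ?x)\<^sup>2 \<le> 2 * (1 + ?x\<^sup>2)" using zero_le_power2[of "1 - ?x"] by (simp add: power2_eq_square algebra_simps)
  have s1: "?s \<ge> 1" by simp
  have s2: "?s\<^sup>2 = 1 + (real_of_int k)\<^sup>2" by simp
  have p: "(1 + (real_of_int k)\<^sup>2) powr (3/2) = ?s ^ 3"
  proof -
    have "(1 + (real_of_int k)\<^sup>2) powr (3/2) = ((1 + (real_of_int k)\<^sup>2) powr (1/2)) powr 3" by (simp add: powr_powr)
    also have "\<dots> = ?s ^ 3" by (simp add: powr_half_sqrt powr_numeral)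
    finally show ?thesis .
  qed
  \<comment> \<open>The constant 3/2 in place of sqrt 2 keeps everything rational, and its cube 27/8
    is still below 4.\<close>
  have e: "(3/2 * ?s)\<^sup>2 = 9/4 * (1 + ?x\<^sup>2)" unfolding power_mult_distrib s2 by (simp add: power_divide)
  have "2 * (1 + ?x\<^sup>2) \<le> 9/4 * (1 + ?x\<^sup>2)" by (intro mult_right_mono) auto
  with le2 have "(1 + ?x)\<^sup>2 \<le> (3/2 * ?s)\<^sup>2" unfolding e by (rule order_trans)
  then have h: "1 + ?x \<le> 3/2 * ?s" by (rule power2_le_imp_le) simp
  then show 2: "1 + real_of_int \<bar>k\<bar> \<le> 2 * ?s" using s1 by simp
  have "?s ^ 1 \<le> ?s ^ 3" by (rule power_increasing) (use s1 in auto)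
  then show "1 + real_of_int \<bar>k\<bar> \<le> 2 * (1 + (real_of_int k)\<^sup>2) powr (3/2)" unfolding p using 2 by simp
  have "(1 + ?x) ^ 3 \<le> (3/2 * ?s) ^ 3" by (intro power_mono h) simp
  also have "(3/2 * ?s) ^ 3 = 27/8 * ?s ^ 3" by (simp add: power_mult_distrib power_divide)
  also have "27/8 * ?s ^ 3 \<le> 4 * ?s ^ 3" by (intro mult_right_mono) auto
  finally show "(1 + real_of_int \<bar>k\<bar>) ^ 3 \<le> 4 * (1 + (real_of_int k)\<^sup>2) powr (3/2)" unfolding p by simp
qed

lemma decay_from_weighted_square:
  assumes "(1 + (real_of_int k)\<^sup>2) powr (3/2) * x\<^sup>2 \<le> B\<^sup>2" "B \<ge> 0"
  shows "x \<le> 2 * B * psi k"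
proof (rule power2_le_imp_le)
  have "(1 + real_of_int \<bar>k\<bar>) ^ 3 * x\<^sup>2 \<le> (4 * (1 + (real_of_int k)\<^sup>2) powr (3/2)) * x\<^sup>2"
    by (intro mult_right_mono weight_comparison) auto
  also have "\<dots> \<le> 4 * B\<^sup>2" using assms(1) by simp
  finally have "(1 + real_of_int \<bar>k\<bar>) ^ 3 * x\<^sup>2 * (psi k)\<^sup>2 \<le> 4 * B\<^sup>2 * (psi k)\<^sup>2"
    by (intro mult_right_mono) auto
  moreover have "(1 + real_of_int \<bar>k\<bar>) ^ 3 * x\<^sup>2 * (psi k)\<^sup>2 = x\<^sup>2 * ((1 + real_of_int \<bar>k\<bar>) ^ 3 * (psi k)\<^sup>2)" by (simp only: mult_ac)
  ultimately have "x\<^sup>2 \<le> 4 * B\<^sup>2 * (psi k)\<^sup>2" unfolding weight_psi_square by (simp only: mult_1_right)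
  then show "x\<^sup>2 \<le> (2 * B * psi k)\<^sup>2" by (simp add: power_mult_distrib)
qed (use assms psi_pos[of k] in simp)

abbreviation h32 :: "(int \<Rightarrow> complex) \<Rightarrow> int \<Rightarrow> real" where
  "h32 a k \<equiv> (1 + (real_of_int k)\<^sup>2) powr (3/2) * (cmod (a k))\<^sup>2"

lemma h32_bound:
  assumes "h32 a summable_on UNIV"
  shows "cmod (a k) \<le> 2 * sqrt (infsum (h32 a) UNIV) * psi k"
proof (rule decay_from_weighted_square)
  have "h32 a k \<le> infsum (h32 a) UNIV" using finite_sum_le_infsum[OF assms, of "{k}"] by simp
  moreover have "0 \<le> infsum (h32 a) UNIV" by (intro infsum_nonneg) auto
  ultimately show "h32 a k \<le> (sqrt (infsum (h32 a) UNIV))\<^sup>2" by simp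
qed (simp add: infsum_nonneg)

lemma h32_decaying: "h32 a summable_on UNIV \<Longrightarrow> decaying a"
  unfolding decaying_def using h32_bound by blast

lemma h32_diff_summable:
  assumes "h32 a summable_on UNIV" "h32 b summable_on UNIV"
  shows "h32 (\<lambda>k. a k - b k) summable_on UNIV"
proof (rule summable_on_comparison_test)
  show "(\<lambda>k. 2 * h32 a k + 2 * h32 b k) summable_on UNIV" by (intro summable_on_add summable_on_cmult_right assms)
  fix k :: int
  have "(cmod (a k - b k))\<^sup>2 \<le> (cmod (a k) + cmod (b k))\<^sup>2" by (intro power_mono norm_triangle_ineq4) auto
  also have "\<dots> \<le> 2 * (cmod (a k))\<^sup>2 + 2 * (cmod (b k))\<^sup>2"
    using zero_le_power2[of "cmod (a k) - cmod (b k)"] by (simp add: power2_eq_square algebra_simps)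
  finally have "h32 (\<lambda>k. a k - b k) k \<le> (1 + (real_of_int k)\<^sup>2) powr (3/2) * (2 * (cmod (a k))\<^sup>2 + 2 * (cmod (b k))\<^sup>2)"
    by (intro mult_left_mono) auto
  then show "h32 (\<lambda>k. a k - b k) k \<le> 2 * h32 a k + 2 * h32 b k" by (simp only: distrib_left mult.left_commute)
qed auto

lemma hsq_le_h32:
  assumes "h32 a summable_on UNIV"
  shows "hsq a \<le> 2 * infsum (h32 a) UNIV"
proof -
  have "hsq a \<le> (\<Sum>\<^sub>\<infinity>k. 2 * h32 a k)"
    unfolding hsq_def
  proof (rule infsum_mono[OF hsq_summable[OF h32_decaying[OF assms]] summable_on_cmult_right[OF assms]])
    fix k
    have "(1 + real_of_int \<bar>k\<bar>) * (cmod (a k))\<^sup>2 \<le> (2 * (1 + (real_of_int k)\<^sup>2) powr (3/2)) * (cmod (a k))\<^sup>2"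
      by (intro mult_right_mono weight_comparison) auto
    then show "(1 + real_of_int \<bar>k\<bar>) * (cmod (a k))\<^sup>2 \<le> 2 * h32 a k" by (simp only: mult.assoc)
  qed
  then show ?thesis by (simp add: infsum_cmult_right')
qed

text \<open>u u_x is half of (u^2)_x: the substitution of k - j for j averages the derivative
  factors k - j and j to k / 2.\<close>

lemma conv_derivative:
  assumes da: "decaying a"
  shows "conv a (\<lambda>k. of_int k * a k) k = of_int k * conv a a k / 2"
proof -
  obtain C where C: "C > 0" "\<And>k. cmod (a k) \<le> C * psi k" "\<And>k. cmod (a k) \<le> C" using decayingE[OF da] by metis
  let ?d = "\<lambda>k. of_int k * a k"
  have d: "cmod (?d k) \<le> C" for k by (rule derivative_bound[OF C(2)])
  have 1: "((\<lambda>j. a j * ?d (k - j)) has_sum conv a ?d k) UNIV" by (rule conv_term_summable[of a ?d C, OF da d])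
  have bij: "bij_betw (\<lambda>j. k - j) UNIV UNIV" by (rule bij_betw_byWitness[of _ "\<lambda>j. k - j"]) auto
  have "((\<lambda>j. a (k - j) * ?d (k - (k - j))) has_sum conv a ?d k) UNIV"
    by (rule has_sum_reindex_bij_betw[OF bij, of "\<lambda>j. a j * ?d (k - j)", THEN iffD2, OF 1])
  then have "((\<lambda>j. a j * ?d (k - j) + a (k - j) * ?d (k - (k - j))) has_sum (conv a ?d k + conv a ?d k)) UNIV"
    by (rule has_sum_add[OF 1])
  moreover have "a j * ?d (k - j) + a (k - j) * ?d (k - (k - j)) = of_int k * (a j * a (k - j))" for j
    by (simp add: algebra_simps)
  moreover have "((\<lambda>j. of_int k * (a j * a (k - j))) has_sum of_int k * conv a a k) UNIV"
    by (rule has_sum_cmult_right[OF conv_term_summable[of a a C, OF da C(3)]])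
  ultimately have "conv a ?d k + conv a ?d k = of_int k * conv a a k" using has_sum_unique by (simp only:) blast
  then show ?thesis by (simp add: field_simps)
qed

context torus
begin

lemma real_seq_fourier_coeff: "real_seq (fourier_coeff L f)"
  unfolding real_seq_def
proof
  fix k
  have "(\<integral>x. of_real (f x) * ch k x \<partial>M) = (\<integral>x. cnj (of_real (f x) * ch (- k) x) \<partial>M)"
    by (intro Bochner_Integration.integral_cong refl) (simp add: ch_def cis_cnj)
  also have "\<dots> = cnj (\<integral>x. of_real (f x) * ch (- k) x \<partial>M)" by (rule Bochner_Integration.integral_cnj)
  finally show "fourier_coeff L f (- k) = cnj (fourier_coeff L f k)"
    unfolding fourier_coeff_ch by simp
qed

lemma sobolev_per_integrable:
  assumes "f \<in> sobolev_per L s"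
  shows "integrable M f"
proof -
  interpret finite_measure M by (rule finite_measure_lebesgue_on) auto
  have "f \<in> borel_measurable M" "integrable M (\<lambda>x. f x ^ 2)" using assms unfolding sobolev_per_def by blast+
  then show ?thesis by (rule square_integrable_imp_integrable)
qed

lemma fourier_coeff_diff:
  assumes "integrable M f" "integrable M g"
  shows "fourier_coeff L (\<lambda>x. f x - g x) k = fourier_coeff L f k - fourier_coeff L g k"
proof -
  have "integrable M (\<lambda>x. of_real (f x) * ch (- k) x)" "integrable M (\<lambda>x. of_real (g x) * ch (- k) x)"
    using assms by (auto intro!: integrable_mult_ch)
  then show ?thesis unfolding fourier_coeff_ch by (simp add: left_diff_distrib right_diff_distrib)
qed

lemma sobolev_per_h32: "f \<in> sobolev_per L (3/2) \<Longrightarrow> h32 (fourier_coeff L f) summable_on UNIV"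
  by (simp add: sobolev_per_def)

lemma sobolev_norm_hsq:
  assumes "decaying (fourier_coeff L f)"
  shows "(sobolev_per_norm L (1/2) f)\<^sup>2 \<le> 2 * L * hsq (fourier_coeff L f)"
    "2 * L * hsq (fourier_coeff L f) \<le> 2 * (sobolev_per_norm L (1/2) f)\<^sup>2"
proof -
  let ?a = "fourier_coeff L f"
  let ?g = "\<lambda>k. (1 + (real_of_int k)\<^sup>2) powr (1/2) * (cmod (?a k))\<^sup>2"
  have g: "?g k \<le> (1 + real_of_int \<bar>k\<bar>) * (cmod (?a k))\<^sup>2" "(1 + real_of_int \<bar>k\<bar>) * (cmod (?a k))\<^sup>2 \<le> 2 * ?g k" for k
  proof -
    have "(1 + (real_of_int k)\<^sup>2) powr (1/2) = sqrt (1 + (real_of_int k)\<^sup>2)" by (simp add: powr_half_sqrt)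
    then show "?g k \<le> (1 + real_of_int \<bar>k\<bar>) * (cmod (?a k))\<^sup>2" "(1 + real_of_int \<bar>k\<bar>) * (cmod (?a k))\<^sup>2 \<le> 2 * ?g k"
      using mult_right_mono[OF weight_comparison(1)[of k], of "(cmod (?a k))\<^sup>2"] mult_right_mono[OF weight_comparison(2)[of k], of "(cmod (?a k))\<^sup>2"]
      by (simp_all only: mult.assoc) auto
  qed
  have sg: "?g summable_on UNIV"
    by (rule summable_on_comparison_test[OF hsq_summable[OF assms] g(1)]) auto
  have n: "(sobolev_per_norm L (1/2) f)\<^sup>2 = 2 * L * infsum ?g UNIV"
    unfolding sobolev_per_norm_def using L0 by (simp add: infsum_nonneg)
  have "infsum ?g UNIV \<le> hsq ?a" unfolding hsq_def by (rule infsum_mono[OF sg hsq_summable[OF assms] g(1)])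
  then show "(sobolev_per_norm L (1/2) f)\<^sup>2 \<le> 2 * L * hsq ?a" unfolding n using L0 by simp
  have "hsq ?a \<le> (\<Sum>\<^sub>\<infinity>k. 2 * ?g k)" unfolding hsq_def
    by (rule infsum_mono[OF hsq_summable[OF assms] summable_on_cmult_right[OF sg] g(2)])
  also have "\<dots> = 2 * infsum ?g UNIV" by (rule infsum_cmult_right')
  finally have "2 * L * hsq ?a \<le> 2 * L * (2 * infsum ?g UNIV)" using L0 by (intro mult_left_mono) auto
  then show "2 * L * hsq ?a \<le> 2 * (sobolev_per_norm L (1/2) f)\<^sup>2" unfolding n by simp
qed

lemma sobolev_continuous_hsq:
  assumes "sobolev_continuous L (3/2) u"
  shows "((\<lambda>\<tau>. infsum (h32 (\<lambda>k. fourier_coeff L (u \<tau>) k - fourier_coeff L (u t) k)) UNIV) \<longlongrightarrow> 0) (at t)"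
proof -
  have u: "u t \<in> sobolev_per L (3/2)" for t using assms unfolding sobolev_continuous_def by blast
  have "fourier_coeff L (\<lambda>x. u \<tau> x - u t x) = (\<lambda>k. fourier_coeff L (u \<tau>) k - fourier_coeff L (u t) k)" for \<tau>
    by (intro ext fourier_coeff_diff sobolev_per_integrable[OF u])
  then have n: "(sobolev_per_norm L (3/2) (\<lambda>x. u \<tau> x - u t x))\<^sup>2 / (2 * L) = infsum (h32 (\<lambda>k. fourier_coeff L (u \<tau>) k - fourier_coeff L (u t) k)) UNIV" for \<tau>
    unfolding sobolev_per_norm_def using L0 by (simp add: infsum_nonneg)
  have "((\<lambda>\<tau>. sobolev_per_norm L (3/2) (\<lambda>x. u \<tau> x - u t x)) \<longlongrightarrow> 0) (at t)"
    using assms unfolding sobolev_continuous_def by blast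
  then have "((\<lambda>\<tau>. (sobolev_per_norm L (3/2) (\<lambda>x. u \<tau> x - u t x))\<^sup>2 / (2 * L)) \<longlongrightarrow> 0\<^sup>2 / (2 * L)) (at t)"
    by (intro tendsto_intros) (use L0 in auto)
  then show ?thesis unfolding n by simp
qed

text \<open>The Hilbert transform of the derivative has symbol kappa |k|, so the equation can be
  solved for the time derivative. Continuity in H^(3/2) makes the pointwise decay uniform near each
  time.\<close>

lemma rBO_solution_flow:
  assumes sol: "rBO_solution L u"
  shows "rbo_flow (pi / L) (\<lambda>t. fourier_coeff L (u t))"
proof
  let ?a = "\<lambda>t. fourier_coeff L (u t)"
  let ?\<kappa> = "pi / L"
  show k0: "?\<kappa> > 0" using L0 by simp
  show "real_seq (?a t)" for t by (rule real_seq_fourier_coeff)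
  have sc: "sobolev_continuous L (3/2) u" using sol by (simp add: rBO_solution_def)
  have u: "u t \<in> sobolev_per L (3/2)" for t using sc unfolding sobolev_continuous_def by blast
  note h = sobolev_per_h32[OF u]
  show "\<exists>C e. e > 0 \<and> (\<forall>s. \<bar>s - t\<bar> < e \<longrightarrow> (\<forall>k. cmod (?a s k) \<le> C * psi k))" for t
  proof -
    let ?D = "\<lambda>\<tau>. infsum (h32 (\<lambda>k. ?a \<tau> k - ?a t k)) UNIV"
    have "eventually (\<lambda>\<tau>. ?D \<tau> < 1) (at t)"
      using sobolev_continuous_hsq[OF sc] by (intro order_tendstoD) auto
    then obtain e where e: "e > 0" and De: "\<And>\<tau>. \<tau> \<noteq> t \<Longrightarrow> dist \<tau> t < e \<Longrightarrow> ?D \<tau> < 1"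
      unfolding eventually_at by blast
    let ?C = "2 * sqrt (infsum (h32 (?a t)) UNIV) + 2"
    have "cmod (?a s k) \<le> ?C * psi k" if "\<bar>s - t\<bar> < e" for s k
    proof -
      have "cmod (?a s k - ?a t k) \<le> 2 * psi k"
      \<comment> \<open>The limit \<open>at t\<close> says nothing about the time t itself.\<close>
      proof (cases "s = t")
        case False
        have "cmod (?a s k - ?a t k) \<le> 2 * sqrt (?D s) * psi k"
          by (rule h32_bound[OF h32_diff_summable[OF h h]])
        also have "\<dots> \<le> 2 * 1 * psi k"
          using De[OF False] that psi_pos[of k] by (intro mult_right_mono mult_left_mono) (auto simp: dist_real_def)
        finally show ?thesis by simp
      qed (use psi_pos[of k] in simp)
      moreover have "cmod (?a t k) \<le> 2 * sqrt (infsum (h32 (?a t)) UNIV) * psi k" by (rule h32_bound[OF h])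
      ultimately show ?thesis using norm_triangle_ineq[of "?a t k" "?a s k - ?a t k"] by (simp add: distrib_right)
    qed
    with e show ?thesis by blast
  qed
  fix t k
  have da: "decaying (?a t)" by (rule h32_decaying[OF h])
  obtain ut ux where ux: "ux \<in> sobolev_per L (1/2)"
    and ut: "((\<lambda>\<tau>. ?a \<tau> k) has_vector_derivative ut k) (at t)"
    and uxh: "fourier_coeff L ux = deriv_hat L (?a t)"
    and eq: "ut k + fourier_coeff L ux k + fourier_coeff L (\<lambda>x. u t x * ux x) k + hilbert_hat (deriv_hat L ut) k = 0"
    using sol unfolding rBO_solution_def by blast
  have "fourier_coeff L (\<lambda>x. u t x * ux x) k = conv (?a t) (fourier_coeff L ux) k"
    by (rule fourier_coeff_product[OF sobolev_per_integrable[OF u] sobolev_per_integrable[OF ux] decaying_norm_summable[OF da]])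
  also have "\<dots> = \<i> * of_real ?\<kappa> * conv (?a t) (\<lambda>k. of_int k * ?a t k) k"
    unfolding uxh deriv_hat_def conv_def by (subst infsum_cmult_right'[symmetric]) (simp add: mult_ac)
  finally have prod: "fourier_coeff L (\<lambda>x. u t x * ux x) k = \<i> * of_real ?\<kappa> * (of_int k * conv (?a t) (?a t) k / 2)"
    unfolding conv_derivative[OF da] .
  have hil: "hilbert_hat (deriv_hat L ut) k = of_real (?\<kappa> * of_int \<bar>k\<bar>) * ut k"
  proof -
    have "of_int (sgn k) * of_int k = (of_int \<bar>k\<bar> :: complex)" by (simp add: sgn_if)
    moreover have "hilbert_hat (deriv_hat L ut) k = (of_int (sgn k) * of_int k) * of_real ?\<kappa> * ut k"
      unfolding hilbert_hat_def deriv_hat_def by (simp add: algebra_simps)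
    ultimately show ?thesis by (simp only: of_real_mult of_real_of_int_eq mult_ac)
  qed
  have p: "1 + ?\<kappa> * of_int \<bar>k\<bar> > 0" using L0 by (intro add_pos_nonneg) auto
  have "of_real (1 + ?\<kappa> * of_int \<bar>k\<bar>) * ut k = - \<i> * of_real (?\<kappa> * of_int k) * (?a t k + conv (?a t) (?a t) k / 2)"
  proof -
    have "ut k + \<i> * of_int k * of_real ?\<kappa> * ?a t k + \<i> * of_real ?\<kappa> * (of_int k * conv (?a t) (?a t) k / 2) + of_real (?\<kappa> * of_int \<bar>k\<bar>) * ut k = 0"
      using eq unfolding prod hil uxh deriv_hat_def .
    then show ?thesis unfolding of_real_add of_real_mult of_real_of_int_eq of_real_1 by (simp add: eq_neg_iff_add_eq_0 algebra_simps)
  qed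
  moreover have "x = - \<i> * of_real (m / P) * g" if "of_real P * x = - \<i> * of_real m * g" "P > 0" for P m :: real and x g :: complex
    using that by (simp add: field_simps)
  ultimately have "ut k = - \<i> * of_real (?\<kappa> * of_int k / (1 + ?\<kappa> * of_int \<bar>k\<bar>)) * (?a t k + conv (?a t) (?a t) k / 2)"
    using p by blast
  with ut show "((\<lambda>\<tau>. ?a \<tau> k) has_vector_derivative
      (- \<i> * of_real (?\<kappa> * of_int k / (1 + ?\<kappa> * of_int \<bar>k\<bar>)) * (?a t k + conv (?a t) (?a t) k / 2))) (at t)" by simp
qed

text \<open>The coefficients \<open>ch k x\<close>, for fixed \<open>x\<close>, are an eigenvector of \<open>kinv\<close>.\<close>

lemma Poisson_kernel_series:
  assumes "0 < r" "r < 1"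
  shows "fseries (\<lambda>k. of_real (ker r k)) x = of_real ((1 - r\<^sup>2) / (1 + r\<^sup>2 - 2 * r * cos (pi * x / L)))"
proof -
  interpret poisson_kernel r by unfold_locales (use assms in auto)
  let ?y = "\<lambda>k. ch k x"
  let ?D = "1 + r\<^sup>2 - 2 * r * cos (pi * x / L)"
  have "ch 1 x + ch (- 1) x = of_real (2 * cos (pi * x / L))"
    by (simp add: ch_def complex_eq_iff)
  then have t: "of_real r * ch 1 x + of_real r * ch (- 1) x = of_real (2 * r * cos (pi * x / L))"
    unfolding distrib_left[symmetric] by simp
  have "kinv r ?y = (\<lambda>k. of_real (?D / (1 - r\<^sup>2)) * ?y k)"
  proof
    fix k
    have "kinv r ?y k = (of_real (1 + r\<^sup>2) - (of_real r * ch 1 x + of_real r * ch (- 1) x)) / of_real (1 - r\<^sup>2) * ch k x"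
      unfolding kinv_def using ch_mult[of k x 1] ch_mult[of k x "- 1"] by (simp add: algebra_simps)
    then show "kinv r ?y k = of_real (?D / (1 - r\<^sup>2)) * ?y k" unfolding t by simp
  qed
  then have "kconv r (kinv r ?y) 0 = of_real (?D / (1 - r\<^sup>2)) * kconv r ?y 0" by (simp only: kconv_cmult)
  moreover have "kconv r (kinv r ?y) 0 = 1" by (subst kconv_kinv[of ?y 1 0]) auto
  ultimately have "of_real (?D / (1 - r\<^sup>2)) * kconv r ?y 0 = 1" by (simp only:)
  moreover have "kconv r ?y 0 = fseries (\<lambda>k. of_real (ker r k)) x"
    unfolding kconv_def fseries_def by simp
  ultimately have "of_real (?D / (1 - r\<^sup>2)) * fseries (\<lambda>k. of_real (ker r k)) x = 1" by simp
  then have "fseries (\<lambda>k. of_real (ker r k)) x = inverse (of_real (?D / (1 - r\<^sup>2)))"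
    using inverse_unique by metis
  also have "\<dots> = of_real (inverse (?D / (1 - r\<^sup>2)))" by (simp only: of_real_inverse)
  finally show ?thesis by (simp only: inverse_divide)
qed

end

theorem theorem7p1:
  fixes L c :: real
  assumes "L > pi" and "c > 1 + pi / (L - pi)"
  shows "\<forall>\<epsilon>>0. \<exists>\<delta>>0. \<forall>u0 u.
           u0 \<in> sobolev_per L (3/2) \<longrightarrow>
           (INF y. sobolev_per_norm L (1/2) (\<lambda>x. u0 x - rBO_wave L c (x + y))) < \<delta> \<longrightarrow>
           rBO_solution L u \<longrightarrow>
           (AE x in lebesgue. u 0 x = u0 x) \<longrightarrow>
           (\<forall>t. \<exists>y. sobolev_per_norm L (1/2) (\<lambda>x. u t x - rBO_wave L c (x + y)) < \<epsilon>)"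
proof -
  have L0: "L > 0" using assms(1) pi_gt_zero by linarith
  interpret torus L by unfold_locales (rule L0)
  define \<kappa> where "\<kappa> = pi / L"
  have \<kappa>: "0 < \<kappa>" "\<kappa> < 1" using assms(1) L0 by (simp_all add: \<kappa>_def)
  have "pi / (L - pi) > 0" using assms(1) by simp
  then have c1: "c > 1" using assms(2) by linarith
  define q where "q = c * pi / ((c - 1) * L)"
  define \<eta> where "\<eta> = artanh q"
  have q0: "0 < q" using c1 L0 by (simp add: q_def)
  \<comment> \<open>The assumption on c is exactly q < 1, which makes the argument of
    \<open>artanh\<close> admissible.\<close>
  have q1: "q < 1"
  proof -
    have "pi < (c - 1) * (L - pi)" using assms by (simp add: field_simps)
    then have "c * pi < (c - 1) * L" by (simp add: algebra_simps)
    then show ?thesis using c1 L0 by (simp add: q_def)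
  qed
  define r where "r = exp (- \<eta>)"
  have r2: "r\<^sup>2 = (1 - q) / (1 + q)"
  proof -
    have "r\<^sup>2 = exp (- (2 * \<eta>))" by (simp add: r_def power2_eq_square flip: exp_add)
    also have "2 * \<eta> = ln ((1 + q) / (1 - q))" by (simp add: \<eta>_def artanh_def)
    also have "exp (- \<dots>) = (1 - q) / (1 + q)" using q0 q1 by (simp add: exp_minus)
    finally show ?thesis .
  qed
  have r0: "0 < r" by (simp add: r_def)
  have "r\<^sup>2 < 1\<^sup>2" unfolding r2 using q0 q1 by simp
  then have r1: "r < 1" by (rule power2_less_imp_less) simp
  interpret pk: poisson_kernel r by unfold_locales (rule r0 r1)+
  \<comment> \<open>With q = tanh eta this is coth eta, and \<open>speed\<close> becomes a
    restatement of the definition of q.\<close>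
  have omega: "pk.\<omega> = 1 / q"
  proof -
    have e: "1 + (1 - q) / (1 + q) = 2 / (1 + q)" "1 - (1 - q) / (1 + q) = 2 * q / (1 + q)"
      using q0 by (simp_all add: field_simps)
    have "(2 / s) / (2 * q / s) = 1 / q" if "s \<noteq> 0" for s :: real using that q0 by simp
    then show ?thesis unfolding pk.\<omega>_def r2 e using q0 by (simp only:)
  qed
  have speed: "c * \<kappa> * pk.\<omega> = c - 1" unfolding omega q_def \<kappa>_def using c1 L0 by simp
  interpret rbo_wave r c \<kappa> by unfold_locales (use \<kappa> c1 speed in simp_all)
  have wave: "rBO_wave L c \<xi> = 2 * c * \<kappa> * ((1 - r\<^sup>2) / (1 + r\<^sup>2 - 2 * r * cos (pi * \<xi> / L)))" for \<xi>
  proof -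
    let ?C = "cos (pi * \<xi> / L)"
    have e: "exp \<eta> = 1 / r" by (simp add: r_def exp_minus divide_inverse)
    have s: "sinh \<eta> = (1 - r\<^sup>2) / (2 * r)" "cosh \<eta> = (1 + r\<^sup>2) / (2 * r)"
      unfolding sinh_field_def cosh_field_def r_def[symmetric] e using r0 by (simp_all add: power2_eq_square field_simps)
    have "sinh \<eta> / (cosh \<eta> - ?C) = ((1 - r\<^sup>2) / (2 * r)) / ((1 + r\<^sup>2 - 2 * r * ?C) / (2 * r))"
      unfolding s using r0 by (simp add: diff_divide_distrib)
    also have "\<dots> = (1 - r\<^sup>2) / (1 + r\<^sup>2 - 2 * r * ?C)" using r0 by simp
    finally have "sinh \<eta> / (cosh \<eta> - ?C) = (1 - r\<^sup>2) / (1 + r\<^sup>2 - 2 * r * ?C)" .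
    then show ?thesis unfolding rBO_wave_def Let_def q_def[symmetric] \<eta>_def[symmetric] \<kappa>_def by simp
  qed
  have wave_series: "of_real (rBO_wave L c (x + y)) = fseries (rot (\<kappa> * y) profile) x" for x y
  proof -
    have "of_real (rBO_wave L c (x + y)) = of_real (2 * c * \<kappa>) * fseries (\<lambda>k. of_real (ker r k)) (x + y)"
      unfolding wave Poisson_kernel_series[OF r0 r1] of_real_mult ..
    also have "\<dots> = (\<Sum>\<^sub>\<infinity>k. of_real (2 * c * \<kappa>) * (of_real (ker r k) * ch k (x + y)))"
      unfolding fseries_def by (rule infsum_cmult_right'[symmetric])
    also have "\<dots> = fseries (rot (\<kappa> * y) profile) x"
      unfolding fseries_def
    proof (rule infsum_cong)
      fix k
      have "ch k (x + y) = cis (of_int k * (\<kappa> * y)) * ch k x"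
        unfolding ch_def \<kappa>_def cis_mult by (simp add: algebra_simps add_divide_distrib)
      then show "of_real (2 * c * \<kappa>) * (of_real (ker r k) * ch k (x + y)) = rot (\<kappa> * y) profile k * ch k x"
        unfolding rot_def profile_def pk.P_def by (simp only: mult_ac)
    qed
    finally show ?thesis .
  qed
  have dR: "decaying (rot \<theta> profile)" for \<theta> by (intro decaying_rot decaying_profile)
  have wave_coeff: "fourier_coeff L (\<lambda>x. rBO_wave L c (x + y)) = rot (\<kappa> * y) profile" for y
  proof
    fix k
    show "fourier_coeff L (\<lambda>x. rBO_wave L c (x + y)) k = rot (\<kappa> * y) profile k"
      unfolding fourier_coeff_ch wave_series fseries_coeff[OF decaying_norm_summable[OF dR]] using L0 by simp
  qed
  have wave_int: "integrable M (\<lambda>x. rBO_wave L c (x + y))" for y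
  proof -
    have "integrable M (\<lambda>x. fseries (rot (\<kappa> * y) profile) x * ch 0 x)"
      by (rule fseries_integral(2)[OF decaying_norm_summable[OF dR] integrable_ch])
    then have "integrable M (\<lambda>x. complex_of_real (rBO_wave L c (x + y)))" unfolding wave_series by simp
    from integrable_Re[OF this] show ?thesis by simp
  qed
  have dist_coeff: "fourier_coeff L (\<lambda>x. v x - rBO_wave L c (x + y)) = (\<lambda>k. fourier_coeff L v k - rot (\<kappa> * y) profile k)"
    "decaying (fourier_coeff L (\<lambda>x. v x - rBO_wave L c (x + y)))"
    if v: "v \<in> sobolev_per L (3/2)" for v y
  proof -
    show 1: "fourier_coeff L (\<lambda>x. v x - rBO_wave L c (x + y)) = (\<lambda>k. fourier_coeff L v k - rot (\<kappa> * y) profile k)"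
      unfolding wave_coeff[symmetric] by (intro ext fourier_coeff_diff sobolev_per_integrable[OF v] wave_int)
    show "decaying (fourier_coeff L (\<lambda>x. v x - rBO_wave L c (x + y)))"
      unfolding 1 by (intro decaying_diff dR h32_decaying sobolev_per_h32 v)
  qed
  show ?thesis
  proof (intro allI impI)
    fix \<epsilon> :: real assume eps: "\<epsilon> > 0"
    have eps': "\<epsilon>\<^sup>2 / (2 * L) > 0" using eps L0 by simp
    obtain d where d: "d > 0" and stab: "\<And>a \<theta> t. (\<And>t. decaying (a t)) \<Longrightarrow> (\<And>t. real_seq (a t)) \<Longrightarrow>
      (\<And>s t. momentum \<kappa> (a s) = momentum \<kappa> (a t)) \<Longrightarrow> (\<And>s t. energy (a s) = energy (a t)) \<Longrightarrow>
      (\<And>t. ((\<lambda>\<tau>. hsq (\<lambda>k. a \<tau> k - a t k)) \<longlongrightarrow> 0) (at t)) \<Longrightarrow>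
      hsq (\<lambda>k. a (0 :: real) k - rot \<theta> profile k) \<le> d \<Longrightarrow> \<exists>\<theta>'. hsq (\<lambda>k. a t k - rot \<theta>' profile k) < \<epsilon>\<^sup>2 / (2 * L)"
      by (rule sequence_stability[OF eps']) blast
    \<comment> \<open>Since 2 L \<open>hsq\<close> is at most twice the squared Sobolev norm,
      delta^2 = L d ensures that \<open>hsq\<close> is at most d.\<close>
    define \<delta> where "\<delta> = sqrt (L * d)"
    have \<delta>: "\<delta> > 0" "\<delta>\<^sup>2 = L * d" using L0 d by (simp_all add: \<delta>_def)
    have "\<exists>y. sobolev_per_norm L (1/2) (\<lambda>x. u t x - rBO_wave L c (x + y)) < \<epsilon>"
      if u0: "u0 \<in> sobolev_per L (3/2)"
        and init: "(INF y. sobolev_per_norm L (1/2) (\<lambda>x. u0 x - rBO_wave L c (x + y))) < \<delta>"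
        and sol: "rBO_solution L u" and ae: "AE x in lebesgue. u 0 x = u0 x" for u0 u t
    proof -
      let ?a = "\<lambda>t. fourier_coeff L (u t)"
      interpret rbo_flow \<kappa> ?a unfolding \<kappa>_def by (rule rBO_solution_flow[OF sol])
      have sc: "sobolev_continuous L (3/2) u" using sol by (simp add: rBO_solution_def)
      have u: "u t \<in> sobolev_per L (3/2)" for t using sc unfolding sobolev_continuous_def by blast
      have nonneg: "sobolev_per_norm L s f \<ge> 0" for s f
        unfolding sobolev_per_norm_def using L0 by (intro real_sqrt_ge_zero mult_nonneg_nonneg infsum_nonneg) auto
      \<comment> \<open>The infimum need not be attained: some translation has norm below delta,
        provided the infimum is taken over a set bounded below.\<close>
      have "bdd_below (range (\<lambda>y. sobolev_per_norm L (1/2) (\<lambda>x. u0 x - rBO_wave L c (x + y))))"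
        by (rule bdd_belowI[of _ 0]) (use nonneg in auto)
      with init obtain y where y: "sobolev_per_norm L (1/2) (\<lambda>x. u0 x - rBO_wave L c (x + y)) < \<delta>"
        by (subst (asm) cINF_less_iff) auto
      \<comment> \<open>The solution agrees with the datum almost everywhere, and Fourier
        coefficients do not see null sets.\<close>
      have aeM: "AE x in M. u 0 x = u0 x" using ae by (subst AE_restrict_space_iff) auto
      have "(\<integral>x. of_real (u 0 x) * ch (- k) x \<partial>M) = (\<integral>x. of_real (u0 x) * ch (- k) x \<partial>M)" for k
      proof (rule integral_cong_AE)
        have "integrable M (\<lambda>x. complex_of_real (u 0 x))" "integrable M (\<lambda>x. complex_of_real (u0 x))"
          using sobolev_per_integrable[OF u] sobolev_per_integrable[OF u0] by simp_all
        then show "(\<lambda>x. of_real (u 0 x) * ch (- k) x) \<in> borel_measurable M" "(\<lambda>x. of_real (u0 x) * ch (- k) x) \<in> borel_measurable M"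
          using integrable_mult_ch borel_measurable_integrable by blast+
        show "AE x in M. complex_of_real (u 0 x) * ch (- k) x = of_real (u0 x) * ch (- k) x"
          using aeM by eventually_elim simp
      qed
      then have a0: "?a 0 = fourier_coeff L u0" unfolding fourier_coeff_ch by auto
      have "2 * L * hsq (\<lambda>k. ?a 0 k - rot (\<kappa> * y) profile k) \<le> 2 * (sobolev_per_norm L (1/2) (\<lambda>x. u0 x - rBO_wave L c (x + y)))\<^sup>2"
        using sobolev_norm_hsq(2)[OF dist_coeff(2)[OF u0]] unfolding dist_coeff(1)[OF u0] a0 .
      also have "\<dots> \<le> 2 * \<delta>\<^sup>2" using y nonneg by (intro mult_left_mono power_mono) auto
      finally have h0: "hsq (\<lambda>k. ?a 0 k - rot (\<kappa> * y) profile k) \<le> d" unfolding \<delta> using L0 by simp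
      have cont: "((\<lambda>\<tau>. hsq (\<lambda>k. ?a \<tau> k - ?a t k)) \<longlongrightarrow> 0) (at t)" for t
      proof (rule tendsto_sandwich[OF _ _ tendsto_const])
        have "((\<lambda>\<tau>. 2 * infsum (h32 (\<lambda>k. ?a \<tau> k - ?a t k)) UNIV) \<longlongrightarrow> 2 * 0) (at t)"
          by (intro tendsto_mult tendsto_const sobolev_continuous_hsq[OF sc])
        then show "((\<lambda>\<tau>. 2 * infsum (h32 (\<lambda>k. ?a \<tau> k - ?a t k)) UNIV) \<longlongrightarrow> 0) (at t)" by simp
        show "eventually (\<lambda>\<tau>. 0 \<le> hsq (\<lambda>k. ?a \<tau> k - ?a t k)) (at t)" by (simp add: hsq_nonneg)
        show "eventually (\<lambda>\<tau>. hsq (\<lambda>k. ?a \<tau> k - ?a t k) \<le> 2 * infsum (h32 (\<lambda>k. ?a \<tau> k - ?a t k)) UNIV) (at t)"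
          by (intro always_eventually allI hsq_le_h32 h32_diff_summable sobolev_per_h32 u)
      qed
      obtain \<theta> where \<theta>: "hsq (\<lambda>k. ?a t k - rot \<theta> profile k) < \<epsilon>\<^sup>2 / (2 * L)"
        using stab[of ?a "\<kappa> * y" t, OF decaying_a real conservation_laws(1) conservation_laws(2) cont h0] by blast
      define z where "z = \<theta> / \<kappa>"
      have z: "\<kappa> * z = \<theta>" using \<kappa> by (simp add: z_def)
      have "(sobolev_per_norm L (1/2) (\<lambda>x. u t x - rBO_wave L c (x + z)))\<^sup>2 \<le> 2 * L * hsq (\<lambda>k. ?a t k - rot \<theta> profile k)"
        using sobolev_norm_hsq(1)[OF dist_coeff(2)[OF u, of t z]] unfolding dist_coeff(1)[OF u] z .
      also have "\<dots> < \<epsilon>\<^sup>2" using \<theta> L0 by (simp add: field_simps)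
      finally have "sobolev_per_norm L (1/2) (\<lambda>x. u t x - rBO_wave L c (x + z)) < \<epsilon>"
        by (rule power2_less_imp_less) (use eps in simp)
      then show ?thesis by blast
    qed
    with \<delta>(1) show "\<exists>\<delta>>0. \<forall>u0 u. u0 \<in> sobolev_per L (3/2) \<longrightarrow>
           (INF y. sobolev_per_norm L (1/2) (\<lambda>x. u0 x - rBO_wave L c (x + y))) < \<delta> \<longrightarrow>
           rBO_solution L u \<longrightarrow> (AE x in lebesgue. u 0 x = u0 x) \<longrightarrow>
           (\<forall>t. \<exists>y. sobolev_per_norm L (1/2) (\<lambda>x. u t x - rBO_wave L c (x + y)) < \<epsilon>)"
      by blast
  qed
qed

end
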